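(* Let $f\colon [0,1]\to\{1,2,3,\ldots\}\cup\{\omega,\mathfrak{c}\}$ be a function. There exists a continuous function $F\colon[0,1]\to[0,1]$ with $F(0)=0$, $F(1)=1$ and $|F^{-1}(y)|=f(y)$ for every $y\in[0,1]$ if and only if the following three conditions hold. (1) For every $y\in(0,1)$ such that $f(y)$ is finite there exists $\varepsilon>0$ such that for all $y_1,y_2\in[0,1]$ with $y-\varepsilon<y_1<y<y_2<y+\varepsilon$ we have $$f(y_1)+f(y_2)\ge 2f(y),$$ and equality can hold only if at least one (equivalently, both) of $f(y_1)$ and $f(y_2)$ is odd. Moreover, if $f(0)$ is finite, there exists $\varepsilon>0$ such that for all $y_2\in[0,1]$, $0<y_2<\varepsilon$ implies $1+f(y_2)\ge 2f(0)$; and if $f(1)$ is finite, there exists $\varepsilon>0$ such that for all $y_1\in[0,1]$, $1-\varepsilon<y_1<1$ implies $f(y_1)+1\ge 2f(1)$. (2) There is a countable set $C\subseteq\{y\in[0,1]: f(y)=\mathfrak{c}\}$ such that for every $y\in[0,1]\setminus C$ with $f(y)\in\{\omega,\mathfrak{c}\}$ and every natural number $n$ there exists $\varepsilon>0$ such that: - if $y\in(0,1)$, then $f(y_1)+f(y_2)\ge n$ for all $y_1,y_2\in[0,1]$ with $y-\varepsilon<y_1<y<y_2<y+\varepsilon$; - if $y=0$, then $1+f(y_2)\ge n$ for all $y_2\in[0,1]$ with $0<y_2<\varepsilon$; - if $y=1$, then $f(y_1)+1\ge n$ for all $y_1\in[0,1]$ with $1-\varepsilon<y_1<1$. (3) The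 set $\{y\in[0,1]: f(y)=\mathfrak{c}\}$ is analytic.
   Context: Here $\omega=\aleph_0$ is the cardinality of a countably infinite set, $\mathfrak{c}=2^{\aleph_0}$ is the cardinality of the continuum, and $|A|$ denotes the cardinality of $A$. Sums and inequalities involving the values $\omega,\mathfrak{c}$ are understood in cardinal arithmetic; infinite values are larger than every natural number and are neither odd nor even. "Countable" means finite (possibly empty) or countably infinite. A set is analytic if it is empty or a continuous image of the Baire space $\omega^\omega$. *)

theory Defs
  imports "HOL-Analysis.Analysis" "HOL-Library.Equipollence" "HOL-Library.Nat_Bijection"
begin

text \<open>The cardinals that can occur as fibre sizes. The value \<open>Fin 0\<close> is included so that every
  natural number is available for comparison.\<close>

datatype cardval = Fin nat | Aleph0 | Continuum

instantiation cardval :: linorder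
begin

definition less_eq_cardval :: "cardval \<Rightarrow> cardval \<Rightarrow> bool" where
  "a \<le> b \<longleftrightarrow> (case b of Fin n \<Rightarrow> (\<exists>m\<le>n. a = Fin m) | Aleph0 \<Rightarrow> a \<noteq> Continuum | Continuum \<Rightarrow> True)"

definition less_cardval :: "cardval \<Rightarrow> cardval \<Rightarrow> bool" where
  "a < b \<longleftrightarrow> a \<le> b \<and> \<not> b \<le> (a::cardval)"

instance
  by standard (auto simp: less_eq_cardval_def less_cardval_def split: cardval.splits;
    metis cardval.exhaust nle_le)+

end

instantiation cardval :: comm_monoid_add
begin

definition zero_cardval :: cardval where
  "0 = Fin 0"

fun plus_cardval :: "cardval \<Rightarrow> cardval \<Rightarrow> cardval" where
  "Fin m + Fin n = Fin (m + n)"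
| "Continuum + _ = Continuum"
| "_ + Continuum = Continuum"
| "_ + _ = Aleph0"

instance
proof
  fix a b c :: cardval
  show "a + b + c = a + (b + c)" by (cases a; cases b; cases c) auto
  show "a + b = b + a" by (cases a; cases b) auto
  show "0 + a = a" by (cases a) (auto simp: zero_cardval_def)
qed

end

fun has_card :: "'a set \<Rightarrow> cardval \<Rightarrow> bool" where
  "has_card A (Fin n) \<longleftrightarrow> finite A \<and> card A = n"
| "has_card A Aleph0 \<longleftrightarrow> A \<approx> (UNIV :: nat set)"
| "has_card A Continuum \<longleftrightarrow> A \<approx> (UNIV :: nat set set)"

definition odd_card :: "cardval \<Rightarrow> bool" where
  "odd_card a \<longleftrightarrow> (\<exists>n. a = Fin n \<and> odd n)"

text \<open>The Baire space is the type \<open>nat \<Rightarrow> nat\<close> with its type class topology, which is the product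
  of discrete topologies.\<close>

definition analytic_set :: "'a::topological_space set \<Rightarrow> bool" where
  "analytic_set A \<longleftrightarrow> A = {} \<or> (\<exists>g :: (nat \<Rightarrow> nat) \<Rightarrow> 'a. continuous_on UNIV g \<and> range g = A)"

text \<open>Order and addition on \<^typ>\<open>cardval\<close> are those of cardinal arithmetic.\<close>

lemma nat_lesspoll_continuum: "(UNIV :: nat set) \<prec> (UNIV :: nat set set)"
  using lesspoll_Pow_self[of "UNIV :: nat set"] by simp

lemma has_card_mono:
  assumes "has_card A a" "has_card B b" "a \<le> b"
  shows "A \<lesssim> B"
proof (cases b)
  case (Fin n)
  then show ?thesis
    using assms by (auto simp: less_eq_cardval_def lepoll_iff_card_le)
next
  case Aleph0
  then have B: "(UNIV :: nat set) \<lesssim> B" "infinite B"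
    using assms(2) infinite_le_lepoll eqpoll_imp_lepoll eqpoll_sym
    by (metis has_card.simps(2), metis has_card.simps(2))
  show ?thesis
    using assms Aleph0 B
    by (cases a) (auto simp: less_eq_cardval_def intro: finite_lepoll_infinite lepoll_trans1)
next
  case Continuum
  then have B1: "(UNIV :: nat set set) \<lesssim> B"
    using assms by (auto intro: eqpoll_imp_lepoll eqpoll_sym)
  then have B2: "(UNIV :: nat set) \<lesssim> B"
    using nat_lesspoll_continuum lepoll_trans lesspoll_imp_lepoll by blast
  then have "infinite B"
    by (simp add: infinite_le_lepoll)
  then show ?thesis
    using assms B1 B2 by (cases a) (auto intro: finite_lepoll_infinite lepoll_trans1)
qed

lemma has_card_unique:
  assumes "has_card A a" "has_card A b"
  shows "a = b"
proof -
  have 1: "infinite A" if "A \<approx> (UNIV :: nat set)"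
    using that eqpoll_finite_iff by auto
  have 2: "infinite A" if "A \<approx> (UNIV :: nat set set)"
    using that infinite_le_lepoll nat_lesspoll_continuum
    by (metis eqpoll_finite_iff lesspoll_imp_lepoll)
  have 3: False if "A \<approx> (UNIV :: nat set)" "A \<approx> (UNIV :: nat set set)"
    using that nat_lesspoll_continuum by (meson eqpoll_sym eqpoll_trans lesspoll_def)
  show ?thesis
    using assms 1 2 3 by (cases a; cases b) auto
qed

lemma has_card_eqpoll: "A \<approx> B \<Longrightarrow> has_card A a \<longleftrightarrow> has_card B a"
  by (cases a) (auto simp: eqpoll_finite_iff dest: eqpoll_sym eqpoll_trans bij_betw_same_card
      simp: eqpoll_def, (meson eqpoll_def eqpoll_sym eqpoll_trans)+)

lemma has_card_le_iff:
  assumes "has_card A a" "has_card B b"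
  shows "a \<le> b \<longleftrightarrow> A \<lesssim> B"
proof
  assume "A \<lesssim> B"
  show "a \<le> b"
  proof (rule ccontr)
    assume "\<not> a \<le> b"
    then have "B \<approx> A"
      using \<open>A \<lesssim> B\<close> has_card_mono[OF assms(2,1)] lepoll_antisym by force
    then have "a = b"
      using assms has_card_eqpoll has_card_unique by blast
    then show False
      using \<open>\<not> a \<le> b\<close> by simp
  qed
qed (rule has_card_mono[OF assms])

lemma has_card_Plus:
  assumes "has_card A a" "has_card B b"
  shows "has_card (A <+> B) (a + b)"
proof -
  have inlA: "A \<lesssim> A <+> B" and inrB: "B \<lesssim> A <+> B"
    by (auto simp: lepoll_def intro!: exI[of _ Inl] exI[of _ Inr])
  have natsum: "(UNIV :: nat set) <+> (UNIV :: nat set) \<lesssim> (UNIV :: nat set)"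
    unfolding lepoll_def by (rule exI[of _ sum_encode]) (auto intro: inj_on_subset inj_sum_encode)
  have "inj (\<lambda>z :: nat set + nat set.
      case z of Inl X \<Rightarrow> insert 0 (Suc ` X) | Inr X \<Rightarrow> Suc ` X)"
    by (rule injI) (auto split: sum.splits simp: inj_image_eq_iff insert_eq_iff)
  then have setsum: "(UNIV :: nat set set) <+> (UNIV :: nat set set) \<lesssim> (UNIV :: nat set set)"
    unfolding lepoll_def by auto
  have le: "A <+> B \<lesssim> U" if "has_card U u" "U <+> U \<lesssim> U" "a \<le> u" "b \<le> u" for U :: "'c set" and u
    using that assms by (meson has_card_mono lepoll_trans sum_lepoll_mono)
  show ?thesis
  proof (cases "a + b")
    case (Fin n)
    then show ?thesis
      using assms by (cases a; cases b) (auto simp: card_Plus)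
  next
    case Aleph0
    then have "a \<le> Aleph0" "b \<le> Aleph0" "a = Aleph0 \<or> b = Aleph0"
      by (cases a; cases b; simp add: less_eq_cardval_def)+
    moreover from this have "(UNIV :: nat set) \<lesssim> A <+> B"
      using assms inlA inrB by (metis eqpoll_sym has_card.simps(2) lepoll_trans1)
    ultimately show ?thesis
      using Aleph0 le[of "UNIV :: nat set" Aleph0] natsum by (auto intro: lepoll_antisym)
  next
    case Continuum
    then have "a \<le> Continuum" "b \<le> Continuum" "a = Continuum \<or> b = Continuum"
      by (cases a; cases b; simp add: less_eq_cardval_def)+
    moreover from this have "(UNIV :: nat set set) \<lesssim> A <+> B"
      using assms inlA inrB by (metis eqpoll_sym has_card.simps(3) lepoll_trans1)
    ultimately show ?thesis
      using Continuum le[of "UNIV :: nat set set" Continuum] setsum by (auto intro: lepoll_antisym)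
  qed
qed

end

theory Submission
  imports Defs
begin

text \<open>Necessity counts excursions: between consecutive points of the fibre of \<open>y\<close> the function leaves
  \<open>y\<close> on one side, and by the intermediate value theorem every nearby value on that side is taken
  twice there. Values whose fibre contains an interval are countably many, and a closed set is
  uncountable iff it contains a countable dense-in-itself set, which makes the values with
  uncountable fibre a continuous image of a closed subset of a Polish space.

  For sufficiency, one associates with each value \<open>y\<close> two initial segments of the natural numbers, its
  right and left germs, such that the germs of index \<open>j\<close> persist on a one-sided neighbourhood and
  \<open>f y - 1\<close> is the number of germs at \<open>y\<close> (up to countably many values with \<open>f y = Continuum\<close>). For each
  \<open>j\<close> the values with a germ of index \<open>j\<close> are tiled by intervals \<open>{a..b}\<close>, where \<open>y\<close> lies in \<open>{a..<b}\<close> of a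
  unique tile iff it has a right germ, and in \<open>{a<..b}\<close> iff it has a left germ. Starting from the
  identity one inserts, at a point of value \<open>r\<close> inside \<open>{a<..<b}\<close>, an excursion from \<open>r\<close> down to \<open>a\<close>, up to
  \<open>b\<close> and back to \<open>r\<close>; this adds one preimage for every germ in the tile, wherever it is inserted.
  Therefore the tiles may be nested in each other along a Souslin scheme of the analytic set: the
  infinite branches then yield continuum many preimages exactly over that set and none elsewhere.
  The remaining countably many values receive an interval of constancy.\<close>


subsection \<open>Analytic sets\<close>

text \<open>The delicate point of sufficiency is a finite value y with \<open>f y = Fin k\<close>:
  its \<open>k - 1\<close> surplus preimages must be divided between the two sides so that every
  germ kept at y persists nearby. Neighbours carrying all germs of index \<open>0..j\<close> on both
  sides have at least \<open>1 + 2 * (j + 1) = 2 * j + 3\<close> preimages, which is the origin of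
  the threshold for index \<open>j\<close>. The extreme case is excluded because both bounds would
  be attained and both are even; this is what the parity clause is for. Its counterpart in necessity
  is that \<open>m\<close> excursions below and \<open>n\<close> above force the odd numbers
  \<open>2 * m + 1\<close> and \<open>2 * n + 1\<close> of preimages. Nesting cannot disturb finite
  fibres: an infinite branch over y needs infinitely many tiles at y, and a finite fibre allows only
  finitely many.\<close>

lemma open_baire_cylinder: "open {\<tau> :: nat \<Rightarrow> nat. \<forall>i<k. \<tau> i = \<sigma> i}"
proof -
  have *: "open {\<tau> :: nat \<Rightarrow> nat. \<tau> i = \<sigma> i}" for i
  proof -
    have "open ((\<lambda>\<tau> :: nat \<Rightarrow> nat. \<tau> i) -` {\<sigma> i})"
      by (intro open_vimage) (auto intro: continuous_on_product_coordinates open_discrete)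
    then show ?thesis by (simp add: vimage_def)
  qed
  have "open (\<Inter>i<k. {\<tau> :: nat \<Rightarrow> nat. \<tau> i = \<sigma> i})"
    using * by auto
  moreover have "(\<Inter>i<k. {\<tau> :: nat \<Rightarrow> nat. \<tau> i = \<sigma> i}) = {\<tau>. \<forall>i<k. \<tau> i = \<sigma> i}" by auto
  ultimately show ?thesis by simp
qed

text \<open>A proposed point of the dense sequence is accepted only if the jump is at most
  \<open>(1/2)^k\<close>; otherwise the approximation stays put. Hence every code yields a Cauchy
  sequence with a rate independent of the code, and the full Baire space can serve as
  domain.\<close>

primrec baire_approx :: "(nat \<Rightarrow> 'a::metric_space) \<Rightarrow> (nat \<Rightarrow> nat) \<Rightarrow> nat \<Rightarrow> 'a" where
  "baire_approx d \<sigma> 0 = d (\<sigma> 0)"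
| "baire_approx d \<sigma> (Suc k) =
    (if dist (baire_approx d \<sigma> k) (d (\<sigma> (Suc k))) \<le> (1/2)^k then d (\<sigma> (Suc k))
     else baire_approx d \<sigma> k)"

lemma baire_approx_in_range: "baire_approx d \<sigma> k \<in> range d"
  by (induction k) auto

lemma baire_approx_cong:
  "(\<And>i. i \<le> k \<Longrightarrow> \<sigma> i = \<tau> i) \<Longrightarrow> baire_approx d \<sigma> k = baire_approx d \<tau> k"
  by (induction k) auto

text \<open>The bound is the exact geometric sum of the permitted jumps; the subtracted term is what
  lets the induction close.\<close>

lemma baire_approx_dist: "dist (baire_approx d \<sigma> k) (baire_approx d \<sigma> (k + m)) \<le> 2 * (1/2)^k - 2 * (1/2)^(k+m)"
proof (induction m)
  case (Suc m)
  have "dist (baire_approx d \<sigma> (k + m)) (baire_approx d \<sigma> (k + Suc m)) \<le> (1/2)^(k+m)"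
    by auto
  then have "dist (baire_approx d \<sigma> k) (baire_approx d \<sigma> (k + Suc m)) \<le> (2 * (1/2)^k - 2 * (1/2)^(k+m)) + (1/2)^(k+m)"
    using Suc dist_triangle[of "baire_approx d \<sigma> k" "baire_approx d \<sigma> (k + Suc m)" "baire_approx d \<sigma> (k+m)"] by linarith
  then show ?case by simp
qed auto

lemma closed_polish_imp_baire_image:
  fixes S :: "'a::polish_space set"
  assumes "closed S" "S \<noteq> {}"
  obtains g :: "(nat \<Rightarrow> nat) \<Rightarrow> 'a" where "continuous_on UNIV g" "range g = S"
proof -
  obtain T where T: "countable T" "T \<subseteq> S" "S \<subseteq> closure T"
    using separable by blast
  have "T \<noteq> {}" using T assms by auto
  define d where "d = from_nat_into T"
  have d: "range d = T"
    unfolding d_def using T \<open>T \<noteq> {}\<close> by (simp add: range_from_nat_into)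
  let ?z = "baire_approx d"
  have bound: "dist (?z \<sigma> k) (?z \<sigma> n) \<le> 2 * (1/2)^k" if "k \<le> n" for \<sigma> k n
  proof -
    have "0 \<le> 2 * (1/2::real)^n" by simp
    then show ?thesis
      using order_trans[OF baire_approx_dist[of d \<sigma> k "n - k"]] that by simp
  qed
  have small: "\<exists>k. 4 * (1/2)^k < e" if "e > 0" for e :: real
    using real_arch_pow_inv[of "e/4" "1/2"] that by (auto simp: field_simps)
  have cauchy: "Cauchy (?z \<sigma>)" for \<sigma>
  proof (rule metric_CauchyI)
    fix e :: real assume "e > 0"
    then obtain k where k: "4 * (1/2)^k < e" using small by blast
    have "dist (?z \<sigma> m) (?z \<sigma> n) < e" if "m \<ge> k" "n \<ge> k" for m n
      using bound[OF that(1), of \<sigma>] bound[OF that(2), of \<sigma>] k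
        dist_triangle3[of "?z \<sigma> m" "?z \<sigma> n" "?z \<sigma> k"] by linarith
    then show "\<exists>M. \<forall>m\<ge>M. \<forall>n\<ge>M. dist (?z \<sigma> m) (?z \<sigma> n) < e" by blast
  qed
  define g where "g \<sigma> = lim (?z \<sigma>)" for \<sigma>
  have lim: "?z \<sigma> \<longlonglongrightarrow> g \<sigma>" for \<sigma>
    unfolding g_def using cauchy by (simp add: Cauchy_convergent convergent_LIMSEQ_iff[symmetric])
  have gbound: "dist (?z \<sigma> k) (g \<sigma>) \<le> 2 * (1/2)^k" for \<sigma> k
  proof (rule LIMSEQ_le_const2)
    show "(\<lambda>n. dist (?z \<sigma> k) (?z \<sigma> n)) \<longlonglongrightarrow> dist (?z \<sigma> k) (g \<sigma>)"
      by (intro tendsto_intros lim)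
  qed (use bound in blast)
  have "continuous_on UNIV g"
    unfolding continuous_on_topological
  proof (intro ballI allI impI)
    fix \<sigma> B assume B: "open B" "g \<sigma> \<in> B"
    then obtain e where e: "e > 0" "\<And>y. dist y (g \<sigma>) < e \<Longrightarrow> y \<in> B"
      unfolding open_dist by blast
    then obtain k where k: "4 * (1/2)^k < e" using small by blast
    have "g \<tau> \<in> B" if "\<forall>i<Suc k. \<tau> i = \<sigma> i" for \<tau>
    proof -
      have "?z \<tau> k = ?z \<sigma> k" using that by (intro baire_approx_cong) auto
      then show ?thesis
        using gbound[of \<tau> k] gbound[of \<sigma> k] k dist_triangle3[of "g \<tau>" "g \<sigma>" "?z \<sigma> k"]
        by (intro e(2)) simp
    qed
    then show "\<exists>A. open A \<and> \<sigma> \<in> A \<and> (\<forall>y\<in>UNIV. y \<in> A \<longrightarrow> g y \<in> B)"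
      by (intro exI[of _ "{\<tau>. \<forall>i<Suc k. \<tau> i = \<sigma> i}"]) (auto simp: open_baire_cylinder simp del: less_Suc_eq)
  qed
  moreover have "range g = S"
  proof
    show "range g \<subseteq> S"
    proof clarify
      fix \<sigma>
      have "\<forall>n. ?z \<sigma> n \<in> S" using baire_approx_in_range d T by blast
      then show "g \<sigma> \<in> S" using assms(1) lim closed_sequentially by blast
    qed
    show "S \<subseteq> range g"
    proof
      fix x assume "x \<in> S"
      \<comment> \<open>The factor \<open>1/4\<close> keeps the distance of consecutive proposals
        below \<open>(1/2)^k\<close>, so none of them is rejected and the approximations converge to
        \<open>x\<close>.\<close>
      have "\<exists>n. dist (d n) x < (1/4) * (1/2)^k" for k
      proof -
        have "x \<in> closure T" using \<open>x \<in> S\<close> T(3) by auto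
        moreover have "0 < (1/4) * (1/2::real)^k" by simp
        ultimately obtain y where "y \<in> T" "dist y x < (1/4) * (1/2)^k"
          unfolding closure_approachable by blast
        then show ?thesis using d by blast
      qed
      then obtain \<sigma> where \<sigma>: "\<And>k. dist (d (\<sigma> k)) x < (1/4) * (1/2)^k" by metis
      have z: "?z \<sigma> k = d (\<sigma> k)" for k
      proof (induction k)
        case (Suc k)
        have "dist (d (\<sigma> k)) (d (\<sigma> (Suc k))) \<le> (1/2)^k"
          using \<sigma>[of k] \<sigma>[of "Suc k"] dist_triangle2[of "d (\<sigma> k)" "d (\<sigma> (Suc k))" x]
            zero_le_power[of "1/2::real" k] by (simp only: power_Suc) linarith
        then show ?case using Suc by simp
      qed simp
      have "dist (?z \<sigma> k) x \<le> (1/2)^k" for k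
        using \<sigma>[of k] zero_le_power[of "1/2::real" k] unfolding z by linarith
      moreover have "(\<lambda>k. (1/2::real)^k) \<longlonglongrightarrow> 0" by (rule LIMSEQ_realpow_zero) auto
      ultimately have "(\<lambda>k. dist (?z \<sigma> k) x) \<longlonglongrightarrow> 0"
        by (intro tendsto_sandwich[of "\<lambda>_. 0" "\<lambda>k. dist (?z \<sigma> k) x" sequentially "\<lambda>k. (1/2)^k" 0]) auto
      then have "?z \<sigma> \<longlonglongrightarrow> x" using tendsto_dist_iff by blast
      then show "x \<in> range g" using lim LIMSEQ_unique by blast
    qed
  qed
  ultimately show ?thesis using that by blast
qed


section \<open>Self-dense trees and the values with uncountable fibre\<close>

lemma self_dense_subset:
  fixes S :: "real set"
  assumes "uncountable S"
  obtains S' where "S' \<subseteq> S" "S' \<noteq> {}" "\<And>x e. x \<in> S' \<Longrightarrow> e > 0 \<Longrightarrow> \<exists>y\<in>S'. y \<noteq> x \<and> \<bar>y - x\<bar> < e"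
proof -
  \<comment> \<open>Discarding the points with a rational neighbourhood that meets \<open>S\<close>
    in a countable set loses only countably many points; what remains consists of condensation
    points of \<open>S\<close>.\<close>
  define I where "I = {(a, b). a \<in> \<rat> \<and> b \<in> \<rat> \<and> countable (S \<inter> {a<..<b})}"
  define N where "N = (\<Union>(a, b)\<in>I. S \<inter> {a<..<b})"
  have "countable I"
    by (rule countable_subset[of _ "\<rat> \<times> \<rat>"]) (auto simp: I_def countable_rat)
  then have N: "countable N"
    unfolding N_def by (rule countable_UN) (auto simp: I_def)
  show ?thesis
  proof
    show "S - N \<subseteq> S" by auto
    show "S - N \<noteq> {}" using N assms countable_subset by auto
    fix x e :: real assume x: "x \<in> S - N" "e > 0"
    obtain a where a: "a \<in> \<rat>" "x - e < a" "a < x" using Rats_dense_in_real[of "x - e" x] x by auto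
    obtain b where b: "b \<in> \<rat>" "x < b" "b < x + e" using Rats_dense_in_real[of x "x + e"] x by auto
    have "uncountable (S \<inter> {a<..<b})"
    proof
      assume "countable (S \<inter> {a<..<b})"
      then have "(a, b) \<in> I" using a b by (simp add: I_def)
      then have "x \<in> N" unfolding N_def using x a b by force
      then show False using x by simp
    qed
    then have "uncountable (S \<inter> {a<..<b} - (N \<union> {x}))"
      by (intro uncountable_minus_countable) (use N in auto)
    then have "S \<inter> {a<..<b} - (N \<union> {x}) \<noteq> {}"
      by (metis countable_empty)
    then obtain y where "y \<in> S \<inter> {a<..<b} - (N \<union> {x})" by blast
    then show "\<exists>y\<in>S - N. y \<noteq> x \<and> \<bar>y - x\<bar> < e"
      using a b by (intro bexI[of _ y]) auto
  qed
qed

text \<open>A countable dense-in-itself set coded as a tree, so that membership in the code is a closed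
  condition on the pair: the second component witnesses that a child differs from its parent.\<close>

definition self_dense_code :: "(nat list \<Rightarrow> real \<times> real) \<Rightarrow> bool" where
  "self_dense_code z \<longleftrightarrow> (\<forall>s k. \<bar>fst (z (k # s)) - fst (z s)\<bar> \<le> 1 / (real k + 1) \<and>
     (fst (z (k # s)) - fst (z s)) * snd (z (k # s)) = 1)"

lemma uncountable_imp_self_dense_code:
  fixes S :: "real set"
  assumes "uncountable S"
  obtains z where "self_dense_code z" "\<And>s. fst (z s) \<in> S"
proof -
  obtain S' where S': "S' \<subseteq> S" "S' \<noteq> {}" "\<And>x e. x \<in> S' \<Longrightarrow> e > 0 \<Longrightarrow> \<exists>y\<in>S'. y \<noteq> x \<and> \<bar>y - x\<bar> < e"
    using self_dense_subset[OF assms] by metis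
  then obtain x0 where x0: "x0 \<in> S'" by auto
  have "\<exists>y. x \<in> S' \<longrightarrow> y \<in> S' \<and> y \<noteq> x \<and> \<bar>y - x\<bar> < 1 / (real k + 1)" for x k
    using S'(3)[of x "1 / (real k + 1)"] by auto
  then obtain pick where pick:
    "\<And>x k. x \<in> S' \<Longrightarrow> pick x k \<in> S' \<and> pick x k \<noteq> x \<and> \<bar>pick x k - x\<bar> < 1 / (real k + 1)"
    by metis
  define X where "X = rec_list x0 (\<lambda>k _ x. pick x k)"
  have X[simp]: "X [] = x0" "X (k # s) = pick (X s) k" for k s
    by (simp_all add: X_def)
  have XS: "X s \<in> S'" for s
    by (induction s) (auto simp: x0 pick)
  define w where "w s = (case s of [] \<Rightarrow> 0 | k # s' \<Rightarrow> 1 / (X s - X s'))" for s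
  show ?thesis
  proof
    show "self_dense_code (\<lambda>s. (X s, w s))"
      unfolding self_dense_code_def using pick[OF XS] by (simp add: w_def less_imp_le)
    show "fst (X s, w s) \<in> S" for s using XS S' by auto
  qed
qed

text \<open>Closedness of \<open>S\<close> keeps the closure \<open>P\<close> of the coded points
  inside \<open>S\<close>. Since \<open>P\<close> has no isolated point, a countable
  \<open>P\<close> would give countably many dense relatively open sets \<open>P - {p}\<close> with
  empty intersection, against the Baire category theorem.\<close>

lemma self_dense_code_imp_uncountable:
  fixes S :: "real set"
  assumes "closed S" "self_dense_code z" "\<And>s. fst (z s) \<in> S"
  shows "uncountable S"
proof
  assume "countable S"
  let ?X = "range (\<lambda>s. fst (z s))"
  define P where "P = closure ?X"
  have P: "closed P" "P \<subseteq> S" "P \<noteq> {}"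
    unfolding P_def using assms by (simp, intro closure_minimal, auto)
  have lim1: "fst (z s) islimpt ?X" for s
    unfolding islimpt_approachable
  proof (intro allI impI)
    fix e :: real assume "e > 0"
    then obtain k where k: "1 / (real k + 1) < e"
      by (metis add.commute nat_approx_posE of_nat_Suc)
    have "\<bar>fst (z (k # s)) - fst (z s)\<bar> \<le> 1 / (real k + 1)"
      "(fst (z (k # s)) - fst (z s)) * snd (z (k # s)) = 1"
      using assms(2) unfolding self_dense_code_def by blast+
    then have "fst (z (k # s)) \<noteq> fst (z s)" "\<bar>fst (z (k # s)) - fst (z s)\<bar> < e"
      using k by auto
    then show "\<exists>x'\<in>?X. x' \<noteq> fst (z s) \<and> dist x' (fst (z s)) < e"
      by (intro bexI[of _ "fst (z (k # s))"]) (simp_all add: dist_real_def)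
  qed
  have lim: "p islimpt P" if "p \<in> P" for p
  proof -
    have "p \<in> ?X \<or> p islimpt ?X" using that unfolding P_def closure_def by blast
    then have "p islimpt ?X" using lim1 by blast
    then show ?thesis unfolding P_def by (rule islimpt_subset[OF _ closure_subset])
  qed
  have "P \<subseteq> closure (\<Inter>p\<in>P. P - {p})"
  proof (rule Baire[OF P(1)])
    show "countable ((\<lambda>p. P - {p}) ` P)"
      by (intro countable_image countable_subset[OF P(2) \<open>countable S\<close>])
    fix T assume "T \<in> (\<lambda>p. P - {p}) ` P"
    then obtain p where p: "p \<in> P" "T = P - {p}" by auto
    have "openin (top_of_set P) (P - {p})"
      by (simp add: openin_delete)
    moreover have "p \<in> closure (P - {p})"
      using lim[OF p(1)] by (simp add: islimpt_in_closure)
    ultimately show "openin (top_of_set P) T \<and> P \<subseteq> closure T"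
      using p closure_subset[of "P - {p}"] by auto
  qed
  moreover have "(\<Inter>p\<in>P. P - {p}) = {}" using P by auto
  ultimately show False using P by auto
qed

text \<open>An uncountable fibre is recognised by the code of a self-dense tree inside it. The codes
  whose points all lie in one common fibre form the closed set \<open>Z\<close> in a countable
  product of planes, and the value of \<open>F\<close> at the root of the tree maps \<open>Z\<close>
  continuously onto the set in question.\<close>

theorem analytic_uncountable_fibres:
  fixes F :: "real \<Rightarrow> real"
  assumes F: "continuous_on {a..b} F"
  shows "analytic_set {y. uncountable {x \<in> {a..b}. F x = y}}"
proof -
  define Z where "Z = {z. self_dense_code z \<and> (\<forall>s. fst (z s) \<in> {a..b} \<and> F (fst (z s)) = F (fst (z [])))}"
  \<comment> \<open>Clamping the argument extends \<open>F\<close> continuously to the line, which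
    makes the conditions on codes closed in the whole product space.\<close>
  define G where "G x = F (max a (min b x))" for x
  show ?thesis
  proof (cases "a \<le> b")
    case True
    have G: "continuous_on UNIV G"
      unfolding G_def by (rule continuous_on_compose2[OF F]) (use True in \<open>auto intro!: continuous_intros\<close>)
    have FG: "F x = G x" if "x \<in> {a..b}" for x using that by (auto simp: G_def min_def max_def)
    have Z_eq: "Z = {z. (\<forall>s k. \<bar>fst (z (k # s)) - fst (z s)\<bar> \<le> 1 / (real k + 1)) \<and>
       (\<forall>s k. (fst (z (k # s)) - fst (z s)) * snd (z (k # s)) = 1) \<and>
       (\<forall>s. a \<le> fst (z s)) \<and> (\<forall>s. fst (z s) \<le> b) \<and> (\<forall>s. G (fst (z s)) = G (fst (z [])))}"
    proof -
      have "(\<forall>s. fst (z s) \<in> {a..b} \<and> F (fst (z s)) = F (fst (z []))) \<longleftrightarrow>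
        (\<forall>s. a \<le> fst (z s)) \<and> (\<forall>s. fst (z s) \<le> b) \<and> (\<forall>s. G (fst (z s)) = G (fst (z [])))"
        for z :: "nat list \<Rightarrow> real \<times> real"
      proof (cases "\<forall>s. fst (z s) \<in> {a..b}")
        case True
        then have "F (fst (z s)) = G (fst (z s))" for s using FG by blast
        then show ?thesis using True by simp
      qed auto
      then show ?thesis unfolding Z_def self_dense_code_def by blast
    qed
    have Gc: "continuous_on UNIV (\<lambda>z :: nat list \<Rightarrow> real \<times> real. G (fst (z s)))" for s
      by (rule continuous_on_compose2[OF G]) (auto intro!: continuous_intros continuous_on_product_coordinates)
    have "closed Z"
      unfolding Z_eq
      by (intro closed_Collect_conj closed_Collect_all closed_Collect_le closed_Collect_eq
          continuous_intros continuous_on_product_coordinates Gc)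
    have img: "{y. uncountable {x \<in> {a..b}. F x = y}} = (\<lambda>z. G (fst (z []))) ` Z"
    proof (intro set_eqI iffI)
      fix y assume "y \<in> {y. uncountable {x \<in> {a..b}. F x = y}}"
      then obtain z where "self_dense_code z" "\<And>s. fst (z s) \<in> {x \<in> {a..b}. F x = y}"
        using uncountable_imp_self_dense_code by blast
      then show "y \<in> (\<lambda>z. G (fst (z []))) ` Z"
        using FG[of "fst (z [])"] by (intro image_eqI[of _ _ z]) (simp_all add: Z_def)
    next
      fix y assume "y \<in> (\<lambda>z. G (fst (z []))) ` Z"
      then obtain z where z: "z \<in> Z" "y = G (fst (z []))" by auto
      have "closed ({a..b} \<inter> F -` {y})"
        by (intro continuous_closed_preimage F) auto
      moreover have "{a..b} \<inter> F -` {y} = {x \<in> {a..b}. F x = y}" by auto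
      moreover have "fst (z s) \<in> {x \<in> {a..b}. F x = y}" for s
        using z FG[of "fst (z [])"] unfolding Z_def by simp
      ultimately show "y \<in> {y. uncountable {x \<in> {a..b}. F x = y}}"
        using z self_dense_code_imp_uncountable[of "{x \<in> {a..b}. F x = y}" z] by (simp add: Z_def)
    qed
    show ?thesis
    proof (cases "Z = {}")
      case False
      then obtain g :: "(nat \<Rightarrow> nat) \<Rightarrow> nat list \<Rightarrow> real \<times> real"
        where g: "continuous_on UNIV g" "range g = Z"
        using closed_polish_imp_baire_image[OF \<open>closed Z\<close> False] by blast
      have "continuous_on UNIV (\<lambda>\<sigma>. G (fst (g \<sigma> [])))"
        using continuous_on_compose2[OF Gc g(1)] by simp
      moreover have "range (\<lambda>\<sigma>. G (fst (g \<sigma> []))) = {y. uncountable {x \<in> {a..b}. F x = y}}"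
        using g(2) img by auto
      ultimately show ?thesis unfolding analytic_set_def by blast
    qed (use img in \<open>simp add: analytic_set_def\<close>)
  qed (simp add: analytic_set_def)
qed


subsection \<open>Counting preimages near a value\<close>

lemma Fin_le_iff: "Fin m \<le> Fin n \<longleftrightarrow> m \<le> n"
  by (auto simp: less_eq_cardval_def)

lemma Fin_le_infinite: "Fin m \<le> Aleph0" "Fin m \<le> Continuum"
  by (auto simp: less_eq_cardval_def)

lemma has_card_ge:
  assumes "has_card A a" "finite B" "B \<subseteq> A" "n \<le> card B"
  shows "Fin n \<le> a"
proof (cases a)
  case (Fin m)
  then have "card B \<le> m" using assms card_mono by auto
  then show ?thesis using Fin assms by (simp add: Fin_le_iff)
qed (simp_all add: Fin_le_infinite)

lemma Fin_add_le:
  assumes "Fin m \<le> a" "Fin n \<le> b" "k \<le> m + n"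
  shows "Fin k \<le> a + b"
  using assms by (cases a; cases b) (auto simp: Fin_le_iff Fin_le_infinite)

lemma IVT_between:
  fixes F :: "real \<Rightarrow> real"
  assumes "continuous_on {a..b} F" "a < b" "F a < y \<and> y < F b \<or> F b < y \<and> y < F a"
  shows "\<exists>x. a < x \<and> x < b \<and> F x = y"
proof -
  have "\<exists>x. a \<le> x \<and> x \<le> b \<and> F x = y"
    using assms IVT'[of F a y b] IVT2'[of F b y a] by force
  then show ?thesis using assms(3) by (metis less_le order_less_irrefl)
qed

text \<open>Every excursion of \<open>F\<close> away from \<open>y\<close> between two points of the fibre contributes two preimages
  to all nearby values on its side.\<close>

lemma excursion_count:
  fixes F :: "real \<Rightarrow> real" and x w :: "nat \<Rightarrow> real"
  assumes cont: "continuous_on {x 0..x k} F"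
    and order: "\<And>i. i < k \<Longrightarrow> x i < w i \<and> w i < x (Suc i)"
    and fib: "\<And>i. i \<le> k \<Longrightarrow> F (x i) = y"
    and off: "\<And>i. i < k \<Longrightarrow> F (w i) \<noteq> y"
  obtains m n e where "m + n = k" "e > 0"
    "\<And>z. y - e < z \<Longrightarrow> z < y \<Longrightarrow> \<exists>B. finite B \<and> card B = 2 * m \<and> B \<subseteq> {u. x 0 < u \<and> u < x k \<and> F u = z}"
    "\<And>z. y < z \<Longrightarrow> z < y + e \<Longrightarrow> \<exists>B. finite B \<and> card B = 2 * n \<and> B \<subseteq> {u. x 0 < u \<and> u < x k \<and> F u = z}"
proof -
  \<comment> \<open>The excursions that pass beyond \<open>z\<close>; each of them takes the value
    \<open>z\<close> once before and once after its test point \<open>w i\<close>.\<close>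
  define side where "side z = {i. i < k \<and> (z < y \<and> F (w i) < z \<or> y < z \<and> z < F (w i))}" for z
  define m where "m = card {i. i < k \<and> F (w i) < y}"
  define n where "n = card {i. i < k \<and> y < F (w i)}"
  \<comment> \<open>The smallest height of an excursion. The inserted \<open>1\<close> keeps the set
    nonempty when \<open>k = 0\<close>.\<close>
  define e where "e = Min (insert 1 ((\<lambda>i. \<bar>F (w i) - y\<bar>) ` {..<k}))"
  have e: "e > 0" unfolding e_def using off by (subst Min_gr_iff) auto
  have e_le: "e \<le> \<bar>F (w i) - y\<bar>" if "i < k" for i
    unfolding e_def using that by (intro Min_le) auto
  have xmono: "x i \<le> x j" if "i \<le> j" "j \<le> k" for i j
    using that
  proof (induction rule: dec_induct)
    case (step n)
    then show ?case using order[of n] by simp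
  qed simp
  have key: "\<exists>B. finite B \<and> card B = 2 * card (side z) \<and> B \<subseteq> {u. x 0 < u \<and> u < x k \<and> F u = z}" if "z \<noteq> y" for z
  proof -
    have "\<exists>u v. x i < u \<and> u < w i \<and> F u = z \<and> w i < v \<and> v < x (Suc i) \<and> F v = z" if i: "i \<in> side z" for i
    proof -
      have ik: "i < k" using i by (simp add: side_def)
      have c1: "continuous_on {x i..w i} F" "continuous_on {w i..x (Suc i)} F"
        using order[OF ik] xmono[of 0 i] xmono[of "Suc i" k] ik
        by (auto intro!: continuous_on_subset[OF cont])
      have fx: "F (x i) = y" "F (x (Suc i)) = y" using fib ik by auto
      have "\<exists>u. x i < u \<and> u < w i \<and> F u = z"
        using i order[OF ik] fx by (intro IVT_between c1) (auto simp: side_def)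
      moreover have "\<exists>v. w i < v \<and> v < x (Suc i) \<and> F v = z"
        using i order[OF ik] fx by (intro IVT_between c1) (auto simp: side_def)
      ultimately show ?thesis by blast
    qed
    then obtain u v where uv: "\<And>i. i \<in> side z \<Longrightarrow> x i < u i \<and> u i < w i \<and> F (u i) = z \<and> w i < v i \<and> v i < x (Suc i) \<and> F (v i) = z"
      by metis
    have fin: "finite (side z)" by (simp add: side_def)
    have sep: "u i < u j \<and> v i < v j \<and> v i < u j" if "i \<in> side z" "j \<in> side z" "i < j" for i j
    proof -
      have "x (Suc i) \<le> x j" using that xmono[of "Suc i" j] by (auto simp: side_def)
      then show ?thesis using uv[OF that(1)] uv[OF that(2)] by auto
    qed
    have "inj_on u (side z)" by (rule linorder_inj_onI') (use sep in force)
    moreover have "inj_on v (side z)" by (rule linorder_inj_onI') (use sep in force)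
    moreover have "u ` side z \<inter> v ` side z = {}"
    proof -
      have "u i \<noteq> v j" if "i \<in> side z" "j \<in> side z" for i j
        using sep[OF that] sep[OF that(2,1)] uv[OF that(1)] uv[OF that(2)] by (cases i j rule: linorder_cases) auto
      then show ?thesis by blast
    qed
    ultimately have "card (u ` side z \<union> v ` side z) = 2 * card (side z)"
      using fin by (simp add: card_Un_disjoint card_image)
    moreover have "u ` side z \<union> v ` side z \<subseteq> {t. x 0 < t \<and> t < x k \<and> F t = z}"
    proof -
      have "x 0 < u i \<and> u i < x k \<and> x 0 < v i \<and> v i < x k" if "i \<in> side z" for i
        using uv[OF that] xmono[of 0 i] xmono[of "Suc i" k] that by (auto simp: side_def)
      then show ?thesis using uv by auto
    qed
    ultimately show ?thesis using fin by (intro exI[of _ "u ` side z \<union> v ` side z"]) simp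
  qed
  show ?thesis
  proof (rule that[of m n e])
    have "{i. i < k \<and> F (w i) < y} \<union> {i. i < k \<and> y < F (w i)} = {..<k}"
      using off by (auto simp: neq_iff)
    moreover have "{i. i < k \<and> F (w i) < y} \<inter> {i. i < k \<and> y < F (w i)} = {}" by auto
    ultimately show "m + n = k"
      unfolding m_def n_def by (subst card_Un_disjoint[symmetric]) auto
    show "e > 0" by (rule e)
    show "\<exists>B. finite B \<and> card B = 2 * m \<and> B \<subseteq> {u. x 0 < u \<and> u < x k \<and> F u = z}" if "y - e < z" "z < y" for z
    proof -
      have "side z = {i. i < k \<and> F (w i) < y}"
        using e_le that by (force simp: side_def)
      then show ?thesis using key[of z] that by (simp add: m_def)
    qed
    show "\<exists>B. finite B \<and> card B = 2 * n \<and> B \<subseteq> {u. x 0 < u \<and> u < x k \<and> F u = z}" if "y < z" "z < y + e" for z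
    proof -
      have "side z = {i. i < k \<and> y < F (w i)}"
        using e_le that by (force simp: side_def)
      then show ?thesis using key[of z] that by (simp add: n_def)
    qed
  qed
qed

section \<open>Fibre counts near finite and infinite values\<close>

text \<open>Extending \<open>F\<close> by the identity outside \<open>{0..1}\<close> makes the end points \<open>0\<close> and \<open>1\<close> behave like
  interior values: the values outside \<open>{0..1}\<close> have fibres of size one.\<close>

locale level_function =
  fixes F :: "real \<Rightarrow> real"
  assumes cont: "continuous_on {0..1} F" and range: "F ` {0..1} \<subseteq> {0..1}" and F0: "F 0 = 0" and F1: "F 1 = 1"
begin

definition E :: "real \<Rightarrow> real" where
  "E x = (if x \<le> 0 then x else if x \<le> 1 then F x else x)"

lemma continuous_on_E: "continuous_on A E"
proof -
  have "continuous_on ({0..1} \<union> {1..}) (\<lambda>x. if x \<le> 1 then F x else x)"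
    by (rule continuous_on_If) (use cont F1 in auto)
  moreover have "{0..1} \<union> {1..} = {0::real..}" by auto
  ultimately have "continuous_on ({..0} \<union> {0..}) E"
    unfolding E_def by (intro continuous_on_If) (use F0 in auto)
  then show ?thesis by (rule continuous_on_subset) auto
qed

lemma E_eq: "x \<in> {0..1} \<Longrightarrow> E x = F x"
  using F0 by (auto simp: E_def)

lemma E_in: "E x \<in> {0..1} \<longleftrightarrow> x \<in> {0..1}"
  using range F0 by (auto simp: E_def image_subset_iff)

lemma E_out: "x \<notin> {0..1} \<Longrightarrow> E x = x" by (auto simp: E_def)

lemma fibre_eq: "y \<in> {0..1} \<Longrightarrow> {x. E x = y} = {x \<in> {0..1}. F x = y}"
  using E_in E_eq by auto metis+

lemma fibre_out:
  assumes "y \<notin> {0..1}"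
  shows "{x. E x = y} = {y}"
proof (intro set_eqI)
  fix x
  show "x \<in> {x. E x = y} \<longleftrightarrow> x \<in> {y}"
    using assms E_in[of x] E_out[of x] E_out[of y] by (cases "x \<in> {0..1}") (metis mem_Collect_eq singletonD, metis mem_Collect_eq singleton_iff)
qed

text \<open>The \<open>k\<close> points of the fibre bound \<open>k - 1\<close> excursions,
  \<open>m\<close> below and \<open>n\<close> above \<open>y\<close>. The extra \<open>1\<close> on
  each side comes from the tails: \<open>E\<close> climbs to \<open>y\<close> from far below before
  the first point and climbs from \<open>y\<close> far up after the last. The two counts add up to
  exactly \<open>2 * k\<close>.\<close>

lemma finite_fibre_count:
  assumes y: "y \<in> {0..1}" and fin: "finite {x. E x = y}" and k: "card {x. E x = y} = k"
  obtains m n e where "m + n + 1 = k" "e > 0"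
    "\<And>z. y - e < z \<Longrightarrow> z < y \<Longrightarrow> \<exists>B. finite B \<and> card B = 2 * m + 1 \<and> B \<subseteq> {x. E x = z}"
    "\<And>z. y < z \<Longrightarrow> z < y + e \<Longrightarrow> \<exists>B. finite B \<and> card B = 2 * n + 1 \<and> B \<subseteq> {x. E x = z}"
proof -
  let ?S = "{x. E x = y}"
  define xs where "xs = sorted_list_of_set ?S"
  have xs: "length xs = k" "set xs = ?S" "sorted_wrt (<) xs"
    using fin k by (simp_all add: xs_def)
  have "\<exists>x. -1 < x \<and> x < 2 \<and> E x = y"
    using y by (intro IVT_between continuous_on_E) (auto simp: E_def)
  then have "?S \<noteq> {}" by blast
  then have "k > 0" using fin k by (metis card_gt_0_iff)
  define x where "x i = xs ! i" for i
  have xmono: "x i < x j" if "i < j" "j < k" for i j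
    using xs(1,3) that unfolding x_def by (simp add: sorted_wrt_iff_nth_less)
  have xfib: "E (x i) = y" if "i < k" for i
    using xs(1,2) that nth_mem unfolding x_def by blast
  have xall: "\<exists>i<k. u = x i" if "E u = y" for u
  proof -
    have "u \<in> set xs" using that xs(2) by simp
    then obtain i where "i < length xs" "xs ! i = u" unfolding in_set_conv_nth by blast
    then show ?thesis using xs(1) by (intro exI[of _ i]) (simp add: x_def)
  qed
  define w where "w i = (x i + x (Suc i)) / 2" for i
  have ww: "x i < w i \<and> w i < x (Suc i)" if "i < k - 1" for i
    using xmono[of i "Suc i"] that by (simp add: w_def)
  have off: "E (w i) \<noteq> y" if i: "i < k - 1" for i
  proof
    assume "E (w i) = y"
    then obtain j where j: "j < k" "w i = x j" using xall by blast
    have "x i < x j" "x j < x (Suc i)" using ww[OF i] j by auto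
    moreover have "i < k" "Suc i < k" using i by auto
    ultimately show False
      using xmono[of j i] xmono[of "Suc i" j] j by (cases j i rule: linorder_cases; cases "j = Suc i") auto
  qed
  obtain m n e where mn: "m + n = k - 1" "e > 0"
    "\<And>z. y - e < z \<Longrightarrow> z < y \<Longrightarrow> \<exists>B. finite B \<and> card B = 2 * m \<and> B \<subseteq> {u. x 0 < u \<and> u < x (k - 1) \<and> E u = z}"
    "\<And>z. y < z \<Longrightarrow> z < y + e \<Longrightarrow> \<exists>B. finite B \<and> card B = 2 * n \<and> B \<subseteq> {u. x 0 < u \<and> u < x (k - 1) \<and> E u = z}"
    by (rule excursion_count[of x "k - 1" E w y, OF continuous_on_E ww])
      (use xfib off \<open>k > 0\<close> in auto)
  have x01: "0 \<le> x i \<and> x i \<le> 1" if "i < k" for i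
    using E_in[of "x i"] xfib[OF that] y by simp
  have x0k: "x 0 \<le> x (k - 1)" using xmono[of 0 "k - 1"] \<open>k > 0\<close> by (cases "k = 1") auto
  show ?thesis
  \<comment> \<open>A distance below \<open>1\<close> puts \<open>z\<close> strictly between
    \<open>-2\<close> and \<open>3\<close>, the values of \<open>E\<close> at the two outer
    reference points.\<close>
  proof (rule that[of m n "min e 1"])
    show "m + n + 1 = k" using mn \<open>k > 0\<close> by simp
    show "min e 1 > 0" using mn by simp
    fix z
    show "\<exists>B. finite B \<and> card B = 2 * m + 1 \<and> B \<subseteq> {x. E x = z}" if z: "y - min e 1 < z" "z < y"
    proof -
      have z': "y - e < z" "y - 1 < z" using z by linarith+
      obtain B where B: "finite B" "card B = 2 * m" "B \<subseteq> {u. x 0 < u \<and> u < x (k - 1) \<and> E u = z}"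
        using mn(3)[OF z'(1) z(2)] by blast
      have "\<exists>u. -2 < u \<and> u < x 0 \<and> E u = z"
      proof (rule IVT_between[OF continuous_on_E])
        have "E (-2) = -2" by (simp add: E_def)
        then show "E (-2) < z \<and> z < E (x 0) \<or> E (x 0) < z \<and> z < E (-2)"
          using z z' y xfib[of 0] \<open>k > 0\<close> by auto
        show "-2 < x 0" using x01[of 0] \<open>k > 0\<close> by auto
      qed
      then obtain u where u: "u < x 0" "E u = z" by blast
      then have "u \<notin> B" using B by auto
      then show ?thesis using B u by (intro exI[of _ "insert u B"]) auto
    qed
    show "\<exists>B. finite B \<and> card B = 2 * n + 1 \<and> B \<subseteq> {x. E x = z}" if z: "y < z" "z < y + min e 1"
    proof -
      have z': "z < y + e" "z < y + 1" using z by linarith+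
      obtain B where B: "finite B" "card B = 2 * n" "B \<subseteq> {u. x 0 < u \<and> u < x (k - 1) \<and> E u = z}"
        using mn(4)[OF z(1) z'(1)] by blast
      have "\<exists>u. x (k - 1) < u \<and> u < 3 \<and> E u = z"
      proof (rule IVT_between[OF continuous_on_E])
        have "E 3 = 3" by (simp add: E_def)
        then show "E (x (k - 1)) < z \<and> z < E 3 \<or> E 3 < z \<and> z < E (x (k - 1))"
          using z z' y xfib[of "k - 1"] \<open>k > 0\<close> by auto
        show "x (k - 1) < 3" using x01[of "k - 1"] \<open>k > 0\<close> by auto
      qed
      then obtain u where u: "x (k - 1) < u" "E u = z" by blast
      then have "u \<notin> B" using B by auto
      then show ?thesis using B u by (intro exI[of _ "insert u B"]) auto
    qed
  qed
qed

definition flat_values :: "real set" where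
  "flat_values = {y \<in> {0..1}. \<exists>a b. 0 \<le> a \<and> a < b \<and> b \<le> 1 \<and> (\<forall>x. a \<le> x \<and> x \<le> b \<longrightarrow> F x = y)}"

lemma countable_flat_values: "countable flat_values"
proof -
  have "\<exists>c\<in>\<rat>. 0 \<le> c \<and> c \<le> 1 \<and> F c = y" if y: "y \<in> flat_values" for y
  proof -
    obtain a b where ab: "0 \<le> a" "a < b" "b \<le> 1" "\<forall>x. a \<le> x \<and> x \<le> b \<longrightarrow> F x = y"
      using y by (auto simp: flat_values_def)
    obtain c where "c \<in> \<rat>" "a < c" "c < b" using Rats_dense_in_real[OF ab(2)] by blast
    then show ?thesis using ab by (intro bexI[of _ c]) auto
  qed
  then have "flat_values \<subseteq> F ` \<rat>" by blast
  then show ?thesis using countable_rat countable_subset by blast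
qed

text \<open>Only finitely many points of the fibre are selected, so further fibre points may lie
  between them and midpoints would not do as test points. A point off the fibre exists between
  neighbours because \<open>y\<close> is not a flat value. The tails are ignored, since
  \<open>k\<close> is arbitrary.\<close>

lemma infinite_fibre_count:
  assumes y: "y \<in> {0..1} - flat_values" and inf: "infinite {x. E x = y}"
  obtains m n e where "m + n = k" "e > 0"
    "\<And>z. y - e < z \<Longrightarrow> z < y \<Longrightarrow> \<exists>B. finite B \<and> card B = 2 * m \<and> B \<subseteq> {x. E x = z}"
    "\<And>z. y < z \<Longrightarrow> z < y + e \<Longrightarrow> \<exists>B. finite B \<and> card B = 2 * n \<and> B \<subseteq> {x. E x = z}"
proof -
  obtain T where T: "T \<subseteq> {x. E x = y}" "finite T" "card T = Suc k"
    using infinite_arbitrarily_large[OF inf] by blast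
  define xs where "xs = sorted_list_of_set T"
  have xs: "length xs = Suc k" "set xs = T" "sorted_wrt (<) xs"
    using T by (simp_all add: xs_def)
  define x where "x i = xs ! i" for i
  have xmono: "x i < x (Suc i)" if "i < k" for i
    using xs(1,3) that unfolding x_def by (simp add: sorted_wrt_iff_nth_less)
  have xfib: "E (x i) = y" if "i \<le> k" for i
    using xs(1,2) that nth_mem[of i xs] T(1) unfolding x_def by auto
  have x01: "0 \<le> x i \<and> x i \<le> 1" if "i \<le> k" for i
    using E_in[of "x i"] xfib[OF that] y by simp
  have "\<exists>w. x i < w \<and> w < x (Suc i) \<and> E w \<noteq> y" if i: "i < k" for i
  proof (rule ccontr)
    assume no: "\<nexists>w. x i < w \<and> w < x (Suc i) \<and> E w \<noteq> y"
    have "F u = y" if u: "x i \<le> u" "u \<le> x (Suc i)" for u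
    proof -
      have "E u = y" using no u xfib[of i] xfib[of "Suc i"] i by (cases "u = x i \<or> u = x (Suc i)") auto
      moreover have "u \<in> {0..1}" using u x01[of i] x01[of "Suc i"] i by auto
      ultimately show ?thesis using E_eq by simp
    qed
    then have "0 \<le> x i \<and> x i < x (Suc i) \<and> x (Suc i) \<le> 1 \<and> (\<forall>u. x i \<le> u \<and> u \<le> x (Suc i) \<longrightarrow> F u = y)"
      using xmono[OF i] x01[of i] x01[of "Suc i"] i by auto
    then have "\<exists>a b. 0 \<le> a \<and> a < b \<and> b \<le> 1 \<and> (\<forall>x. a \<le> x \<and> x \<le> b \<longrightarrow> F x = y)" by blast
    then have "y \<in> flat_values" unfolding flat_values_def using y by simp
    then show False using y by simp
  qed
  then obtain w where w: "\<And>i. i < k \<Longrightarrow> x i < w i \<and> w i < x (Suc i) \<and> E (w i) \<noteq> y" by metis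
  obtain m n e where mn: "m + n = k" "e > 0"
    "\<And>z. y - e < z \<Longrightarrow> z < y \<Longrightarrow> \<exists>B. finite B \<and> card B = 2 * m \<and> B \<subseteq> {u. x 0 < u \<and> u < x k \<and> E u = z}"
    "\<And>z. y < z \<Longrightarrow> z < y + e \<Longrightarrow> \<exists>B. finite B \<and> card B = 2 * n \<and> B \<subseteq> {u. x 0 < u \<and> u < x k \<and> E u = z}"
    by (rule excursion_count[of x k E w y, OF continuous_on_E]) (use w xfib in auto)
  show ?thesis
  proof (rule that[OF mn(1,2)])
    show "\<exists>B. finite B \<and> card B = 2 * m \<and> B \<subseteq> {x. E x = z}" if "y - e < z" "z < y" for z
      using mn(3)[OF that] by blast
    show "\<exists>B. finite B \<and> card B = 2 * n \<and> B \<subseteq> {x. E x = z}" if "y < z" "z < y + e" for z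
      using mn(4)[OF that] by blast
  qed
qed

end


text \<open>These are the fibre sizes of the extension by the identity. The value
  \<open>Fin 1\<close> outside accounts for the summand \<open>1\<close> in the conditions at the
  end values, so that a single two-sided condition covers all of \<open>{0..1}\<close>.\<close>

definition ext :: "(real \<Rightarrow> cardval) \<Rightarrow> real \<Rightarrow> cardval" where
  "ext f y = (if y \<in> {0..1} then f y else Fin 1)"

locale level_cards = level_function +
  fixes f :: "real \<Rightarrow> cardval"
  assumes card: "y \<in> {0..1} \<Longrightarrow> has_card {x \<in> {0..1}. F x = y} (f y)"
begin

lemma card': "has_card {x. E x = y} (ext f y)"
  using card fibre_eq fibre_out by (cases "y \<in> {0..1}") (auto simp: ext_def)

lemma finite_level:
  assumes y: "y \<in> {0..1}" and k: "f y = Fin k"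
  shows "\<exists>e>0. \<forall>y1 y2. y - e < y1 \<and> y1 < y \<and> y < y2 \<and> y2 < y + e \<longrightarrow>
     ext f y1 + ext f y2 \<ge> Fin (2 * k) \<and> (ext f y1 + ext f y2 = Fin (2 * k) \<longrightarrow> odd_card (ext f y1) \<or> odd_card (ext f y2))"
proof -
  have "finite {x. E x = y}" "card {x. E x = y} = k"
    using card'[of y] y k by (simp_all add: ext_def)
  then obtain m n e where mn: "m + n + 1 = k" "e > 0"
    "\<And>z. y - e < z \<Longrightarrow> z < y \<Longrightarrow> \<exists>B. finite B \<and> card B = 2 * m + 1 \<and> B \<subseteq> {x. E x = z}"
    "\<And>z. y < z \<Longrightarrow> z < y + e \<Longrightarrow> \<exists>B. finite B \<and> card B = 2 * n + 1 \<and> B \<subseteq> {x. E x = z}"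
    by (rule finite_fibre_count[OF y]) auto
  have "ext f y1 + ext f y2 \<ge> Fin (2 * k) \<and> (ext f y1 + ext f y2 = Fin (2 * k) \<longrightarrow> odd_card (ext f y1) \<or> odd_card (ext f y2))"
    if z: "y - e < y1" "y1 < y" "y < y2" "y2 < y + e" for y1 y2
  proof -
    have le: "Fin (2 * m + 1) \<le> ext f y1" "Fin (2 * n + 1) \<le> ext f y2"
      using mn(3)[OF z(1,2)] mn(4)[OF z(3,4)] has_card_ge[OF card'] by (metis order_refl)+
    moreover have "odd_card (ext f y1)" if eq: "ext f y1 + ext f y2 = Fin (2 * k)"
    proof -
      obtain u v where uv: "ext f y1 = Fin u" "ext f y2 = Fin v" "u + v = 2 * k"
        using eq by (cases "ext f y1"; cases "ext f y2") auto
      \<comment> \<open>The two lower bounds add up to \<open>2 * k\<close>, so equality leaves no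
        slack and both are attained.\<close>
      then have "u = 2 * m + 1" using le mn(1) by (simp add: Fin_le_iff)
      then show ?thesis using uv by (simp add: odd_card_def)
    qed
    ultimately show ?thesis using mn(1) by (auto intro: Fin_add_le)
  qed
  then show ?thesis using mn(2) by blast
qed

lemma infinite_level:
  assumes y: "y \<in> {0..1} - flat_values" and inf: "f y \<in> {Aleph0, Continuum}"
  shows "\<exists>e>0. \<forall>y1 y2. y - e < y1 \<and> y1 < y \<and> y < y2 \<and> y2 < y + e \<longrightarrow> ext f y1 + ext f y2 \<ge> Fin n"
proof -
  have "infinite {x. E x = y}"
  proof
    assume "finite {x. E x = y}"
    then have "has_card {x. E x = y} (Fin (card {x. E x = y}))" by simp
    then have "ext f y = Fin (card {x. E x = y})" using card' has_card_unique by blast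
    then show False using inf y by (auto simp: ext_def)
  qed
  then obtain m k e where mk: "m + k = n" "e > 0"
    "\<And>z. y - e < z \<Longrightarrow> z < y \<Longrightarrow> \<exists>B. finite B \<and> card B = 2 * m \<and> B \<subseteq> {x. E x = z}"
    "\<And>z. y < z \<Longrightarrow> z < y + e \<Longrightarrow> \<exists>B. finite B \<and> card B = 2 * k \<and> B \<subseteq> {x. E x = z}"
    by (rule infinite_fibre_count[OF y, of n]) auto
  have "ext f y1 + ext f y2 \<ge> Fin n" if z: "y - e < y1" "y1 < y" "y < y2" "y2 < y + e" for y1 y2
  proof -
    have "Fin (2 * m) \<le> ext f y1" "Fin (2 * k) \<le> ext f y2"
      using mk(3)[OF z(1,2)] mk(4)[OF z(3,4)] has_card_ge[OF card'] by (metis order_refl)+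
    then show ?thesis using mk(1) by (auto intro: Fin_add_le)
  qed
  then show ?thesis using mk(2) by blast
qed

text \<open>The fibre has one of the listed sizes, and \<open>Continuum\<close> is the only one of
  them above \<open>Aleph0\<close>; hence uncountability detects it.\<close>

lemma continuum_iff:
  assumes "y \<in> {0..1}"
  shows "f y = Continuum \<longleftrightarrow> uncountable {x \<in> {0..1}. F x = y}"
proof -
  have "countable A \<longleftrightarrow> A \<lesssim> (UNIV :: nat set)" for A :: "real set"
    by (metis countable_def lepoll_def top_greatest)
  then show ?thesis
    using has_card_le_iff[OF card[OF assms], of "UNIV :: nat set" Aleph0]
    by (cases "f y") (auto simp: less_eq_cardval_def)
qed

lemma flat_values_continuum: "flat_values \<subseteq> {y \<in> {0..1}. f y = Continuum}"
proof
  fix y assume y: "y \<in> flat_values"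
  then obtain a b where "0 \<le> a" "a < b" "b \<le> 1" "\<forall>x. a \<le> x \<and> x \<le> b \<longrightarrow> F x = y" "y \<in> {0..1}"
    unfolding flat_values_def by blast
  then have "{a..b} \<subseteq> {x \<in> {0..1}. F x = y}" "uncountable {a..b}" by (auto simp: uncountable_closed_interval)
  then show "y \<in> {y \<in> {0..1}. f y = Continuum}"
    using continuum_iff[of y] \<open>y \<in> {0..1}\<close> countable_subset by blast
qed

lemma analytic_continuum: "analytic_set {y \<in> {0..1}. f y = Continuum}"
proof -
  have "{y \<in> {0..1}. f y = Continuum} = {y. uncountable {x \<in> {0..1}. F x = y}}"
  proof (intro set_eqI iffI)
    fix y assume "y \<in> {y. uncountable {x \<in> {0..1}. F x = y}}"
    then have "uncountable {x \<in> {0..1}. F x = y}" by simp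
    then have "{x \<in> {0..1}. F x = y} \<noteq> {}" by (metis countable_empty)
    then have "y \<in> {0..1}" using range by blast
    then show "y \<in> {y \<in> {0..1}. f y = Continuum}"
      using continuum_iff \<open>uncountable {x \<in> {0..1}. F x = y}\<close> by simp
  qed (use continuum_iff in auto)
  then show ?thesis using analytic_uncountable_fibres[OF cont] by simp
qed

end


subsection \<open>Monotone maps with prescribed flat pieces\<close>

text \<open>The mass of \<open>A\<close> under a finite purely atomic measure with atoms in
  \<open>R\<close>, summed over an enumeration. An element enumerated repeatedly merely gets a
  larger weight; testing membership in \<open>R\<close> gives no mass to the default values of the
  enumeration of an empty \<open>R\<close>.\<close>

definition jump :: "real set \<Rightarrow> real set \<Rightarrow> real" where
  "jump R A = (\<Sum>n. if from_nat_into R n \<in> R \<inter> A then (1/2)^n else 0)"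

lemma jump_summable: "summable (\<lambda>n. if from_nat_into R n \<in> R \<inter> A then (1/2::real)^n else 0)"
  by (rule summable_comparison_test'[of "\<lambda>n. (1/2::real)^n"]) auto

lemma jump_nonneg: "0 \<le> jump R A"
  unfolding jump_def by (intro suminf_nonneg jump_summable) auto

lemma jump_le_2: "jump R A \<le> 2"
proof -
  have "jump R A \<le> (\<Sum>n. (1/2::real)^n)"
    unfolding jump_def by (intro suminf_le jump_summable) auto
  then show ?thesis using suminf_geometric[of "1/2::real"] by simp
qed

lemma jump_Un:
  assumes "A \<inter> B = {}"
  shows "jump R (A \<union> B) = jump R A + jump R B"
  unfolding jump_def suminf_add[OF jump_summable jump_summable]
  by (intro suminf_cong) (use assms in auto)

lemma jump_pos:
  assumes "countable R" "r \<in> R" "r \<in> A"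
  shows "0 < jump R A"
proof -
  obtain n where "from_nat_into R n = r"
    using from_nat_into_surj[OF assms(1,2)] by blast
  then have "(1/2)^n = (if from_nat_into R n \<in> R \<inter> A then (1/2::real)^n else 0)"
    using assms by simp
  also have "\<dots> \<le> jump R A"
    using sum_le_suminf[OF jump_summable, of "{n}" R A] unfolding jump_def by simp
  finally show ?thesis by (rule less_le_trans[rotated]) simp
qed

lemma jump_empty:
  assumes "R \<inter> A = {}"
  shows "jump R A = 0"
  unfolding jump_def using assms by simp

lemma jump_ge_partial: "(\<Sum>n<N. if from_nat_into R n \<in> R \<inter> A then (1/2)^n else 0) \<le> jump R A"
  unfolding jump_def by (rule sum_le_suminf[OF jump_summable]) auto

lemma jump_gt_partial:
  assumes "c < jump R A"
  obtains N where "c < (\<Sum>n<N. if from_nat_into R n \<in> R \<inter> A then (1/2)^n else 0)"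
proof -
  have "(\<lambda>N. \<Sum>n<N. if from_nat_into R n \<in> R \<inter> A then (1/2)^n else 0) \<longlonglongrightarrow> jump R A"
    unfolding jump_def by (rule summable_LIMSEQ[OF jump_summable])
  then have "\<forall>\<^sub>F N in sequentially. c < (\<Sum>n<N. if from_nat_into R n \<in> R \<inter> A then (1/2)^n else 0)"
    using assms order_tendstoD(1) by blast
  then show ?thesis using that by (auto simp: eventually_sequentially)
qed

lemma jump_tail:
  "jump R A \<le> (\<Sum>n<N. if from_nat_into R n \<in> R \<inter> A then (1/2)^n else 0) + 2 * (1/2)^N"
proof -
  let ?f = "\<lambda>n. if from_nat_into R n \<in> R \<inter> A then (1/2::real)^n else 0"
  have "(\<Sum>n. ?f (n + N)) \<le> (\<Sum>n. (1/2::real)^N * (1/2)^n)"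
  proof (rule suminf_le)
    show "?f (n + N) \<le> (1/2)^N * (1/2)^n" for n by (simp add: power_add)
    show "summable (\<lambda>n. ?f (n + N))"
      by (rule summable_ignore_initial_segment[OF jump_summable])
    show "summable (\<lambda>n. (1/2::real)^N * (1/2)^n)" by (intro summable_mult) simp
  qed
  also have "\<dots> = (1/2::real)^N * 2"
    using suminf_geometric[of "1/2::real"] by (subst suminf_mult) auto
  finally show ?thesis
    unfolding jump_def using suminf_split_initial_segment[OF jump_summable, of R A N] by simp
qed

text \<open>\<open>flat_lo R v\<close> and \<open>flat_hi R v\<close> are the one-sided limits at
  \<open>v\<close> of the strictly increasing function that adds to \<open>v\<close> the mass of
  \<open>{..v}\<close>. Its generalised inverse turns a jump at a point of \<open>R\<close> into an
  interval of constancy.\<close>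

definition flat_lo :: "real set \<Rightarrow> real \<Rightarrow> real" where
  "flat_lo R v = v + jump R {..<v}"

definition flat_hi :: "real set \<Rightarrow> real \<Rightarrow> real" where
  "flat_hi R v = v + jump R {..v}"

lemma flat_hi_eq: "flat_hi R v = flat_lo R v + jump R {v}"
proof -
  have "{..v} = {..<v} \<union> {v}" by auto
  then have "jump R {..v} = jump R {..<v} + jump R {v}"
    using jump_Un[of "{..<v}" "{v}" R] by simp
  then show ?thesis by (simp add: flat_hi_def flat_lo_def)
qed

lemma flat_lo_le_hi: "flat_lo R v \<le> flat_hi R v"
  using flat_hi_eq jump_nonneg by simp

lemma flat_lo_less_hi: "countable R \<Longrightarrow> v \<in> R \<Longrightarrow> flat_lo R v < flat_hi R v"
  using flat_hi_eq jump_pos[of R v "{v}"] by simp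

lemma flat_lo_eq_hi: "v \<notin> R \<Longrightarrow> flat_lo R v = flat_hi R v"
  using flat_hi_eq jump_empty[of R "{v}"] by simp

text \<open>The gap of length at least \<open>w - v\<close> serves twice: it separates the intervals
  belonging to different values, and it gives the inverse the Lipschitz constant
  \<open>1\<close>.\<close>

lemma flat_hi_less_lo:
  assumes "v < w"
  shows "flat_hi R v + (w - v) \<le> flat_lo R w"
proof -
  have "{..v} \<union> {v<..<w} = {..<w}" using assms by (rule ivl_disj_un_one(1))
  then have "jump R {..<w} = jump R {..v} + jump R {v<..<w}"
    by (metis jump_Un ivl_disj_int_one(1))
  then show ?thesis using jump_nonneg[of R "{v<..<w}"] by (simp add: flat_hi_def flat_lo_def)
qed

lemma flat_lo_mono: "v \<le> w \<Longrightarrow> flat_lo R v \<le> flat_lo R w"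
  using flat_hi_less_lo[of v w R] flat_lo_le_hi[of R v] by (cases "v = w") auto

lemma flat_exists: "\<exists>v. flat_lo R v \<le> x \<and> x \<le> flat_hi R v"
proof -
  define T where "T = {t. flat_lo R t \<le> x}"
  define v where "v = Sup T"
  have "x - 2 \<in> T"
    using jump_le_2[of R "{..<x - 2}"] by (simp add: T_def flat_lo_def)
  have bdd: "bdd_above T"
    unfolding T_def flat_lo_def using jump_nonneg[of R]
    by (intro bdd_aboveI[of _ x]) (auto intro: order_trans[rotated])
  have upper: "t \<le> v" if "t \<in> T" for t
    unfolding v_def using that bdd by (rule cSup_upper)
  have "flat_lo R v \<le> x"
  proof (rule ccontr)
    assume "\<not> flat_lo R v \<le> x"
    then have "x - v < jump R {..<v}" by (simp add: flat_lo_def)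
    then obtain N where N: "x - v < (\<Sum>n<N. if from_nat_into R n \<in> R \<inter> {..<v} then (1/2)^n else 0)" (is "_ < ?s")
      using jump_gt_partial by blast
    \<comment> \<open>Finitely many atoms below \<open>v\<close> already carry more than
      \<open>x - v\<close>. A point \<open>t < v\<close> beyond all of them and beyond
      \<open>x - ?s\<close> still has \<open>flat_lo R t\<close> above \<open>x\<close>, although
      members of \<open>T\<close> exist to its right.\<close>
    define M where "M = insert (x - ?s) {from_nat_into R n | n. n < N \<and> from_nat_into R n < v}"
    have M: "finite M" "M \<noteq> {}" "\<And>m. m \<in> M \<Longrightarrow> m < v" using N by (auto simp: M_def)
    define t where "t = (Max M + v) / 2"
    have "Max M < v" using M by simp
    then have t: "t < v" "Max M < t" unfolding t_def by auto
    have tM: "m < t" if "m \<in> M" for m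
      using Max_ge[OF M(1) that] t by simp
    have "?s = (\<Sum>n<N. if from_nat_into R n \<in> R \<inter> {..<t} then (1/2)^n else 0)"
    proof (intro sum.cong refl)
      fix n assume "n \<in> {..<N}"
      then have "from_nat_into R n < v \<longleftrightarrow> from_nat_into R n < t"
        using t(1) tM[of "from_nat_into R n"] by (auto simp: M_def)
      then show "(if from_nat_into R n \<in> R \<inter> {..<v} then (1/2::real)^n else 0) =
        (if from_nat_into R n \<in> R \<inter> {..<t} then (1/2)^n else 0)" by simp
    qed
    then have "?s \<le> jump R {..<t}" using jump_ge_partial[where A = "{..<t}"] by simp
    moreover have "x - ?s < t" using tM by (simp add: M_def)
    ultimately have "x < flat_lo R t" by (simp add: flat_lo_def)
    moreover obtain u where "u \<in> T" "t < u"
      using t(1) less_cSupE[of t T] \<open>x - 2 \<in> T\<close> unfolding v_def by blast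
    ultimately show False
      using flat_lo_mono[of t u R] by (simp add: T_def)
  qed
  moreover have "x \<le> flat_hi R v"
  proof (rule ccontr)
    assume "\<not> x \<le> flat_hi R v"
    \<comment> \<open>Half of the gap pays for the step from \<open>v\<close> to \<open>s\<close>,
      the other half for the mass strictly between them, from which the first \<open>N\<close> atoms
      are kept away.\<close>
    define \<delta> where "\<delta> = (x - flat_hi R v) / 2"
    have "\<delta> > 0" using \<open>\<not> x \<le> flat_hi R v\<close> by (simp add: \<delta>_def)
    then obtain N where N: "2 * (1/2)^N < \<delta>"
      using real_arch_pow_inv[of "\<delta>/2" "1/2"] by (auto simp: field_simps)
    define M where "M = insert (v + \<delta>) {from_nat_into R n | n. n < N \<and> v < from_nat_into R n}"
    have M: "finite M" "M \<noteq> {}" "\<And>m. m \<in> M \<Longrightarrow> v < m" using \<open>\<delta> > 0\<close> by (auto simp: M_def)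
    define s where "s = Min M"
    have sM: "s \<le> m" if "m \<in> M" for m
      unfolding s_def using M(1) that by simp
    have s: "v < s" "s \<le> v + \<delta>"
      using M(3)[OF Min_in[OF M(1,2)]] sM by (simp_all add: s_def M_def)
    have "(\<Sum>n<N. if from_nat_into R n \<in> R \<inter> {v<..<s} then (1/2::real)^n else 0) = 0"
    proof (intro sum.neutral ballI)
      fix n assume "n \<in> {..<N}"
      then have "from_nat_into R n \<notin> {v<..<s}"
        using sM[of "from_nat_into R n"] unfolding M_def by fastforce
      then show "(if from_nat_into R n \<in> R \<inter> {v<..<s} then (1/2::real)^n else 0) = 0" by simp
    qed
    then have "jump R {v<..<s} \<le> \<delta>"
      using jump_tail[of R "{v<..<s}" N] N by simp
    moreover have "{..v} \<union> {v<..<s} = {..<s}" using s(1) by (rule ivl_disj_un_one(1))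
    then have "jump R {..<s} = jump R {..v} + jump R {v<..<s}"
      by (metis jump_Un ivl_disj_int_one(1))
    ultimately have "flat_lo R s \<le> x"
      using s(2) \<open>\<not> x \<le> flat_hi R v\<close> unfolding \<delta>_def flat_lo_def flat_hi_def by (simp add: field_simps)
    then show False using upper[of s] s(1) by (simp add: T_def)
  qed
  ultimately show ?thesis by blast
qed

definition flat_map :: "real set \<Rightarrow> real \<Rightarrow> real" where
  "flat_map R x = (SOME v. flat_lo R v \<le> x \<and> x \<le> flat_hi R v)"

lemma flat_map_bounds: "flat_lo R (flat_map R x) \<le> x" "x \<le> flat_hi R (flat_map R x)"
  unfolding flat_map_def using someI_ex[OF flat_exists[of R x]] by auto

lemma flat_map_iff: "flat_map R x = v \<longleftrightarrow> flat_lo R v \<le> x \<and> x \<le> flat_hi R v"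
proof
  assume "flat_lo R v \<le> x \<and> x \<le> flat_hi R v"
  then show "flat_map R x = v"
    using flat_map_bounds[where R=R and x=x] flat_hi_less_lo[of v "flat_map R x" R] flat_hi_less_lo[of "flat_map R x" v R]
    by (cases v "flat_map R x" rule: linorder_cases) auto
qed (use flat_map_bounds in auto)

lemma flat_map_lipschitz:
  assumes "x \<le> y"
  shows "flat_map R x \<le> flat_map R y" "flat_map R y - flat_map R x \<le> y - x"
proof -
  show "flat_map R x \<le> flat_map R y"
    using flat_map_bounds[where R=R and x=x] flat_map_bounds[where R=R and x=y] assms
      flat_hi_less_lo[of "flat_map R y" "flat_map R x" R] by force
  then show "flat_map R y - flat_map R x \<le> y - x"
    using flat_map_bounds[where R=R and x=x] flat_map_bounds[where R=R and x=y] assms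
      flat_hi_less_lo[of "flat_map R x" "flat_map R y" R] by force
qed

lemma continuous_on_flat_map: "continuous_on A (flat_map R)"
proof (rule lipschitz_on_continuous_on[of 1])
  show "1-lipschitz_on A (flat_map R)"
  proof (rule lipschitz_onI)
    fix x y
    show "dist (flat_map R x) (flat_map R y) \<le> 1 * dist x y"
      using flat_map_lipschitz[of x y R] flat_map_lipschitz[of y x R]
      by (cases "x \<le> y") (auto simp: dist_real_def)
  qed simp
qed


section \<open>Affine maps and the basic excursion\<close>

definition aff :: "real \<Rightarrow> real \<Rightarrow> real \<Rightarrow> real \<Rightarrow> real \<Rightarrow> real" where
  "aff a b u w x = u + (w - u) * ((x - a) / (b - a))"

lemma aff_left: "aff a b u w a = u" by (simp add: aff_def)

lemma aff_right: "a \<noteq> b \<Longrightarrow> aff a b u w b = w" by (simp add: aff_def)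

lemma aff_aff: "a \<noteq> b \<Longrightarrow> u \<noteq> w \<Longrightarrow> aff u w a b (aff a b u w x) = x"
  by (simp add: aff_def)

lemma aff_eq_iff: "a \<noteq> b \<Longrightarrow> u \<noteq> w \<Longrightarrow> aff a b u w x = v \<longleftrightarrow> x = aff u w a b v"
  using aff_aff by metis

lemma aff_less: 
  assumes "a < b" "u < w" "x < y"
  shows "aff a b u w x < aff a b u w y"
  using assms by (simp add: aff_def divide_strict_right_mono mult_strict_left_mono)

lemma aff_less_dec: 
  assumes "a < b" "w < u" "x < y"
  shows "aff a b u w y < aff a b u w x"
  using assms by (simp add: aff_def divide_strict_right_mono mult_strict_left_mono_neg)

lemma aff_less_iff: "a < b \<Longrightarrow> u < w \<Longrightarrow> aff a b u w x < aff a b u w y \<longleftrightarrow> x < y"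
  using aff_less by (metis linorder_cases order_less_asym)

lemma aff_le_iff: "a < b \<Longrightarrow> u < w \<Longrightarrow> aff a b u w x \<le> aff a b u w y \<longleftrightarrow> x \<le> y"
  using aff_less_iff by (metis not_le)

lemma aff_less_dec_iff: "a < b \<Longrightarrow> w < u \<Longrightarrow> aff a b u w x < aff a b u w y \<longleftrightarrow> y < x"
  using aff_less_dec by (metis linorder_cases order_less_asym)

lemma aff_le_dec_iff: "a < b \<Longrightarrow> w < u \<Longrightarrow> aff a b u w x \<le> aff a b u w y \<longleftrightarrow> y \<le> x"
  using aff_less_dec_iff by (metis not_le)

lemma continuous_on_aff: "continuous_on A (aff a b u w)"
  unfolding aff_def divide_inverse by (intro continuous_intros)

text \<open>A path from \<open>r\<close> down to \<open>p\<close>, up to \<open>q\<close> and back to \<open>r\<close> whose rising part is flat exactly at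
  the values in \<open>R\<close>. Counting only the half-open remainder of each flat piece, it takes the values in
  \<open>{p<..<q}\<close> twice and \<open>p\<close>, \<open>q\<close> once.\<close>

definition is_gadget where
  "is_gadget s t p q r R \<gamma> lo hi a b \<longleftrightarrow>
    s < a \<and> a < b \<and> b < t \<and> continuous_on {s..t} \<gamma> \<and> \<gamma> s = r \<and> \<gamma> t = r \<and> \<gamma> a = p \<and> \<gamma> b = (q::real) \<and>
    (\<forall>x. s \<le> x \<longrightarrow> x \<le> t \<longrightarrow> p \<le> \<gamma> x \<and> \<gamma> x \<le> q) \<and>
    (\<forall>v\<in>R. a < lo v \<and> lo v < hi v \<and> hi v < b) \<and>
    (\<forall>x v. a \<le> x \<longrightarrow> x \<le> b \<longrightarrow> p \<le> v \<longrightarrow> v \<le> q \<longrightarrow> (\<gamma> x = v \<longleftrightarrow> lo v \<le> x \<and> x \<le> hi v)) \<and>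
    (\<forall>v. p \<le> v \<longrightarrow> v \<le> q \<longrightarrow> {x \<in> {a..b::real}. \<gamma> x = v \<and> (\<forall>c\<in>R. x \<notin> {lo c<..hi c})} = {lo v}) \<and>
    (\<forall>v. finite {x \<in> {s<..t}. \<gamma> x = v \<and> (\<forall>c\<in>R. x \<notin> {lo c<..hi c})} \<and>
      card {x \<in> {s<..t}. \<gamma> x = v \<and> (\<forall>c\<in>R. x \<notin> {lo c<..hi c})} =
       (if p \<le> v \<and> v < q then 1 else 0) + (if p < v \<and> v \<le> q then 1 else 0))"

text \<open>The first third falls from \<open>r\<close> to \<open>p\<close>, the middle third is a
  rescaled \<open>flat_map\<close> rising from \<open>p\<close> to \<open>q\<close>, and the last
  falls back to \<open>r\<close>. Values of \<open>{p<..<r}\<close> are taken by the first two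
  parts, values of \<open>{r..<q}\<close> by the last two, and the extreme values by the rising part
  only. Leaving out \<open>s\<close> but keeping \<open>t\<close> counts \<open>r\<close> once on
  the falling parts.\<close>

lemma gadget_exists:
  fixes s t p q r :: real
  assumes st: "s < t" and pr: "p < r" and rq: "r < q" and R: "countable R" "R \<subseteq> {p<..<q}"
  shows "\<exists>\<gamma> lo hi a b. is_gadget s t p q r R \<gamma> lo hi a b"
proof -
  define a where "a = (2 * s + t) / 3"
  define b where "b = (s + 2 * t) / 3"
  have sabt: "s < a" "a < b" "b < t" using st by (auto simp: a_def b_def field_simps)
  have pq: "p < q" using pr rq by simp
  \<comment> \<open>Since the extreme values are not in \<open>R\<close>, the rising part has no
    flat piece at its ends, and the flat pieces stay strictly inside the middle third.\<close>
  have pqR: "p \<notin> R" "q \<notin> R" using R(2) by auto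
  define L where "L = flat_lo R p"
  define U where "U = flat_lo R q"
  have LU: "L < U" "flat_hi R p = L" "flat_hi R q = U"
    using flat_hi_less_lo[OF pq, of R] pq flat_lo_eq_hi[OF pqR(1)] flat_lo_eq_hi[OF pqR(2)]
    by (auto simp: L_def U_def)
  define lo where "lo v = aff L U a b (flat_lo R v)" for v
  define hi where "hi v = aff L U a b (flat_hi R v)" for v
  define m where "m x = flat_map R (aff a b L U x)" for x
  define \<gamma> where "\<gamma> x = (if x \<le> a then aff s a r p x else if x \<le> b then m x else aff b t q r x)" for x
  have m_iff: "m x = v \<longleftrightarrow> lo v \<le> x \<and> x \<le> hi v" for x v
  proof -
    have "flat_lo R v = aff a b L U (lo v)" "flat_hi R v = aff a b L U (hi v)"
      using aff_aff[of L U a b] LU sabt by (auto simp: lo_def hi_def)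
    then show ?thesis
      unfolding m_def flat_map_iff using aff_le_iff[OF sabt(2) LU(1)] by simp
  qed
  have ma: "m a = p" and mb: "m b = q"
    unfolding m_def flat_map_iff using LU sabt by (auto simp: aff_left aff_right L_def U_def)
  have lo_ge: "a \<le> lo v" if "p \<le> v" for v
    using flat_lo_mono[OF that, of R] aff_le_iff[OF LU(1) sabt(2), of L "flat_lo R v"]
    by (simp add: lo_def L_def aff_left)
  have hi_le: "hi v \<le> b" if "v \<le> q" for v
  proof -
    have "flat_hi R v \<le> U"
      using that flat_hi_less_lo[of v q R] LU by (cases "v = q") (auto simp: U_def)
    then show ?thesis
      using aff_le_iff[OF LU(1) sabt(2), of "flat_hi R v" U] LU by (simp add: hi_def aff_right)
  qed
  have lo_hi: "lo v \<le> hi v" for v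
    using flat_lo_le_hi aff_le_iff[OF LU(1) sabt(2)] by (simp add: lo_def hi_def)
  have mid: "\<gamma> x = v \<longleftrightarrow> lo v \<le> x \<and> x \<le> hi v" if "a \<le> x" "x \<le> b" for x v
  proof (cases "x = a")
    case True
    then show ?thesis using ma m_iff[of a v] sabt aff_right[of s a r p] by (simp add: \<gamma>_def)
  next
    case False
    then show ?thesis using that m_iff by (simp add: \<gamma>_def)
  qed
  have first: "\<gamma> x = aff s a r p x" if "x \<le> a" for x using that by (simp add: \<gamma>_def)
  have last: "\<gamma> x = aff b t q r x" if "b \<le> x" for x
    using that sabt mb by (cases "x = b") (auto simp: \<gamma>_def aff_left)
  have m_range: "p \<le> m x \<and> m x \<le> q" if "a \<le> x" "x \<le> b" for x
    using that flat_map_lipschitz(1)[of "aff a b L U a" "aff a b L U x" R]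
      flat_map_lipschitz(1)[of "aff a b L U x" "aff a b L U b" R] aff_le_iff[OF sabt(2) LU(1)] ma mb
    by (simp add: m_def)
  have first_range: "p \<le> aff s a r p x \<and> aff s a r p x \<le> r" if "s \<le> x" "x \<le> a" for x
    using aff_le_dec_iff[OF sabt(1) pr, of x s] aff_le_dec_iff[OF sabt(1) pr, of a x] that sabt
    by (auto simp: aff_left aff_right)
  have last_range: "r \<le> aff b t q r x \<and> aff b t q r x \<le> q" if "b \<le> x" "x \<le> t" for x
    using aff_le_dec_iff[OF sabt(3) rq, of x b] aff_le_dec_iff[OF sabt(3) rq, of t x] that sabt
    by (auto simp: aff_left aff_right)
  have range: "p \<le> \<gamma> x \<and> \<gamma> x \<le> q" if "s \<le> x" "x \<le> t" for x
    using that m_range[of x] first_range[of x] last_range[of x] pr rq unfolding \<gamma>_def by auto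
  have cont: "continuous_on {s..t} \<gamma>"
  proof -
    have "continuous_on {a..} (\<lambda>x. if x \<le> b then m x else aff b t q r x)"
    proof -
      have "continuous_on ({a..b} \<union> {b..}) (\<lambda>x. if x \<le> b then m x else aff b t q r x)"
        unfolding m_def
        by (rule continuous_on_If)
          (use sabt mb in \<open>auto simp: m_def aff_left intro!: continuous_on_aff
              continuous_on_compose2[OF continuous_on_flat_map[of UNIV]]\<close>)
      moreover have "{a..b} \<union> {b..} = {a..}" using sabt by auto
      ultimately show ?thesis by simp
    qed
    then have "continuous_on ({..a} \<union> {a..}) \<gamma>"
      unfolding \<gamma>_def
      by (intro continuous_on_If) (use sabt ma in \<open>auto simp: aff_right intro!: continuous_on_aff\<close>)
    then show ?thesis by (rule continuous_on_subset) auto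
  qed
  have mid_count: "{x \<in> {a..b}. \<gamma> x = v \<and> (\<forall>c\<in>R. x \<notin> {lo c<..hi c})} = {lo v}" if v: "p \<le> v" "v \<le> q" for v
  proof (intro set_eqI iffI)
    fix x assume x: "x \<in> {x \<in> {a..b}. \<gamma> x = v \<and> (\<forall>c\<in>R. x \<notin> {lo c<..hi c})}"
    then have "lo v \<le> x" "x \<le> hi v" using mid by auto
    moreover have "lo v = hi v" if "v \<notin> R" using flat_lo_eq_hi[OF that] by (simp add: lo_def hi_def)
    ultimately show "x \<in> {lo v}" using x by (cases "v \<in> R") force+
  next
    fix x assume "x \<in> {lo v}"
    then have x: "x = lo v" by simp
    have ab: "lo v \<in> {a..b}" using lo_ge[OF v(1)] hi_le[OF v(2)] lo_hi[of v] by simp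
    then have "\<gamma> (lo v) = v" using mid lo_hi by simp
    moreover have "lo v \<notin> {lo c<..hi c}" for c
      using m_iff[of "lo v" v] m_iff[of "lo v" c] lo_hi[of v] by auto
    ultimately show "x \<in> {x \<in> {a..b}. \<gamma> x = v \<and> (\<forall>c\<in>R. x \<notin> {lo c<..hi c})}"
      using x ab by simp
  qed
  have R_in: "a < lo v \<and> lo v < hi v \<and> hi v < b" if "v \<in> R" for v
  proof -
    have v: "p < v" "v < q" using that R(2) by auto
    have "lo v \<noteq> a" using m_iff[of a v] ma lo_hi[of v] v by auto
    moreover have "hi v \<noteq> b" using m_iff[of b v] mb lo_hi[of v] v by auto
    moreover have "lo v < hi v"
      using flat_lo_less_hi[OF R(1) that] aff_less_iff[OF LU(1) sabt(2)] by (simp add: lo_def hi_def)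
    ultimately show ?thesis using lo_ge[of v] hi_le[of v] v by simp
  qed
  have split: "{x \<in> {s<..t}. \<gamma> x = v \<and> (\<forall>c\<in>R. x \<notin> {lo c<..hi c})} =
      {x \<in> {s<..<a}. aff s a r p x = v} \<union> {x \<in> {a..b}. \<gamma> x = v \<and> (\<forall>c\<in>R. x \<notin> {lo c<..hi c})} \<union>
      {x \<in> {b<..t}. aff b t q r x = v}" (is "?X = ?A \<union> ?M \<union> ?B") for v
  proof -
    have "x \<notin> {lo c<..hi c}" if "c \<in> R" "x < a \<or> b < x" for x c
      using R_in[OF that(1)] that(2) by auto
    then show ?thesis using first last sabt by (auto simp: not_le not_less less_imp_le)
  qed
  have A: "{x \<in> {s<..<a}. aff s a r p x = v} = (if p < v \<and> v < r then {aff r p s a v} else {})" for v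
  proof -
    have "s < aff r p s a v \<and> aff r p s a v < a \<longleftrightarrow> p < v \<and> v < r"
      using aff_less_dec_iff[OF sabt(1) pr, of "aff r p s a v" s] aff_less_dec_iff[OF sabt(1) pr, of a "aff r p s a v"]
        aff_aff[of r p s a v] sabt pr by (auto simp: aff_left aff_right)
    then show ?thesis using aff_eq_iff[of s a r p] sabt pr by auto
  qed
  have B: "{x \<in> {b<..t}. aff b t q r x = v} = (if r \<le> v \<and> v < q then {aff q r b t v} else {})" for v
  proof -
    have "b < aff q r b t v \<and> aff q r b t v \<le> t \<longleftrightarrow> r \<le> v \<and> v < q"
      using aff_less_dec_iff[OF sabt(3) rq, of "aff q r b t v" b] aff_le_dec_iff[OF sabt(3) rq, of t "aff q r b t v"]
        aff_aff[of q r b t v] sabt rq by (auto simp: aff_left aff_right)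
    then show ?thesis using aff_eq_iff[of b t q r] sabt rq by auto
  qed
  have M: "{x \<in> {a..b}. \<gamma> x = v \<and> (\<forall>c\<in>R. x \<notin> {lo c<..hi c})} = (if p \<le> v \<and> v \<le> q then {lo v} else {})" for v
    using mid_count[of v] range sabt by (auto simp del: greaterThanAtMost_iff)
  have fin: "finite {x \<in> {s<..t}. \<gamma> x = v \<and> (\<forall>c\<in>R. x \<notin> {lo c<..hi c})}" for v
    unfolding split A B M by simp
  have card: "card {x \<in> {s<..t}. \<gamma> x = v \<and> (\<forall>c\<in>R. x \<notin> {lo c<..hi c})} =
       (if p \<le> v \<and> v < q then 1 else 0) + (if p < v \<and> v \<le> q then 1 else 0)" for v
  proof -
    let ?A = "{x \<in> {s<..<a}. aff s a r p x = v}" and ?B = "{x \<in> {b<..t}. aff b t q r x = v}"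
    let ?M = "{x \<in> {a..b}. \<gamma> x = v \<and> (\<forall>c\<in>R. x \<notin> {lo c<..hi c})}"
    have "card (?A \<union> ?M \<union> ?B) = card ?A + card ?M + card ?B"
    proof -
      have "finite ?A" "finite ?M" "finite ?B" unfolding A B M by simp_all
      moreover have "?A \<inter> ?M = {}" "(?A \<union> ?M) \<inter> ?B = {}" using sabt by auto
      ultimately show ?thesis by (simp add: card_Un_disjoint)
    qed
    then show ?thesis
      unfolding split A B M using pr rq by (simp split: if_splits)
  qed
  have ends: "\<gamma> s = r" "\<gamma> t = r" "\<gamma> a = p" "\<gamma> b = q"
    using sabt first last by (auto simp: aff_left aff_right)
  have "is_gadget s t p q r R \<gamma> lo hi a b"
    unfolding is_gadget_def
    by (intro conjI allI impI ballI sabt cont ends mid mid_count fin card) (use range R_in in auto)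
  then show ?thesis by blast
qed


subsection \<open>Continuous functions from trees of intervals\<close>

text \<open>Node \<open>n\<close> stands for an excursion with value range
  \<open>{p n..q n}\<close>, to be inserted into that of its parent. Finiteness of the set of long
  ranges makes late insertions uniformly small, and \<open>par n < n\<close> permits recursion along
  the numbering.\<close>

locale interval_tree =
  fixes N :: "nat set" and par :: "nat \<Rightarrow> nat" and p q :: "nat \<Rightarrow> real"
  assumes zero_in: "0 \<in> N"
    and par: "n \<in> N \<Longrightarrow> n \<noteq> 0 \<Longrightarrow> par n < n \<and> par n \<in> N"
    and pq: "n \<in> N \<Longrightarrow> p n < q n"
    and nest: "n \<in> N \<Longrightarrow> n \<noteq> 0 \<Longrightarrow> p (par n) \<le> p n \<and> q n \<le> q (par n)"
    and small: "e > 0 \<Longrightarrow> finite {n \<in> N. e \<le> q n - p n}"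
begin

definition kids :: "nat \<Rightarrow> nat set" where
  "kids n = {c \<in> N. c \<noteq> 0 \<and> par c = n}"

text \<open>The level at which node \<open>n\<close> is inserted into its parent. Avoiding all
  earlier choices gives siblings different levels, hence disjoint flat pieces to live on.\<close>

function r :: "nat \<Rightarrow> real" where
  "r n = (SOME x. p n < x \<and> x < q n \<and> x \<notin> r ` {..<n})"
  by auto
termination by (relation less_than) auto

declare r.simps [simp del]

lemma r: 
  assumes "n \<in> N" 
  shows "p n < r n" "r n < q n" "m < n \<Longrightarrow> r m \<noteq> r n"
proof -
  have "infinite ({p n<..<q n} - r ` {..<n})"
    using pq[OF assms] by (intro Diff_infinite_finite) auto
  then have "{p n<..<q n} - r ` {..<n} \<noteq> {}"
    by (metis finite.emptyI)
  then have ex: "\<exists>x. p n < x \<and> x < q n \<and> x \<notin> r ` {..<n}" by auto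
  have *: "p n < r n \<and> r n < q n \<and> r n \<notin> r ` {..<n}"
    unfolding r.simps[of n] by (rule someI_ex[OF ex])
  then show "p n < r n" "r n < q n" by auto
  show "r m \<noteq> r n" if "m < n"
    using * that by (metis imageI lessThan_iff)
qed

lemma r_inj: "m \<in> N \<Longrightarrow> n \<in> N \<Longrightarrow> r m = r n \<Longrightarrow> m = n"
  using r(3) by (metis linorder_neqE_nat)

definition gad :: "nat \<Rightarrow> real \<Rightarrow> real \<Rightarrow> (real \<Rightarrow> real) \<times> (real \<Rightarrow> real) \<times> (real \<Rightarrow> real) \<times> real \<times> real" where
  "gad n s t = (SOME (\<gamma>, lo, hi, a, b). is_gadget s t (p n) (q n) (r n) (r ` kids n) \<gamma> lo hi a b)"

lemma gad:
  assumes "n \<in> N" "s < t" "gad n s t = (\<gamma>, lo, hi, a, b)"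
  shows "is_gadget s t (p n) (q n) (r n) (r ` kids n) \<gamma> lo hi a b"
proof -
  have "r ` kids n \<subseteq> {p n<..<q n}"
  proof clarify
    fix c assume "c \<in> kids n"
    then have "c \<in> N" "c \<noteq> 0" "par c = n" by (auto simp: kids_def)
    then show "r c \<in> {p n<..<q n}" using nest[of c] r[of c] by auto
  qed
  moreover have "countable (r ` kids n)" by (simp add: countable_subset[of _ UNIV])
  ultimately have "\<exists>\<gamma> lo hi a b. is_gadget s t (p n) (q n) (r n) (r ` kids n) \<gamma> lo hi a b"
    using gadget_exists[OF assms(2)] r[OF assms(1)] by blast
  then have "\<exists>z. case z of (\<gamma>, lo, hi, a, b) \<Rightarrow> is_gadget s t (p n) (q n) (r n) (r ` kids n) \<gamma> lo hi a b"
    by auto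
  from someI_ex[OF this] show ?thesis using assms(3) by (simp add: gad_def)
qed

text \<open>The end points of the domain of node \<open>n\<close>: the flat piece of its parent's
  gadget at level \<open>r n\<close>. The test \<open>par n < n\<close> ensures termination, and its
  failure covers the root, with domain \<open>{0..1}\<close>.\<close>

function K :: "nat \<Rightarrow> real \<times> real" where
  "K n = (if par n < n then
      (case gad (par n) (fst (K (par n))) (snd (K (par n))) of (\<gamma>, lo, hi, a, b) \<Rightarrow> (lo (r n), hi (r n)))
    else (0, 1))"
  by auto
termination by (relation less_than) auto

declare K.simps [simp del]

abbreviation "s n \<equiv> fst (K n)"
abbreviation "t n \<equiv> snd (K n)"

definition "\<gamma> n = fst (gad n (s n) (t n))"
definition "lo n = fst (snd (gad n (s n) (t n)))"
definition "hi n = fst (snd (snd (gad n (s n) (t n))))"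
definition "a n = fst (snd (snd (snd (gad n (s n) (t n)))))"
definition "b n = snd (snd (snd (snd (gad n (s n) (t n)))))"

lemma gad_n: 
  assumes "n \<in> N" "s n < t n" 
  shows "is_gadget (s n) (t n) (p n) (q n) (r n) (r ` kids n) (\<gamma> n) (lo n) (hi n) (a n) (b n)"
  by (rule gad[OF assms]) (simp add: \<gamma>_def lo_def hi_def a_def b_def)

lemma K_root: "K 0 = (0, 1)" by (simp add: K.simps)

lemma K_kid: "n \<in> N \<Longrightarrow> n \<noteq> 0 \<Longrightarrow> K n = (lo (par n) (r n), hi (par n) (r n))"
  using par[of n] by (subst K.simps) (simp add: lo_def hi_def split: prod.splits)

lemma s_less_t: "n \<in> N \<Longrightarrow> s n < t n"
proof (induction n rule: less_induct)
  case (less n)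
  show ?case
  proof (cases "n = 0")
    case True
    then show ?thesis by (simp add: K_root)
  next
    case False
    then have "s (par n) < t (par n)" using less par by blast
    then have "is_gadget (s (par n)) (t (par n)) (p (par n)) (q (par n)) (r (par n)) (r ` kids (par n)) (\<gamma> (par n))
      (lo (par n)) (hi (par n)) (a (par n)) (b (par n))"
      using gad_n par less.prems False by blast
    moreover have "n \<in> kids (par n)" using less.prems False by (simp add: kids_def)
    ultimately show ?thesis using K_kid[OF less.prems False] by (simp add: is_gadget_def)
  qed
qed

lemma gadN:
  "n \<in> N \<Longrightarrow> is_gadget (s n) (t n) (p n) (q n) (r n) (r ` kids n) (\<gamma> n) (lo n) (hi n) (a n) (b n)"
  using gad_n s_less_t by blast

lemma kid:
  assumes "n \<in> N" "c \<in> kids n"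
  shows "s c = lo n (r c)" "t c = hi n (r c)" "a n < s c" "t c < b n"
    "s n < a n" "b n < t n" "c \<in> N" "n < c" "c \<noteq> 0" "par c = n"
    "s n \<le> s c" "t c \<le> t n"
proof -
  have c: "c \<in> N" "c \<noteq> 0" "par c = n" using assms by (auto simp: kids_def)
  then show "c \<in> N" "c \<noteq> 0" "par c = n" "n < c" using par by auto
  show K: "s c = lo n (r c)" "t c = hi n (r c)" using K_kid[OF c(1,2)] c by auto
  show "a n < s c" "t c < b n" "s n < a n" "b n < t n" "s n \<le> s c" "t c \<le> t n"
    using gadN[OF assms(1)] assms(2) unfolding is_gadget_def K by force+
qed

lemma kid_flat:
  assumes "n \<in> N" "c \<in> kids n" "a n \<le> x" "x \<le> b n"
  shows "\<gamma> n x = r c \<longleftrightarrow> s c \<le> x \<and> x \<le> t c"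
proof -
  have c: "p n \<le> r c" "r c \<le> q n"
    using nest[of c] r[of c] assms(2) by (auto simp: kids_def)
  have "\<forall>x v. a n \<le> x \<longrightarrow> x \<le> b n \<longrightarrow> p n \<le> v \<longrightarrow> v \<le> q n \<longrightarrow>
      (\<gamma> n x = v \<longleftrightarrow> lo n v \<le> x \<and> x \<le> hi n v)"
    using gadN[OF assms(1)] unfolding is_gadget_def by blast
  then show ?thesis
    using c assms(3,4) kid(1,2)[OF assms(1,2)] by simp
qed

section \<open>Nested domains and the approximating functions\<close>

definition cK :: "nat \<Rightarrow> real \<Rightarrow> bool" where
  "cK n x \<longleftrightarrow> s n \<le> x \<and> x \<le> t n"

text \<open>A node owns its domain without the left end point, which is left to the parent.
  Replacing a flat piece thus leaves the parent exactly one preimage of that level on its rising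
  part, independently of what the child does.\<close>

definition inK :: "nat \<Rightarrow> real \<Rightarrow> bool" where
  "inK n x \<longleftrightarrow> s n < x \<and> x \<le> t n"

lemma inK_cK: "inK n x \<Longrightarrow> cK n x" by (simp add: inK_def cK_def)

lemma in_kids_par: "n \<in> N \<Longrightarrow> n \<noteq> 0 \<Longrightarrow> n \<in> kids (par n)" by (simp add: kids_def)

lemma cK_par:
  assumes "n \<in> N" "n \<noteq> 0" "cK n x"
  shows "inK (par n) x" "cK (par n) x" "a (par n) < x" "x < b (par n)" "\<gamma> (par n) x = r n"
proof -
  have P: "par n \<in> N" "n \<in> kids (par n)" using assms par in_kids_par by auto
  then show "a (par n) < x" "x < b (par n)" "inK (par n) x" "cK (par n) x"
    using kid[OF P] assms(3) unfolding cK_def inK_def by auto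
  then show "\<gamma> (par n) x = r n" using kid_flat[OF P, of x] assms(3) by (simp add: cK_def)
qed

text \<open>Nodes whose closed domains share a point form a chain of ancestors. If \<open>m\<close>
  lay strictly between \<open>par n\<close> and \<open>n\<close>, the two inductions would force
  \<open>par m = par n\<close>; the common parent takes both levels \<open>r m\<close> and
  \<open>r n\<close> at \<open>x\<close>, so the siblings would coincide.\<close>

lemma cK_le_par:
  assumes "m < n" "m \<in> N" "n \<in> N" "cK m x" "cK n x"
  shows "m \<le> par n"
  using assms
proof (induction n arbitrary: m rule: less_induct)
  case (less n)
  note outer = less.IH
  have n: "n \<noteq> 0" "n \<in> N" "cK n x" using less.prems by auto
  note pn = par[OF n(2,1)] cK_par[OF n(2,1,3)]
  show ?case using less.prems
  proof (induction m rule: less_induct)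
    case (less m)
    show ?case
    proof (rule ccontr)
      assume "\<not> m \<le> par n"
      then have m: "par n < m" "m \<noteq> 0" by auto
      note pm = par[OF less.prems(2) m(2)] cK_par[OF less.prems(2) m(2) less.prems(4)]
      have "par n \<le> par m" using outer[of m "par n"] m less.prems pn by blast
      moreover have "par m \<le> par n"
        using less.IH[of "par m"] pm less.prems by simp
      ultimately have "par m = par n" by simp
      then have "r m = r n" using pm(6) pn(6) by simp
      then show False using r_inj less.prems by blast
    qed
  qed
qed

lemma cK_nest:
  assumes "m \<le> n" "m \<in> N" "n \<in> N" "cK m x" "cK n x"
  shows "p m \<le> p n \<and> q n \<le> q m"
  using assms
proof (induction n rule: less_induct)
  case (less n)
  show ?case
  proof (cases "m = n")
    case False
    then have n: "n \<noteq> 0" "m < n" using less.prems by auto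
    then have "p m \<le> p (par n) \<and> q (par n) \<le> q m"
      using less.IH[of "par n"] par[OF less.prems(3) n(1)] cK_par[OF less.prems(3) n(1) less.prems(5)]
        cK_le_par[OF n(2) less.prems(2-5)] less.prems by blast
    then show ?thesis using nest[OF less.prems(3) n(1)] by auto
  qed simp
qed

lemma \<gamma>_range: "n \<in> N \<Longrightarrow> cK n x \<Longrightarrow> p n \<le> \<gamma> n x \<and> \<gamma> n x \<le> q n"
  using gadN unfolding is_gadget_def cK_def by blast

text \<open>Stage \<open>n\<close> has inserted the nodes below \<open>n\<close>. The root is
  present from the start, so the step for node \<open>0\<close> changes nothing.\<close>

primrec Fs :: "nat \<Rightarrow> real \<Rightarrow> real" where
  "Fs 0 x = \<gamma> 0 x"
| "Fs (Suc n) x = (if n \<in> N \<and> inK n x then \<gamma> n x else Fs n x)"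

lemma Fs_const:
  assumes "m \<le> n" "\<And>k. m \<le> k \<Longrightarrow> k < n \<Longrightarrow> k \<in> N \<Longrightarrow> \<not> inK k x"
  shows "Fs n x = Fs m x"
  using assms
proof (induction n)
  case (Suc n)
  then show ?case by (cases "m = Suc n") auto
qed simp

lemma Fs_val:
  assumes "m \<in> N" "inK m x" "m < n" "\<And>k. m < k \<Longrightarrow> k < n \<Longrightarrow> k \<in> N \<Longrightarrow> \<not> inK k x"
  shows "Fs n x = \<gamma> m x"
  using Fs_const[of "Suc m" n x] assms by simp

lemma Fs_on_K:
  assumes n: "n \<in> N" "n \<noteq> 0" and x: "cK n x"
  shows "Fs n x = r n"
proof -
  have "Fs n x = \<gamma> (par n) x"
  proof (rule Fs_val)
    fix k assume "par n < k" "k < n" "k \<in> N"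
    then show "\<not> inK k x" using cK_le_par[of k n x] n x inK_cK by auto
  qed (use par[OF n] cK_par[OF n x] in auto)
  then show ?thesis using cK_par[OF n x] by simp
qed

text \<open>The value is that of the last inserted gadget whose domain contains \<open>x\<close>,
  and its range lies within the range of every earlier such node.\<close>

lemma Fs_in_J:
  assumes "m \<in> N" "inK m x" "m < n"
  shows "p m \<le> Fs n x \<and> Fs n x \<le> q m"
proof -
  define M where "M = {k \<in> N. k < n \<and> inK k x}"
  have M: "finite M" "m \<in> M" using assms by (auto simp: M_def)
  then have "M \<noteq> {}" by blast
  then have MM: "Max M \<in> M" "m \<le> Max M"
    by (rule Max_in[OF M(1)]) (rule Max_ge[OF M])
  have "Fs n x = \<gamma> (Max M) x"
  proof (rule Fs_val)
    fix k assume k: "Max M < k" "k < n" "k \<in> N"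
    then have "k \<notin> M" using Max_ge[OF M(1)] not_le by blast
    then show "\<not> inK k x" using k by (simp add: M_def)
  qed (use MM in \<open>auto simp: M_def\<close>)
  then show ?thesis
    using \<gamma>_range[of "Max M" x] cK_nest[of m "Max M" x] MM assms inK_cK by (force simp: M_def)
qed

text \<open>The first node \<open>k \<ge> m\<close> containing \<open>x\<close> controls all later
  changes at \<open>x\<close>: before its insertion the value is \<open>r k\<close>, and afterwards
  it never leaves \<open>{p k..q k}\<close>. Positivity of \<open>m\<close> excludes the root, which
  has no parental flat piece.\<close>

lemma Fs_dist:
  assumes "0 < m" "m \<le> n" "\<And>k. m \<le> k \<Longrightarrow> k \<in> N \<Longrightarrow> q k - p k < e" "e > 0"
  shows "\<bar>Fs n x - Fs m x\<bar> < e"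
proof (cases "\<exists>k. m \<le> k \<and> k < n \<and> k \<in> N \<and> inK k x")
  case False
  then show ?thesis using Fs_const[of m n x] assms by auto
next
  case True
  define k where "k = (LEAST k. m \<le> k \<and> k < n \<and> k \<in> N \<and> inK k x)"
  have k: "m \<le> k" "k < n" "k \<in> N" "inK k x"
    using LeastI_ex[OF True] unfolding k_def by auto
  have "Fs k x = Fs m x"
  proof (rule Fs_const[OF k(1)])
    fix j assume "m \<le> j" "j < k" "j \<in> N"
    then show "\<not> inK j x" using not_less_Least[of j] k unfolding k_def by force
  qed
  moreover have "Fs k x = r k" using Fs_on_K[of k x] k assms(1) inK_cK by auto
  ultimately have "p k \<le> Fs m x" "Fs m x \<le> q k" using r[OF k(3)] by auto
  then show ?thesis using Fs_in_J[OF k(3,4,2)] assms(3)[OF k(1,3)] by (auto simp: abs_le_iff)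
qed

lemma eventually_short: 
  assumes "e > 0"
  obtains m where "0 < m" "\<And>k. m \<le> k \<Longrightarrow> k \<in> N \<Longrightarrow> q k - p k < e"
proof -
  obtain m where m: "\<forall>k\<in>{n \<in> N. e \<le> q n - p n}. k \<le> m"
    using finite_nat_set_iff_bounded_le[THEN iffD1, OF small[OF assms]] by (rule exE)
  show ?thesis
  proof (rule that[of "Suc m"])
    fix k assume "Suc m \<le> k" "k \<in> N"
    then have "k \<notin> {n \<in> N. e \<le> q n - p n}" using m by (meson not_less_eq_eq)
    then show "q k - p k < e" using \<open>k \<in> N\<close> by simp
  qed simp
qed

lemma continuous_on_Fs: "continuous_on {0..1} (Fs n)"
proof (induction n)
  case 0
  have "continuous_on {0..1} (\<gamma> 0)"
    using gadN[OF zero_in] unfolding is_gadget_def by (simp add: K_root)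
  then show ?case by simp
next
  case (Suc n)
  show ?case
  proof (cases "n \<in> N \<and> n \<noteq> 0")
    case False
    have "Fs (Suc n) x = Fs n x" for x using False by auto
    then show ?thesis using Suc by simp
  next
    case True
    have sn: "s n < t n" using s_less_t True by blast
    have g: "continuous_on {s n..t n} (\<gamma> n)" "\<gamma> n (s n) = r n" "\<gamma> n (t n) = r n"
      using gadN True unfolding is_gadget_def by blast+
    have Fr: "Fs n x = r n" if "s n \<le> x" "x \<le> t n" for x
      using Fs_on_K True that by (auto simp: cK_def)
    let ?h = "\<lambda>x. if x \<in> {s n..t n} then \<gamma> n x else Fs n x"
    \<comment> \<open>At \<open>s n\<close> the half-open definition still takes the old function;
      both functions have the value \<open>r n\<close> there, so pasting on the closed interval
      gives the same result.\<close>
    have eq: "Fs (Suc n) x = ?h x" for x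
      using True Fr[of x] g sn by (cases "x = s n") (auto simp: inK_def)
    have fr: "x = s n \<or> x = t n" if "x \<in> {s n..t n}" "x \<in> {..s n} \<union> {t n..}" for x using that by auto
    have "continuous_on ({0..1} \<inter> {s n..t n} \<union> {0..1} \<inter> ({..s n} \<union> {t n..})) ?h"
    proof (rule continuous_on_cases)
      show "closed ({0..1} \<inter> {s n..t n})" "closed ({0..1} \<inter> ({..s n} \<union> {t n..}))"
        by (intro closed_Int closed_Un; simp)+
      show "continuous_on ({0..1} \<inter> {s n..t n}) (\<gamma> n)" by (rule continuous_on_subset[OF g(1)]) auto
      show "continuous_on ({0..1} \<inter> ({..s n} \<union> {t n..})) (Fs n)" by (rule continuous_on_subset[OF Suc]) auto
      show "\<forall>x. x \<in> {0..1} \<inter> {s n..t n} \<and> x \<notin> {s n..t n} \<or> x \<in> {0..1} \<inter> ({..s n} \<union> {t n..}) \<and> x \<in> {s n..t n} \<longrightarrow> \<gamma> n x = Fs n x"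
        using fr g Fr sn by (metis IntD1 IntD2 less_imp_le order_refl)
    qed
    moreover have "{0..1} \<inter> {s n..t n} \<union> {0..1} \<inter> ({..s n} \<union> {t n..}) = {0..1}" by auto
    ultimately have "continuous_on {0..1} ?h" by simp
    then show ?thesis using eq by (simp only: eq cong: continuous_on_cong)
  qed
qed

definition F :: "real \<Rightarrow> real" where "F x = lim (\<lambda>n. Fs n x)"

lemma uniform_limit_F: "uniform_limit A Fs F sequentially"
proof -
  have "uniformly_Cauchy_on A Fs"
  proof (rule uniformly_Cauchy_onI)
    fix e :: real assume "e > 0"
    then obtain m where m: "0 < m" "\<And>k. m \<le> k \<Longrightarrow> k \<in> N \<Longrightarrow> q k - p k < e / 2"
      using eventually_short[of "e/2"] by auto
    have half: "\<bar>Fs i x - Fs m x\<bar> < e / 2" if "i \<ge> m" for i x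
      by (rule Fs_dist[OF m(1) that m(2)]) (use \<open>e > 0\<close> in auto)
    have "dist (Fs i x) (Fs j x) < e" if "i \<ge> m" "j \<ge> m" for i j x
      using half[OF that(1), of x] half[OF that(2), of x] unfolding dist_real_def by linarith
    then show "\<exists>M. \<forall>x\<in>A. \<forall>m\<ge>M. \<forall>n\<ge>M. dist (Fs m x) (Fs n x) < e" by blast
  qed
  then have "uniformly_convergent_on A Fs" by (rule Cauchy_uniformly_convergent)
  then show ?thesis unfolding F_def uniformly_convergent_uniform_limit_iff .
qed

lemma F_lim: "(\<lambda>n. Fs n x) \<longlonglongrightarrow> F x"
  using tendsto_uniform_limitI[OF uniform_limit_F[of UNIV]] by simp

lemma continuous_on_F: "continuous_on {0..1} F"
  by (rule uniform_limit_theorem[OF _ uniform_limit_F]) (auto simp: continuous_on_Fs)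

lemma F_in_J:
  assumes "m \<in> N" "inK m x"
  shows "p m \<le> F x" "F x \<le> q m"
proof -
  show "p m \<le> F x"
    by (rule LIMSEQ_le_const[OF F_lim]) (use Fs_in_J[OF assms] in \<open>auto intro!: exI[of _ "Suc m"]\<close>)
  show "F x \<le> q m"
    by (rule LIMSEQ_le_const2[OF F_lim]) (use Fs_in_J[OF assms] in \<open>auto intro!: exI[of _ "Suc m"]\<close>)
qed

lemma F_val:
  assumes "m \<in> N" "inK m x" "\<And>k. m < k \<Longrightarrow> k \<in> N \<Longrightarrow> \<not> inK k x"
  shows "F x = \<gamma> m x"
proof -
  have "\<forall>\<^sub>F n in sequentially. Fs n x = \<gamma> m x"
    unfolding eventually_sequentially
    by (intro exI[of _ "Suc m"]) (use assms Fs_val in \<open>auto simp: Suc_le_eq\<close>)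
  then have "(\<lambda>n. Fs n x) \<longlonglongrightarrow> \<gamma> m x" by (rule tendsto_eventually)
  then show ?thesis using F_lim LIMSEQ_unique by blast
qed

end


section \<open>Fibres of the limit function\<close>

context interval_tree begin

definition M :: "real \<Rightarrow> nat set" where
  "M x = {m \<in> N. inK m x}"

lemma M_par: "m \<in> M x \<Longrightarrow> m \<noteq> 0 \<Longrightarrow> par m \<in> M x \<and> par m < m"
  using cK_par(1)[of m x] par[of m] inK_cK by (auto simp: M_def)

text \<open>The least member of \<open>M x\<close> beyond \<open>n\<close> has its parent in
  \<open>M x\<close>; minimality and the chain property force that parent to be
  \<open>n\<close>.\<close>

lemma M_next:
  assumes n: "n \<in> M x" and ex: "\<exists>m\<in>M x. n < m"
  obtains c where "c \<in> kids n" "c \<in> M x"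
proof -
  define m where "m = (LEAST m. m \<in> M x \<and> n < m)"
  have m: "m \<in> M x" "n < m"
    using LeastI_ex[of "\<lambda>m. m \<in> M x \<and> n < m"] ex unfolding m_def by auto
  have m0: "m \<noteq> 0" using m by auto
  have pm: "par m \<in> M x" "par m < m" using M_par m m0 by auto
  then have "par m \<le> n" using not_less_Least[of "par m" "\<lambda>m. m \<in> M x \<and> n < m"] unfolding m_def by auto
  moreover have "n \<le> par m"
    using cK_le_par[of n m x] m n inK_cK by (auto simp: M_def)
  ultimately have "m \<in> kids n" using m m0 by (auto simp: kids_def M_def)
  then show ?thesis using that m by blast
qed

text \<open>The points at which the nested construction stops at node \<open>n\<close> with value \<open>y\<close>.\<close>

definition piece :: "nat \<Rightarrow> real \<Rightarrow> real set" where
  "piece n y = {x \<in> (if n = 0 then {a 0..b 0} else {s n<..t n}). \<gamma> n x = y \<and> (\<forall>c\<in>kids n. \<not> inK c x)}"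

lemma dom_bounds: "0 < a 0" "a 0 < b 0" "b 0 < 1" "\<gamma> 0 (a 0) = p 0" "\<gamma> 0 (b 0) = q 0"
  using gadN[OF zero_in] unfolding is_gadget_def by (simp_all add: K_root)

lemma inK_root: "a 0 \<le> x \<Longrightarrow> x \<le> b 0 \<Longrightarrow> inK 0 x"
  using dom_bounds by (simp add: inK_def K_root)

lemma K_in_dom: "n \<in> N \<Longrightarrow> n \<noteq> 0 \<Longrightarrow> a 0 < s n \<and> t n < b 0"
proof (induction n rule: less_induct)
  case (less n)
  have P: "par n \<in> N" "n \<in> kids (par n)" "par n < n" using less.prems par in_kids_par by auto
  show ?case
  proof (cases "par n = 0")
    case True
    then show ?thesis using kid[OF P(1,2)] by simp
  next
    case False
    then show ?thesis using less.IH[OF P(3,1)] kid[OF P(1,2)] by simp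
  qed
qed

lemma not_inK_kids_iff:
  assumes "n \<in> N"
  shows "(\<forall>c\<in>kids n. \<not> inK c x) \<longleftrightarrow> (\<forall>v\<in>r ` kids n. x \<notin> {lo n v<..hi n v})"
  using kid(1,2)[OF assms] by (auto simp: inK_def)

lemma piece_card:
  assumes "n \<in> N" "n \<noteq> 0"
  shows "finite (piece n y)"
    "card (piece n y) = (if p n \<le> y \<and> y < q n then 1 else 0) + (if p n < y \<and> y \<le> q n then 1 else 0)"
  using gadN[OF assms(1)] assms(2) unfolding is_gadget_def piece_def not_inK_kids_iff[OF assms(1)]
  by simp_all

text \<open>Only the rising part of the root gadget is kept, so the root supplies one point per
  value where another node supplies up to two. This monotone map takes the place of the
  identity.\<close>

lemma piece_0: "p 0 \<le> y \<Longrightarrow> y \<le> q 0 \<Longrightarrow> \<exists>x. piece 0 y = {x}"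
  using gadN[OF zero_in] unfolding is_gadget_def piece_def not_inK_kids_iff[OF zero_in]
  by auto

lemma piece_inK: "n \<in> N \<Longrightarrow> x \<in> piece n y \<Longrightarrow> inK n x"
  using inK_root by (auto simp: piece_def inK_def split: if_splits)

lemma piece_M:
  assumes "n \<in> N" "x \<in> piece n y"
  shows "finite (M x)" "Max (M x) = n" "F x = y" "a 0 \<le> x" "x \<le> b 0"
proof -
  have nM: "n \<in> M x" using piece_inK assms by (simp add: M_def)
  have le: "m \<le> n" if "m \<in> M x" for m
  proof (rule ccontr)
    assume "\<not> m \<le> n"
    then have "\<exists>m\<in>M x. n < m" using that by (intro bexI[of _ m]) auto
    then obtain c where "c \<in> kids n" "c \<in> M x"
      by (rule M_next[OF nM])
    then show False using assms by (auto simp: piece_def M_def)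
  qed
  then show "finite (M x)" using finite_nat_set_iff_bounded_le by blast
  then show "Max (M x) = n" using nM le by (intro Max_eqI) auto
  have "\<not> inK k x" if "n < k" "k \<in> N" for k
    using le[of k] that by (auto simp: M_def)
  then have "F x = \<gamma> n x"
    by (intro F_val assms piece_inK[OF assms])
  then show "F x = y" using assms by (simp add: piece_def)
  show "a 0 \<le> x" "x \<le> b 0"
    using assms K_in_dom[of n] by (auto simp: piece_def split: if_splits)
qed

definition fib :: "real \<Rightarrow> real set" where
  "fib y = {x \<in> {a 0..b 0}. F x = y}"

text \<open>A point either lies in finitely many domains, and then belongs to the piece of the last
  of them, or it follows an infinite branch.\<close>

lemma fib_eq: "fib y = (\<Union>n\<in>N. piece n y) \<union> {x \<in> fib y. infinite (M x)}"
proof (intro set_eqI iffI)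
  fix x assume "x \<in> (\<Union>n\<in>N. piece n y) \<union> {x \<in> fib y. infinite (M x)}"
  then show "x \<in> fib y" using piece_M by (auto simp: fib_def)
next
  fix x assume x: "x \<in> fib y"
  show "x \<in> (\<Union>n\<in>N. piece n y) \<union> {x \<in> fib y. infinite (M x)}"
  proof (cases "finite (M x)")
    case True
    define n where "n = Max (M x)"
    have "0 \<in> M x" using x inK_root zero_in by (simp add: fib_def M_def)
    then have n: "n \<in> M x" unfolding n_def using Max_in[OF True] by blast
    have le: "m \<le> n" if "m \<in> M x" for m unfolding n_def using True that by simp
    have "\<not> inK k x" if "n < k" "k \<in> N" for k
      using le[of k] that by (auto simp: M_def)
    then have "F x = \<gamma> n x"
      using n by (intro F_val) (auto simp: M_def)
    moreover have "\<not> inK c x" if "c \<in> kids n" for c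
    proof
      assume "inK c x"
      then have "c \<in> M x" using that by (auto simp: kids_def M_def)
      then show False using le[of c] kid(8)[of n c] that n by (auto simp: M_def)
    qed
    ultimately have "x \<in> piece n y"
      using x n by (auto simp: piece_def fib_def M_def inK_def)
    then show ?thesis using n by (auto simp: M_def)
  qed (use x in simp)
qed

definition over :: "real \<Rightarrow> nat set" where
  "over y = {n \<in> N - {0}. p n \<le> y \<and> y \<le> q n}"

lemma infinite_M_over:
  assumes "x \<in> fib y" "infinite (M x)"
  shows "infinite (over y)"
proof -
  have "M x - {0} \<subseteq> over y"
    using F_in_J assms by (auto simp: M_def over_def fib_def)
  moreover have "infinite (M x - {0})" using assms by simp
  ultimately show ?thesis using finite_subset by blast
qed

lemma piece_nonempty: "n \<in> over y \<Longrightarrow> piece n y \<noteq> {}"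
  using piece_card[of n y] pq[of n] by (auto simp: over_def split: if_splits)

lemma piece_empty: "n \<in> N \<Longrightarrow> n \<noteq> 0 \<Longrightarrow> n \<notin> over y \<Longrightarrow> piece n y = {}"
  using piece_card[of n y] by (auto simp: over_def split: if_splits)

lemma piece_disjoint: "m \<in> N \<Longrightarrow> n \<in> N \<Longrightarrow> m \<noteq> n \<Longrightarrow> piece m y \<inter> piece n y' = {}"
  using piece_M(2) by blast

lemma fib_finite:
  assumes y: "p 0 \<le> y" "y \<le> q 0" and fin: "finite (over y)"
  shows "finite (fib y)"
    "card (fib y) = 1 + (\<Sum>n\<in>over y. (if p n \<le> y \<and> y < q n then 1 else 0) + (if p n < y \<and> y \<le> q n then 1 else 0))"
proof -
  have "{x \<in> fib y. infinite (M x)} = {}" using infinite_M_over fin by blast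
  then have "fib y = (\<Union>n\<in>N. piece n y)" by (subst fib_eq) (simp only: Un_empty_right)
  also have "\<dots> = (\<Union>n\<in>insert 0 (over y). piece n y)"
  proof -
    have "N = insert 0 (over y) \<union> (N - {0} - over y)" using zero_in by (auto simp: over_def)
    moreover have "(\<Union>n\<in>N - {0} - over y. piece n y) = {}" using piece_empty by blast
    ultimately show ?thesis by (metis (no_types, lifting) UN_Un sup_bot.right_neutral)
  qed
  finally have eq: "fib y = (\<Union>n\<in>insert 0 (over y). piece n y)" .
  obtain x0 where x0: "piece 0 y = {x0}" using piece_0 y by blast
  have finp: "finite (piece n y)" if "n \<in> insert 0 (over y)" for n
    using that piece_card(1)[of n y] x0 by (auto simp: over_def)
  show "finite (fib y)" unfolding eq using fin finp by blast
  have "card (fib y) = (\<Sum>n\<in>insert 0 (over y). card (piece n y))"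
    unfolding eq
  proof (rule card_UN_disjoint)
    show "\<forall>i\<in>insert 0 (over y). \<forall>j\<in>insert 0 (over y). i \<noteq> j \<longrightarrow> piece i y \<inter> piece j y = {}"
      using piece_disjoint zero_in by (auto simp: over_def)
  qed (use fin finp in auto)
  also have "\<dots> = card (piece 0 y) + (\<Sum>n\<in>over y. card (piece n y))"
    using fin by (subst sum.insert) (auto simp: over_def)
  also have "(\<Sum>n\<in>over y. card (piece n y)) =
      (\<Sum>n\<in>over y. (if p n \<le> y \<and> y < q n then 1 else 0) + (if p n < y \<and> y \<le> q n then 1 else 0))"
    by (intro sum.cong refl piece_card(2)) (auto simp: over_def)
  finally show "card (fib y) = 1 + (\<Sum>n\<in>over y. (if p n \<le> y \<and> y < q n then 1 else 0) + (if p n < y \<and> y \<le> q n then 1 else 0))"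
    using x0 by simp
qed

lemma fib_infinite:
  assumes "infinite (over y)"
  shows "infinite (fib y)"
proof
  assume "finite (fib y)"
  define g where "g n = (SOME x. x \<in> piece n y)" for n
  have g: "g n \<in> piece n y" if "n \<in> over y" for n
    unfolding g_def using piece_nonempty[OF that] by (simp add: some_in_eq)
  have "over y \<subseteq> N" by (auto simp: over_def)
  have "inj_on g (over y)"
  proof (rule inj_onI)
    fix m n assume mn: "m \<in> over y" "n \<in> over y" "g m = g n"
    then show "m = n" using piece_disjoint[of m n y y] g[of m] g[of n] \<open>over y \<subseteq> N\<close> by auto
  qed
  moreover have "g ` over y \<subseteq> fib y"
    using g fib_eq[of y] \<open>over y \<subseteq> N\<close> by blast
  ultimately show False
    using \<open>finite (fib y)\<close> assms inj_on_finite by blast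
qed

section \<open>Infinite branches and large fibres\<close>

definition branch :: "(nat \<Rightarrow> nat) \<Rightarrow> bool" where
  "branch c \<longleftrightarrow> c 0 = 0 \<and> (\<forall>k. c (Suc k) \<in> kids (c k))"

text \<open>A point in infinitely many domains determines an infinite branch all of whose ranges
  contain \<open>y\<close>. If there is no such branch, the fibre is exhausted by countably many
  finite pieces.\<close>

lemma fib_countable:
  assumes "\<And>c. branch c \<Longrightarrow> \<exists>k. \<not> (p (c k) \<le> y \<and> y \<le> q (c k))" "p 0 \<le> y" "y \<le> q 0"
  shows "countable (fib y)"
proof -
  have "\<not> infinite (M x)" if x: "x \<in> fib y" for x
  proof
    assume inf: "infinite (M x)"
    have M0: "0 \<in> M x" using x inK_root zero_in by (simp add: fib_def M_def)
    have "\<exists>c. \<forall>k. (c k \<in> M x \<and> (k = 0 \<longrightarrow> c k = 0)) \<and> c (Suc k) \<in> kids (c k)"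
    proof (rule dependent_nat_choice)
      show "\<exists>n. n \<in> M x \<and> (0 = 0 \<longrightarrow> n = 0)" using M0 by auto
      fix n k :: nat assume "n \<in> M x \<and> (k = 0 \<longrightarrow> n = 0)"
      moreover have "\<exists>m\<in>M x. n < m"
        using inf by (meson finite_nat_set_iff_bounded_le not_le)
      ultimately show "\<exists>m. (m \<in> M x \<and> (Suc k = 0 \<longrightarrow> m = 0)) \<and> m \<in> kids n"
        using M_next by (metis nat.distinct(1))
    qed
    then obtain c where c: "\<And>k. c k \<in> M x" "c 0 = 0" "\<And>k. c (Suc k) \<in> kids (c k)" by auto
    then have "branch c" by (simp add: branch_def)
    moreover have "p (c k) \<le> y \<and> y \<le> q (c k)" for k
      using c(1)[of k] F_in_J x by (auto simp: M_def fib_def)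
    ultimately show False using assms by blast
  qed
  then have "{x \<in> fib y. infinite (M x)} = {}" by blast
  then have "fib y = (\<Union>n\<in>N. piece n y)" by (subst fib_eq) (simp only: Un_empty_right)
  moreover have "countable (piece n y)" if "n \<in> N" for n
  proof (cases "n = 0")
    case True
    then show ?thesis using piece_0 assms(2,3) by force
  qed (use piece_card that countable_finite in blast)
  ultimately show ?thesis by auto
qed

lemma branch_N:
  assumes "branch c"
  shows "c k \<in> N" "k \<le> c k"
proof -
  show "c k \<in> N" using assms by (cases k) (auto simp: branch_def kids_def zero_in)
  show "k \<le> c k"
  proof (induction k)
    case (Suc k)
    have "c k \<in> N" using assms by (cases k) (auto simp: branch_def kids_def zero_in)
    then show ?case using Suc assms kid(8)[of "c k" "c (Suc k)"] by (auto simp: branch_def)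
  qed simp
qed

definition branch_point :: "(nat \<Rightarrow> nat) \<Rightarrow> real" where
  "branch_point c = (SOME x. \<forall>k. inK (c k) x)"

lemma branch_point:
  assumes "branch c"
  shows "inK (c k) (branch_point c)"
proof -
  have kd: "c k \<in> N" "c (Suc k) \<in> kids (c k)" for k
    using branch_N[OF assms] assms by (auto simp: branch_def)
  have "(\<Inter>k. {s (c k)..t (c k)}) \<noteq> {}"
  proof (rule compact_nest)
    show "{s (c k)..t (c k)} \<noteq> {}" for k using s_less_t[OF kd(1)[of k]] by auto
    show "{s (c n)..t (c n)} \<subseteq> {s (c m)..t (c m)}" if "m \<le> n" for m n
      using that
    proof (induction rule: dec_induct)
      case (step n)
      then show ?case using kid(11,12)[OF kd(1)[of n] kd(2)[of n]] by auto
    qed simp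
  qed auto
  then obtain x where "x \<in> (\<Inter>k. {s (c k)..t (c k)})" by blast
  then have x: "cK (c k) x" for k by (auto simp: cK_def)
  \<comment> \<open>A child's domain begins strictly to the right of its parent's, which improves
    closed membership to half-open membership.\<close>
  have "inK (c k) x" for k
    using x[of "Suc k"] kid[OF kd(1)[of k] kd(2)[of k]] by (auto simp: cK_def inK_def)
  then have "\<exists>x. \<forall>k. inK (c k) x" by blast
  from someI_ex[OF this] show ?thesis unfolding branch_point_def by blast
qed

text \<open>Both \<open>y\<close> and the value of \<open>F\<close> lie in every range along the
  branch, and these ranges shrink to length zero because node numbers grow along it.\<close>

lemma branch_point_fib:
  assumes c: "branch c" and y: "\<And>k. p (c k) \<le> y \<and> y \<le> q (c k)"
  shows "branch_point c \<in> fib y"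
proof -
  have "F (branch_point c) = y"
  proof (rule ccontr)
    assume ne: "F (branch_point c) \<noteq> y"
    then have "\<bar>F (branch_point c) - y\<bar> > 0" by simp
    then obtain m where m: "\<And>k. m \<le> k \<Longrightarrow> k \<in> N \<Longrightarrow> q k - p k < \<bar>F (branch_point c) - y\<bar>"
      using eventually_short by metis
    have "q (c m) - p (c m) < \<bar>F (branch_point c) - y\<bar>"
      using m branch_N[OF c] by blast
    then show False
      using F_in_J[OF branch_N(1)[OF c] branch_point[OF c], of m] y[of m] by linarith
  qed
  moreover have "cK (c (Suc 0)) (branch_point c)" "c (Suc 0) \<in> kids 0"
    using branch_point[OF c] inK_cK c unfolding branch_def by (blast, metis)
  then have "a 0 \<le> branch_point c \<and> branch_point c \<le> b 0"
    using kid(3,4)[OF zero_in, of "c (Suc 0)"] by (auto simp: cK_def)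
  ultimately show ?thesis by (simp add: fib_def)
qed

text \<open>At the first difference two siblings would contain a common point, where the gadget of
  their parent would have to take both of their levels.\<close>

lemma branch_point_inj: "inj_on branch_point {c. branch c}"
proof (rule inj_onI)
  fix c d assume "c \<in> {c. branch c}" "d \<in> {c. branch c}" and eq: "branch_point c = branch_point d"
  then have cd: "branch c" "branch d" by auto
  have "c k = d k" for k
  proof (induction k)
    case 0
    then show ?case using cd by (simp add: branch_def)
  next
    case (Suc k)
    have k: "c (Suc k) \<in> kids (c k)" "d (Suc k) \<in> kids (c k)"
      using cd Suc unfolding branch_def by metis+
    have n: "c (Suc k) \<noteq> 0" "d (Suc k) \<noteq> 0" "par (c (Suc k)) = par (d (Suc k))"
      using k by (auto simp: kids_def)
    have "r (c (Suc k)) = r (d (Suc k))"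
      using cK_par(5)[OF branch_N(1)[OF cd(1)] n(1) inK_cK[OF branch_point[OF cd(1)]]]
        cK_par(5)[OF branch_N(1)[OF cd(2)] n(2) inK_cK[OF branch_point[OF cd(2)]]] eq n(3) by simp
    then show ?case using r_inj branch_N(1) cd by blast
  qed
  then show "c = d" by blast
qed

lemma F_ends: "F (a 0) = p 0" "F (b 0) = q 0"
proof -
  have "M x = {0}" if "x = a 0 \<or> x = b 0" for x
  proof -
    have "\<not> inK n x" if n: "n \<in> N" "n \<noteq> 0" for n
      using K_in_dom[OF n] \<open>x = a 0 \<or> x = b 0\<close> s_less_t[OF n(1)] by (auto simp: inK_def)
    then show ?thesis using inK_root[of x] that dom_bounds zero_in by (auto simp: M_def)
  qed
  note M0 = this
  have "F x = \<gamma> 0 x" if x: "x = a 0 \<or> x = b 0" for x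
  proof (rule F_val[OF zero_in])
    have "0 \<in> M x" using M0[OF x] by simp
    then show "inK 0 x" by (simp add: M_def)
    fix k assume k: "0 < k" "k \<in> N"
    show "\<not> inK k x"
    proof
      assume "inK k x"
      then have "k \<in> M x" using k by (simp add: M_def)
      then show False using M0[OF x] k by simp
    qed
  qed
  then show "F (a 0) = p 0" "F (b 0) = q 0" using dom_bounds by auto
qed

lemma fib_branches: "{c. branch c \<and> (\<forall>k. p (c k) \<le> y \<and> y \<le> q (c k))} \<lesssim> fib y"
  unfolding lepoll_def
proof (intro exI conjI)
  show "inj_on branch_point {c. branch c \<and> (\<forall>k. p (c k) \<le> y \<and> y \<le> q (c k))}"
    by (rule inj_on_subset[OF branch_point_inj]) auto
  show "branch_point ` {c. branch c \<and> (\<forall>k. p (c k) \<le> y \<and> y \<le> q (c k))} \<subseteq> fib y"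
    using branch_point_fib by blast
qed

end


subsection \<open>Tilings adapted to one-sided germs\<close>

text \<open>Each point is followed by a gap free of \<open>Q\<close>. A rational number chosen in
  the gap lies to the left of or at every later point of the set, so the choice is
  injective.\<close>

lemma countable_right_isolated:
  fixes Q :: "real \<Rightarrow> bool"
  assumes "\<And>y. Q y \<Longrightarrow> \<exists>e>0. \<forall>t. y < t \<and> t < y + e \<longrightarrow> \<not> Q t"
  shows "countable {y. Q y}"
proof -
  have "\<exists>c\<in>\<rat>. y < c \<and> (\<forall>t. y < t \<and> t < c \<longrightarrow> \<not> Q t)" if y: "Q y" for y
  proof -
    obtain e where e: "e > 0" "\<forall>t. y < t \<and> t < y + e \<longrightarrow> \<not> Q t" using assms[OF y] by blast
    obtain c where "c \<in> \<rat>" "y < c" "c < y + e" using Rats_dense_in_real[of y "y + e"] e by auto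
    then show ?thesis using e by (intro bexI[of _ c]) auto
  qed
  then obtain c where c: "\<And>y. Q y \<Longrightarrow> c y \<in> \<rat> \<and> y < c y \<and> (\<forall>t. y < t \<and> t < c y \<longrightarrow> \<not> Q t)"
    by metis
  have "inj_on c {y. Q y}"
  proof (rule linorder_inj_onI')
    fix y y' assume "y \<in> {y. Q y}" "y' \<in> {y. Q y}" "y < y'"
    then show "c y \<noteq> c y'" using c[of y] c[of y'] by force
  qed
  moreover have "countable (c ` {y. Q y})"
    by (rule countable_subset[OF _ countable_rat]) (use c in auto)
  ultimately show ?thesis by (rule countable_image_inj_on[rotated])
qed

section \<open>One-sided germs and the countable set where they disagree\<close>

locale germs =
  fixes rg lg :: "nat \<Rightarrow> real \<Rightarrow> bool"
  assumes rg_Suc: "rg (Suc j) y \<Longrightarrow> rg j y"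
    and lg_Suc: "lg (Suc j) y \<Longrightarrow> lg j y"
    and rg_right: "rg j y \<Longrightarrow> \<exists>e>0. \<forall>t. y < t \<and> t < y + e \<longrightarrow> rg j t \<and> lg j t"
    and lg_left: "lg j y \<Longrightarrow> \<exists>e>0. \<forall>t. y - e < t \<and> t < y \<longrightarrow> rg j t \<and> lg j t"
    and rg_bounds: "rg j y \<Longrightarrow> 0 \<le> y \<and> y < 1"
    and lg_bounds: "lg j y \<Longrightarrow> 0 < y \<and> y \<le> 1"
begin

lemma rg_antimono: "i \<le> j \<Longrightarrow> rg j y \<Longrightarrow> rg i y"
  by (induction rule: dec_induct) (auto dest: rg_Suc)

lemma lg_antimono: "i \<le> j \<Longrightarrow> lg j y \<Longrightarrow> lg i y"
  by (induction rule: dec_induct) (auto dest: lg_Suc)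

definition odd_points :: "real set" where
  "odd_points = {y. \<exists>j. rg j y \<noteq> lg j y}"

lemma countable_odd_points: "countable odd_points"
proof -
  have right: "countable {y. rg j y \<and> \<not> lg j y}" for j
    by (rule countable_right_isolated) (use rg_right in blast)
  \<comment> \<open>Reflection turns isolation from the left into isolation from the right.\<close>
  have "countable {y. lg j (- y) \<and> \<not> rg j (- y)}" for j
  proof (rule countable_right_isolated)
    fix y assume "lg j (- y) \<and> \<not> rg j (- y)"
    then obtain e where e: "e > 0" "\<And>t. - y - e < t \<Longrightarrow> t < - y \<Longrightarrow> rg j t"
      using lg_left by blast
    have "rg j (- t)" if "y < t" "t < y + e" for t
      by (rule e(2)) (use that in auto)
    then show "\<exists>e>0. \<forall>t. y < t \<and> t < y + e \<longrightarrow> \<not> (lg j (- t) \<and> \<not> rg j (- t))" using e(1) by blast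
  qed
  then have "countable (uminus ` {y. lg j (- y) \<and> \<not> rg j (- y)})" for j by blast
  moreover have "uminus ` {y. lg j (- y) \<and> \<not> rg j (- y)} = {y. lg j y \<and> \<not> rg j y}" for j
    by (auto intro: image_eqI[of _ _ "- y" for y])
  ultimately have left: "countable {y. lg j y \<and> \<not> rg j y}" for j by simp
  have "odd_points \<subseteq> (\<Union>j. {y. rg j y \<and> \<not> lg j y} \<union> {y. lg j y \<and> \<not> rg j y})"
    by (auto simp: odd_points_def)
  moreover have "countable (\<Union>j. {y. rg j y \<and> \<not> lg j y} \<union> {y. lg j y \<and> \<not> rg j y})"
    using left right by blast
  ultimately show ?thesis using countable_subset by blast
qed

text \<open>The dyadic points make the gaps short. The odd points must enter as well: an interval
  with \<open>y\<close> in its interior can be good for \<open>j\<close> only if \<open>y\<close>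
  has both germs of index \<open>j\<close>, so where they disagree \<open>y\<close> has to become an
  end point. Inserting \<open>0\<close> makes the enumerated set nonempty.\<close>

definition grid :: "nat \<Rightarrow> real set" where
  "grid m = (\<lambda>k. real k / 2 ^ m) ` {..2 ^ m} \<union> (from_nat_into (insert 0 odd_points) ` {..<m} \<inter> {0..1})"

lemma grid: "finite (grid m)" "0 \<in> grid m" "1 \<in> grid m" "grid m \<subseteq> {0..1}"
proof -
  show "finite (grid m)" by (simp add: grid_def)
  show "0 \<in> grid m" unfolding grid_def by (intro UnI1 image_eqI[of _ _ 0]) auto
  show "1 \<in> grid m" unfolding grid_def by (intro UnI1 image_eqI[of _ _ "2 ^ m"]) auto
  have "real k / 2 ^ m \<le> 1" if "k \<le> 2 ^ m" for k
    using that by (simp add: divide_le_eq_1)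
  then show "grid m \<subseteq> {0..1}" unfolding grid_def by auto
qed

lemma grid_Suc: "grid m \<subseteq> grid (Suc m)"
proof -
  have "real k / 2 ^ m \<in> (\<lambda>k. real k / 2 ^ Suc m) ` {..2 ^ Suc m}" if "k \<le> 2 ^ m" for k
    by (rule image_eqI[of _ _ "2 * k"]) (use that in auto)
  then have "(\<lambda>k. real k / 2 ^ m) ` {..2 ^ m} \<subseteq> (\<lambda>k. real k / 2 ^ Suc m) ` {..2 ^ Suc m}"
    by (simp only: image_subset_iff atMost_iff) simp
  moreover have "from_nat_into (insert 0 odd_points) ` {..<m} \<subseteq> from_nat_into (insert 0 odd_points) ` {..<Suc m}"
    by (intro image_mono) auto
  ultimately show ?thesis unfolding grid_def by (intro Un_mono Int_mono) auto
qed

lemma grid_mono: "m \<le> n \<Longrightarrow> grid m \<subseteq> grid n"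
  by (rule lift_Suc_mono_le[of grid]) (use grid_Suc in auto)

lemma odd_point_in_grid:
  assumes "y \<in> odd_points"
  obtains m where "\<And>n. n \<ge> m \<Longrightarrow> y \<in> grid n"
proof -
  have y: "y \<in> {0..1}" using assms rg_bounds lg_bounds by (fastforce simp: odd_points_def)
  obtain i where "from_nat_into (insert 0 odd_points) i = y"
    using from_nat_into_surj[of "insert 0 odd_points" y] countable_odd_points assms by auto
  then have "y \<in> grid n" if "n \<ge> Suc i" for n
    unfolding grid_def using that y by (intro UnI2 IntI image_eqI[of _ _ i]) auto
  then show ?thesis using that by blast
qed

definition adj :: "nat \<Rightarrow> real \<Rightarrow> real \<Rightarrow> bool" where
  "adj m a b \<longleftrightarrow> a \<in> grid m \<and> b \<in> grid m \<and> a < b \<and> (\<forall>x\<in>grid m. \<not> (a < x \<and> x < b))"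

lemma adj_length:
  assumes "adj m a b"
  shows "b - a \<le> (1/2) ^ m"
proof -
  have ab: "0 \<le> a" "a < b" "b \<le> 1" using assms grid(4)[of m] by (auto simp: adj_def)
  \<comment> \<open>The numerator of the first dyadic point of level \<open>m\<close> strictly above
    \<open>a\<close>.\<close>
  define k where "k = nat (\<lfloor>a * 2 ^ m\<rfloor> + 1)"
  have k: "real k = real_of_int \<lfloor>a * 2 ^ m\<rfloor> + 1"
    using ab by (simp add: k_def)
  then have lt: "a * 2 ^ m < real k" and le: "real k \<le> a * 2 ^ m + 1" by linarith+
  have "a * 2 ^ m < 1 * 2 ^ m" using ab by (intro mult_strict_right_mono) auto
  then have "a * 2 ^ m < real_of_int (2 ^ m)" by simp
  then have "\<lfloor>a * 2 ^ m\<rfloor> < 2 ^ m" by (simp only: floor_less_iff)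
  then have "k \<le> 2 ^ m" unfolding k_def by (simp add: nat_le_iff)
  then have "real k / 2 ^ m \<in> grid m" unfolding grid_def by auto
  moreover have "a < real k / 2 ^ m" using lt by (simp add: pos_less_divide_eq)
  ultimately have "b \<le> real k / 2 ^ m" using assms by (auto simp: adj_def)
  also have "\<dots> \<le> a + 1 / 2 ^ m" using le by (simp add: field_simps)
  finally show ?thesis by (simp add: power_one_over)
qed

lemma adj_cut:
  assumes Q: "a0 \<in> grid m" "Q a0" "b0 \<in> grid m" "\<not> Q b0" and down: "\<And>x z. x \<le> z \<Longrightarrow> Q z \<Longrightarrow> Q x"
  obtains a b where "adj m a b" "Q a" "\<not> Q b"
proof -
  define A where "A = {x \<in> grid m. Q x}"
  define B where "B = {x \<in> grid m. \<not> Q x}"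
  have A: "finite A" "A \<noteq> {}" using grid(1)[of m] Q by (auto simp: A_def)
  have B: "finite B" "B \<noteq> {}" using grid(1)[of m] Q by (auto simp: B_def)
  note MA = Max_in[OF A] and MB = Min_in[OF B]
  have no: "\<not> (Max A < x \<and> x < Min B)" if "x \<in> grid m" for x
  proof (cases "Q x")
    case True
    then have "x \<le> Max A" using that A by (intro Max_ge) (auto simp: A_def)
    then show ?thesis by simp
  next
    case False
    then have "Min B \<le> x" using that B by (intro Min_le) (auto simp: B_def)
    then show ?thesis by simp
  qed
  have "Max A < Min B"
  proof (rule ccontr)
    assume "\<not> Max A < Min B"
    then show False using down[of "Min B" "Max A"] MA MB by (simp add: A_def B_def)
  qed
  then show ?thesis
    by (intro that[of "Max A" "Min B"]) (use MA MB no in \<open>auto simp: adj_def A_def B_def\<close>)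
qed

lemma adj_right:
  assumes "0 \<le> y" "y < 1"
  obtains a b where "adj m a b" "a \<le> y" "y < b"
  by (rule adj_cut[of 0 m "\<lambda>x. x \<le> y" 1]) (use that assms grid(2,3) in auto)

lemma adj_left:
  assumes "0 < y" "y \<le> 1"
  obtains a b where "adj m a b" "a < y" "y \<le> b"
  by (rule adj_cut[of 0 m "\<lambda>x. x < y" 1]) (use that assms grid(2,3) in auto)

text \<open>End points of a coarse gap are points of the finer grid and therefore cannot lie
  strictly inside a finer gap.\<close>

lemma adj_laminar:
  assumes "adj m a b" "adj n c d" "m \<le> n" "a < d" "c < b"
  shows "a \<le> c \<and> d \<le> b"
proof -
  have "a \<in> grid n" "b \<in> grid n" using assms grid_mono by (auto simp: adj_def)
  then have "\<not> (c < a \<and> a < d)" "\<not> (c < b \<and> b < d)" using assms(2) by (auto simp: adj_def)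
  then show ?thesis using assms by auto
qed

lemma finite_long_adj:
  assumes "e > 0"
  shows "finite {(m, a, b). adj m a b \<and> e \<le> b - a}"
proof -
  obtain n where n: "(1/2) ^ n < e" using real_arch_pow_inv[OF assms, of "1/2"] by auto
  have "{(m, a, b). adj m a b \<and> e \<le> b - a} \<subseteq> (SIGMA m:{..<n}. grid m \<times> grid m)"
  proof clarsimp
    fix m a b assume m: "adj m a b" "e \<le> b - a"
    have "(1/2::real) ^ n < (1/2) ^ m" using adj_length[OF m(1)] m(2) n by linarith
    then have "m < n" using power_decreasing[of n m "1/2::real"] by (force simp: not_less)
    then show "m < n \<and> a \<in> grid m \<and> b \<in> grid m" using m by (simp add: adj_def)
  qed
  moreover have "finite (SIGMA m:{..<n}. grid m \<times> grid m)" using grid(1) by auto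
  ultimately show ?thesis using finite_subset by blast
qed

section \<open>Tiles as maximal good grid intervals\<close>

definition good :: "nat \<Rightarrow> real \<Rightarrow> real \<Rightarrow> bool" where
  "good j a b \<longleftrightarrow> (\<forall>t. a \<le> t \<and> t < b \<longrightarrow> rg j t) \<and> (\<forall>t. a < t \<and> t \<le> b \<longrightarrow> lg j t)"

text \<open>The requirement \<open>m \<ge> j\<close> bounds the length for index \<open>j\<close> by
  \<open>(1/2)^j\<close>, so that only finitely many pairs of an index and an interval exceed a
  given length.\<close>

definition cand :: "nat \<Rightarrow> real \<Rightarrow> real \<Rightarrow> bool" where
  "cand j a b \<longleftrightarrow> (\<exists>m\<ge>j. adj m a b \<and> good j a b)"

definition tile :: "nat \<Rightarrow> real \<Rightarrow> real \<Rightarrow> bool" where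
  "tile j a b \<longleftrightarrow> cand j a b \<and> (\<forall>a' b'. cand j a' b' \<and> a' \<le> a \<and> b \<le> b' \<longrightarrow> a' = a \<and> b' = b)"

text \<open>Only finitely many grid intervals are at least as long as the given one, so there is a
  longest candidate containing it, and that one is maximal.\<close>

lemma tile_above:
  assumes "cand j a b"
  obtains a' b' where "tile j a' b'" "a' \<le> a" "b \<le> b'"
proof -
  have ab: "b - a > 0" using assms by (auto simp: cand_def adj_def)
  define S where "S = {(a', b'). cand j a' b' \<and> a' \<le> a \<and> b \<le> b'}"
  have "S \<subseteq> snd ` {(m, a', b'). adj m a' b' \<and> b - a \<le> b' - a'}"
    by (force simp: S_def cand_def image_iff)
  then have fin: "finite S" using finite_long_adj[OF ab] finite_subset by blast
  have "(a, b) \<in> S" using assms by (simp add: S_def)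
  define len where "len = (\<lambda>z :: real \<times> real. snd z - fst z)"
  have "Max (len ` S) \<in> len ` S" using fin \<open>(a, b) \<in> S\<close> by (intro Max_in) auto
  then obtain c d where cd: "(c, d) \<in> S" "len (c, d) = Max (len ` S)" by auto
  have max: "len z \<le> len (c, d)" if "z \<in> S" for z unfolding cd using fin that by simp
  have "tile j c d"
    unfolding tile_def
  proof (intro conjI allI impI)
    show "cand j c d" using cd by (simp add: S_def)
    fix a' b' assume *: "cand j a' b' \<and> a' \<le> c \<and> d \<le> b'"
    then have "(a', b') \<in> S" using cd(1) by (auto simp: S_def)
    then have "b' - a' \<le> d - c" using max by (force simp: len_def)
    then show "a' = c" "b' = d" using * by auto
  qed
  then show ?thesis using that cd(1) by (auto simp: S_def)
qed

lemma tile_basic: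
  assumes "tile j a b"
  shows "0 \<le> a" "a < b" "b \<le> 1" "good j a b" "\<exists>m\<ge>j. adj m a b"
proof -
  obtain m where m: "m \<ge> j" "adj m a b" "good j a b"
    using assms by (auto simp: tile_def cand_def)
  then show "0 \<le> a" "a < b" "b \<le> 1" using grid(4)[of m] by (auto simp: adj_def)
  show "good j a b" "\<exists>m\<ge>j. adj m a b" using m by blast+
qed

lemma tile_unique:
  assumes "tile j a b" "tile j c d" "a < d" "c < b"
  shows "a = c \<and> b = d"
proof -
  obtain m n where mn: "adj m a b" "adj n c d" using assms by (auto simp: tile_def cand_def)
  have "(a \<le> c \<and> d \<le> b) \<or> (c \<le> a \<and> b \<le> d)"
    using adj_laminar[OF mn] adj_laminar[OF mn(2,1)] assms by (cases "m \<le> n") auto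
  then show ?thesis using assms(1,2) unfolding tile_def by metis
qed

text \<open>\<open>Q\<close> expresses that an interval reaches \<open>y\<close> on the side under
  consideration. On a fine enough level such an interval is short and therefore good, and a tile
  lies above it.\<close>

lemma tile_near:
  assumes "\<delta> > 0" and good: "\<And>m a b. m \<ge> m0 \<Longrightarrow> adj m a b \<Longrightarrow> Q a b \<Longrightarrow> y - \<delta> < a \<Longrightarrow> b < y + \<delta> \<Longrightarrow> good j a b"
    and Q: "\<And>m. \<exists>a b. adj m a b \<and> Q a b \<and> a \<le> y \<and> y \<le> b"
  obtains a b c d where "tile j a b" "a \<le> c" "d \<le> b" "Q c d"
proof -
  obtain m1 where m1: "(1/2) ^ m1 < \<delta>" using real_arch_pow_inv[OF \<open>\<delta> > 0\<close>, of "1/2"] by auto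
  define m where "m = max (max m0 m1) j"
  obtain c d where cd: "adj m c d" "Q c d" "c \<le> y" "y \<le> d" using Q by blast
  have "(1/2::real) ^ m \<le> (1/2) ^ m1" by (rule power_decreasing) (auto simp: m_def)
  then have "d - c < \<delta>" using adj_length[OF cd(1)] m1 by linarith
  then have "good j c d" using cd by (intro good[of m]) (auto simp: m_def)
  then have "cand j c d" using cd(1) unfolding cand_def by (intro exI[of _ m]) (auto simp: m_def)
  then show ?thesis using tile_above that cd(2) by blast
qed

lemma tile_right:
  assumes y: "rg j y"
  obtains a b where "tile j a b" "a \<le> y" "y < b"
proof -
  obtain e where e: "e > 0" "\<And>t. y < t \<Longrightarrow> t < y + e \<Longrightarrow> rg j t \<and> lg j t" using rg_right[OF y] by blast
  have ex: "\<exists>a b. adj m a b \<and> (a \<le> y \<and> y < b) \<and> a \<le> y \<and> y \<le> b" for m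
    using adj_right rg_bounds[OF y] by (metis less_imp_le)
  have "\<exists>\<delta>>0. \<exists>m0. \<forall>m\<ge>m0. \<forall>a b. adj m a b \<longrightarrow> a \<le> y \<and> y < b \<longrightarrow> y - \<delta> < a \<longrightarrow> b < y + \<delta> \<longrightarrow> good j a b"
  proof (cases "lg j y")
    case True
    then obtain e' where e': "e' > 0" "\<And>t. y - e' < t \<Longrightarrow> t < y \<Longrightarrow> rg j t \<and> lg j t" using lg_left by blast
    have "rg j t \<and> lg j t" if "y - min e e' < t" "t < y + min e e'" for t
      using e(2)[of t] e'(2)[of t] that y True by (cases t y rule: linorder_cases) auto
    then show ?thesis
      using e(1) e'(1) unfolding good_def by (intro exI[of _ "min e e'"] conjI exI[of _ 0]) auto
  next
    case False
    \<comment> \<open>Nothing is known to the left of \<open>y\<close> in this case, but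
      \<open>y\<close> belongs to all fine grids, so the interval that reaches to its right begins
      at \<open>y\<close> itself.\<close>
    then have "y \<in> odd_points" using y by (auto simp: odd_points_def)
    then obtain m0 where m0: "\<And>n. n \<ge> m0 \<Longrightarrow> y \<in> grid n" using odd_point_in_grid by blast
    have "a = y" if "m \<ge> m0" "adj m a b" "a \<le> y" "y < b" for m a b
      using m0[OF that(1)] that by (auto simp: adj_def le_less)
    then show ?thesis
      using e y unfolding good_def by (intro exI[of _ e] conjI exI[of _ m0]) (force simp: le_less)+
  qed
  then obtain \<delta> m0 where d: "\<delta> > 0" "\<And>m a b. m \<ge> m0 \<Longrightarrow> adj m a b \<Longrightarrow> a \<le> y \<and> y < b \<Longrightarrow> y - \<delta> < a \<Longrightarrow> b < y + \<delta> \<Longrightarrow> good j a b"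
    by blast
  show ?thesis
  proof (rule tile_near[of \<delta> m0 "\<lambda>a b. a \<le> y \<and> y < b" y j])
    fix a b c d assume "tile j a b" "a \<le> c" "d \<le> b" "c \<le> y \<and> y < d"
    then show ?thesis by (intro that) auto
  qed (use d ex in blast)+
qed

lemma tile_left:
  assumes y: "lg j y"
  obtains a b where "tile j a b" "a < y" "y \<le> b"
proof -
  obtain e where e: "e > 0" "\<And>t. y - e < t \<Longrightarrow> t < y \<Longrightarrow> rg j t \<and> lg j t" using lg_left[OF y] by blast
  have ex: "\<exists>a b. adj m a b \<and> (a < y \<and> y \<le> b) \<and> a \<le> y \<and> y \<le> b" for m
    using adj_left lg_bounds[OF y] by (metis less_imp_le)
  have "\<exists>\<delta>>0. \<exists>m0. \<forall>m\<ge>m0. \<forall>a b. adj m a b \<longrightarrow> a < y \<and> y \<le> b \<longrightarrow> y - \<delta> < a \<longrightarrow> b < y + \<delta> \<longrightarrow> good j a b"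
  proof (cases "rg j y")
    case True
    then obtain e' where e': "e' > 0" "\<And>t. y < t \<Longrightarrow> t < y + e' \<Longrightarrow> rg j t \<and> lg j t"
      using rg_right by blast
    have "rg j t \<and> lg j t" if "y - min e e' < t" "t < y + min e e'" for t
      using e(2)[of t] e'(2)[of t] that y True by (cases t y rule: linorder_cases) auto
    then show ?thesis
      using e(1) e'(1) unfolding good_def by (intro exI[of _ "min e e'"] conjI exI[of _ 0]) auto
  next
    case False
    then have "y \<in> odd_points" using y by (auto simp: odd_points_def)
    then obtain m0 where m0: "\<And>n. n \<ge> m0 \<Longrightarrow> y \<in> grid n" using odd_point_in_grid by blast
    have "b = y" if "m \<ge> m0" "adj m a b" "a < y" "y \<le> b" for m a b
      using m0[OF that(1)] that by (auto simp: adj_def le_less)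
    then show ?thesis
      using e y unfolding good_def by (intro exI[of _ e] conjI exI[of _ m0]) (force simp: le_less)+
  qed
  then obtain \<delta> m0 where d: "\<delta> > 0" "\<And>m a b. m \<ge> m0 \<Longrightarrow> adj m a b \<Longrightarrow> a < y \<and> y \<le> b \<Longrightarrow> y - \<delta> < a \<Longrightarrow> b < y + \<delta> \<Longrightarrow> good j a b"
    by blast
  show ?thesis
  proof (rule tile_near[of \<delta> m0 "\<lambda>a b. a < y \<and> y \<le> b" y j])
    fix a b c d assume "tile j a b" "a \<le> c" "d \<le> b" "c < y \<and> y \<le> d"
    then show ?thesis by (intro that) auto
  qed (use d ex in blast)+
qed

text \<open>Lowering the index weakens both goodness and the demand on the level, so a tile is a
  candidate for every smaller index. This supplies the parents when tiles are nested along
  codes.\<close>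

lemma tile_refine:
  assumes "tile j a b" "i \<le> j"
  obtains a' b' where "tile i a' b'" "a' \<le> a" "b \<le> b'"
proof -
  have "cand i a b"
    using assms rg_antimono lg_antimono unfolding tile_def cand_def good_def by (meson order_trans)
  then show ?thesis using tile_above that by blast
qed

lemma finite_long_tiles:
  assumes "e > 0"
  shows "finite {(j, a, b). tile j a b \<and> e \<le> b - a}"
proof -
  have "{(j, a, b). tile j a b \<and> e \<le> b - a} \<subseteq>
      (\<Union>(m, a, b)\<in>{(m, a, b). adj m a b \<and> e \<le> b - a}. (\<lambda>j. (j, a, b)) ` {..m})"
  proof
    fix x assume "x \<in> {(j, a, b). tile j a b \<and> e \<le> b - a}"
    then obtain j a b where x: "x = (j, a, b)" "tile j a b" "e \<le> b - a" by auto
    then obtain m where "m \<ge> j" "adj m a b" using tile_basic(5) by blast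
    then show "x \<in> (\<Union>(m, a, b)\<in>{(m, a, b). adj m a b \<and> e \<le> b - a}. (\<lambda>j. (j, a, b)) ` {..m})"
      using x by (intro UN_I[of "(m, a, b)"]) auto
  qed
  moreover have "finite (\<Union>(m, a, b)\<in>{(m, a, b). adj m a b \<and> e \<le> b - a}. (\<lambda>j. (j, a, b)) ` {..m})"
    using finite_long_adj[OF assms] by auto
  ultimately show ?thesis using finite_subset by blast
qed

lemma tile_rg: "tile j a b \<Longrightarrow> a \<le> y \<Longrightarrow> y < b \<Longrightarrow> rg j y"
  using tile_basic(4) by (auto simp: good_def)

lemma tile_lg: "tile j a b \<Longrightarrow> a < y \<Longrightarrow> y \<le> b \<Longrightarrow> lg j y"
  using tile_basic(4) by (auto simp: good_def)

end


subsection \<open>Souslin schemes\<close>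

text \<open>Codes are finite sequences written in reverse, so that extending a code is consing.\<close>

definition prefix_code :: "(nat \<Rightarrow> nat) \<Rightarrow> nat \<Rightarrow> nat list" where
  "prefix_code \<sigma> n = rev (map \<sigma> [0..<n])"

lemma prefix_code_simps: "prefix_code \<sigma> 0 = []" "prefix_code \<sigma> (Suc n) = \<sigma> n # prefix_code \<sigma> n"
  by (simp_all add: prefix_code_def)

lemma length_prefix_code [simp]: "length (prefix_code \<sigma> n) = n"
  by (simp add: prefix_code_def)

lemma prefix_code_eq: "prefix_code \<sigma> n = prefix_code \<tau> n \<longleftrightarrow> (\<forall>i<n. \<sigma> i = \<tau> i)"
  by (auto simp: prefix_code_def)

text \<open>The chain may start at any code, not only at the empty one. After reversal a digit is
  stable once it is present, and \<open>S (Suc m)\<close> is long enough to contain position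
  \<open>m\<close>.\<close>

lemma prefix_code_limit:
  assumes "\<And>i. \<exists>k. S (Suc i) = k # S i"
  obtains \<sigma> where "\<And>i. S i = prefix_code \<sigma> (length (S i))"
proof -
  have len: "length (S i) = length (S 0) + i" for i
  proof (induction i)
    case (Suc i)
    then show ?case using assms[of i] by auto
  qed simp
  have nth: "rev (S (i + d)) ! m = rev (S i) ! m" if "m < length (S i)" for i d m
  proof (induction d)
    case (Suc d)
    obtain k where k: "S (Suc (i + d)) = k # S (i + d)" using assms by blast
    have "m < length (S (i + d))" using that len[of i] len[of "i + d"] by simp
    then show ?case using Suc k by (simp add: nth_append)
  qed simp
  define \<sigma> where "\<sigma> m = rev (S (Suc m)) ! m" for m
  have "S i = prefix_code \<sigma> (length (S i))" for i
  proof -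
    have "rev (S i) = map \<sigma> [0..<length (S i)]"
    proof (rule nth_equalityI)
      fix m assume m: "m < length (rev (S i))"
      have "rev (S i) ! m = \<sigma> m"
      proof (cases "Suc m \<le> i")
        case True
        then show ?thesis unfolding \<sigma>_def using nth[of m "Suc m" "i - Suc m"] len[of "Suc m"] by simp
      next
        case False
        then show ?thesis unfolding \<sigma>_def using nth[of m i "Suc m - i"] m by simp
      qed
      then show "rev (S i) ! m = map \<sigma> [0..<length (S i)] ! m" using m by simp
    qed simp
    then show ?thesis unfolding prefix_code_def by (metis rev_rev_ident)
  qed
  then show ?thesis using that by blast
qed

text \<open>\<open>P s\<close> models the image of a cylinder. The first axiom asks only that these
  sets meet intervals shrinking to \<open>y\<close>, because a tile can test intersection with an
  interval but not membership of one particular value. The second provides enough codes for one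
  branch per code to fill the fibre.\<close>

locale souslin_scheme =
  fixes A :: "real set" and P :: "nat list \<Rightarrow> real set"
  assumes P_limit: "(\<And>i. \<exists>k. S (Suc i) = k # S i) \<Longrightarrow> (\<And>i. P (S i) \<inter> {l i..h i} \<noteq> {}) \<Longrightarrow>
      (\<And>i. l i \<le> y \<and> y \<le> h i) \<Longrightarrow> (\<And>e. e > 0 \<Longrightarrow> \<exists>n. \<forall>i\<ge>n. h i - l i < e) \<Longrightarrow> y \<in> A"
    and P_codes: "y \<in> A \<Longrightarrow> (UNIV :: nat set set) \<lesssim> {\<sigma>. \<forall>n. y \<in> P (prefix_code \<sigma> n)}"

lemma analytic_scheme:
  assumes "analytic_set A"
  shows "\<exists>P. souslin_scheme A P"
proof (cases "A = {}")
  case True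
  then have "souslin_scheme A (\<lambda>_. {})" by unfold_locales auto
  then show ?thesis by blast
next
  case False
  then obtain g0 :: "(nat \<Rightarrow> nat) \<Rightarrow> real" where g0: "continuous_on UNIV g0" "range g0 = A"
    using assms by (auto simp: analytic_set_def)
  text \<open>The odd coordinates are ignored, which makes every point have continuum many codes.\<close>
  define g where "g \<sigma> = g0 (\<lambda>i. \<sigma> (2 * i))" for \<sigma> :: "nat \<Rightarrow> nat"
  have g_cont: "continuous_on UNIV g"
    unfolding g_def
    by (rule continuous_on_compose2[OF g0(1)])
      (auto intro!: continuous_on_coordinatewise_then_product continuous_on_product_coordinates)
  define P where "P s = g ` {\<sigma>. prefix_code \<sigma> (length s) = s}" for s
  have "souslin_scheme A P"
  proof
    fix S l h y
    assume S: "\<And>i. \<exists>k. S (Suc i) = k # S i" and ne: "\<And>i. P (S i) \<inter> {l i..h i} \<noteq> {}"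
      and y: "\<And>i. l i \<le> y \<and> y \<le> h i" and small: "\<And>e. e > 0 \<Longrightarrow> \<exists>n. \<forall>i\<ge>n. h i - l i < (e::real)"
    obtain \<sigma> where \<sigma>: "\<And>i. S i = prefix_code \<sigma> (length (S i))" by (rule prefix_code_limit[of S]) (use S in blast)+
    have len: "i \<le> length (S i)" for i
    proof (induction i)
      case (Suc i)
      then show ?case using S[of i] by auto
    qed simp
    \<comment> \<open>The witnesses chosen in the cylinders converge coordinatewise to
      \<open>\<sigma>\<close>, while their images are squeezed towards \<open>y\<close>; continuity
      then gives \<open>g \<sigma> = y\<close>.\<close>
    have "\<forall>i. \<exists>\<tau>. prefix_code \<tau> (length (S i)) = S i \<and> g \<tau> \<in> {l i..h i}"
      using ne unfolding P_def by blast
    then obtain \<tau> where \<tau>: "\<And>i. prefix_code (\<tau> i) (length (S i)) = S i" "\<And>i. g (\<tau> i) \<in> {l i..h i}"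
      by metis
    have agree: "\<forall>m<length (S i). \<tau> i m = \<sigma> m" for i
      using \<tau>(1)[of i] \<sigma>[of i] prefix_code_eq by metis
    have "g \<sigma> = y"
    proof (rule ccontr)
      assume "g \<sigma> \<noteq> y"
      define e where "e = \<bar>g \<sigma> - y\<bar> / 2"
      have e: "e > 0" using \<open>g \<sigma> \<noteq> y\<close> by (simp add: e_def)
      have "\<tau> \<longlonglongrightarrow> \<sigma>"
        unfolding limitin_canonical_iff[symmetric] euclidean_product_topology[symmetric]
      proof (subst limitin_componentwise, safe)
        fix m
        have "\<tau> i m = \<sigma> m" if "i \<ge> Suc m" for i using agree[of i] len[of i] that by auto
        then have "\<forall>\<^sub>F i in sequentially. \<tau> i m = \<sigma> m" unfolding eventually_sequentially by blast
        then show "limitin euclidean (\<lambda>i. \<tau> i m) (\<sigma> m) sequentially"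
          unfolding limitin_canonical_iff by (rule tendsto_eventually)
      qed (auto simp: extensional_UNIV)
      then have "(\<lambda>i. g (\<tau> i)) \<longlonglongrightarrow> g \<sigma>"
        using continuous_on_tendsto_compose[OF g_cont] by auto
      then obtain n where n: "\<And>i. i \<ge> n \<Longrightarrow> \<bar>g (\<tau> i) - g \<sigma>\<bar> < e"
        using e unfolding LIMSEQ_iff by auto
      obtain n' where n': "\<And>i. i \<ge> n' \<Longrightarrow> h i - l i < e" using small e by blast
      have "\<bar>g (\<tau> (max n n')) - g \<sigma>\<bar> < e" "h (max n n') - l (max n n') < e" using n n' by auto
      moreover have "\<bar>g (\<tau> (max n n')) - y\<bar> \<le> h (max n n') - l (max n n')"
        using \<tau>(2)[of "max n n'"] y[of "max n n'"] by (auto simp: abs_le_iff)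
      moreover have "\<bar>g \<sigma> - y\<bar> \<le> \<bar>g (\<tau> (max n n')) - g \<sigma>\<bar> + \<bar>g (\<tau> (max n n')) - y\<bar>" by linarith
      ultimately have "\<bar>g \<sigma> - y\<bar> < e + e" by linarith
      then show False by (simp add: e_def)
    qed
    then show "y \<in> A" using g0(2) unfolding g_def by blast
  next
    fix y assume "y \<in> A"
    then obtain \<tau> where \<tau>: "g0 \<tau> = y" using g0(2) by blast
    \<comment> \<open>The even coordinates carry a fixed preimage of \<open>y\<close>, and the odd
      ones record an arbitrary set \<open>X\<close>.\<close>
    define c where "c X = (\<lambda>i. if even i then \<tau> (i div 2) else (if i div 2 \<in> X then 1 else 0))" for X :: "nat set"
    have "g (c X) = y" for X using \<tau> by (simp add: g_def c_def)
    then have "range c \<subseteq> {\<sigma>. \<forall>n. y \<in> P (prefix_code \<sigma> n)}"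
      unfolding P_def by (auto intro!: image_eqI)
    moreover have "inj c"
    proof (rule injI)
      fix X Y assume eq: "c X = c Y"
      have "i \<in> X \<longleftrightarrow> i \<in> Y" for i
        using fun_cong[OF eq, of "Suc (2 * i)"] by (simp add: c_def split: if_splits)
      then show "X = Y" by blast
    qed
    ultimately show "(UNIV :: nat set set) \<lesssim> {\<sigma>. \<forall>n. y \<in> P (prefix_code \<sigma> n)}"
      unfolding lepoll_def by blast
  qed
  then show ?thesis by blast
qed


subsection \<open>Functions with prescribed germ counts\<close>

locale coded_germs = germs rg lg + souslin_scheme A P
  for rg lg :: "nat \<Rightarrow> real \<Rightarrow> bool" and A P
begin

section \<open>Numbering and nesting the tiles\<close>

definition T :: "(nat \<times> real \<times> real) set" where
  "T = {(j, a, b). tile j a b}"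

text \<open>Ties in length are broken by the index because a tile and its parent may be the same
  interval with different indices.\<close>

definition before :: "nat \<times> real \<times> real \<Rightarrow> nat \<times> real \<times> real \<Rightarrow> bool" where
  "before = (\<lambda>(i, a, b) (j, c, d). d - c < b - a \<or> (b - a = d - c \<and> (i < j \<or> i = j \<and> a < c)))"

lemma before_trans: "before x y \<Longrightarrow> before y z \<Longrightarrow> before x z"
  by (auto simp: before_def split: prod.splits)

lemma before_irrefl: "\<not> before x x"
  by (auto simp: before_def split: prod.splits)

lemma before_total: "x \<noteq> y \<Longrightarrow> before x y \<or> before y x"
  by (auto simp: before_def split: prod.splits)

lemma finite_before: "x \<in> T \<Longrightarrow> finite {z \<in> T. before z x}"
proof -
  assume "x \<in> T"
  then obtain j a b where x: "x = (j, a, b)" "tile j a b" by (auto simp: T_def)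
  have "{z \<in> T. before z x} \<subseteq> {(j, c, d). tile j c d \<and> b - a \<le> d - c}"
    unfolding x(1) by (auto simp: T_def before_def)
  moreover have "finite {(j, c, d). tile j c d \<and> b - a \<le> d - c}"
    using tile_basic(2)[OF x(2)] by (intro finite_long_tiles) simp
  ultimately show ?thesis using finite_subset by blast
qed

text \<open>Longer tiles are numbered first, so that a parent precedes its children.\<close>

definition enc :: "nat \<times> real \<times> real \<Rightarrow> nat" where
  "enc x = Suc (card {z \<in> T. before z x})"

lemma enc_less:
  assumes "x \<in> T" "y \<in> T" "before x y"
  shows "enc x < enc y"
proof -
  have "{z \<in> T. before z x} \<subset> {z \<in> T. before z y}"
    using assms before_trans before_irrefl by blast
  then have "card {z \<in> T. before z x} < card {z \<in> T. before z y}"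
    by (rule psubset_card_mono[OF finite_before[OF assms(2)]])
  then show ?thesis by (simp add: enc_def)
qed

lemma inj_enc: "inj_on enc T"
proof (rule inj_onI)
  fix x y assume "x \<in> T" "y \<in> T" "enc x = enc y"
  then show "x = y" using enc_less[of x y] enc_less[of y x] before_total[of x y] by auto
qed

definition dec :: "nat \<Rightarrow> nat \<times> real \<times> real" where
  "dec = inv_into T enc"

lemma dec_enc [simp]: "x \<in> T \<Longrightarrow> dec (enc x) = x"
  unfolding dec_def by (rule inv_into_f_f[OF inj_enc])

definition up :: "nat \<Rightarrow> real \<Rightarrow> real \<Rightarrow> real \<times> real" where
  "up i a b = (SOME (c, d). tile i c d \<and> c \<le> a \<and> b \<le> d)"

lemma up:
  assumes "tile j a b" "i \<le> j"
  shows "tile i (fst (up i a b)) (snd (up i a b))" "fst (up i a b) \<le> a" "b \<le> snd (up i a b)"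
proof -
  obtain c d where "tile i c d" "c \<le> a" "b \<le> d" by (rule tile_refine[OF assms])
  then have "\<exists>z. case z of (c, d) \<Rightarrow> tile i c d \<and> c \<le> a \<and> b \<le> d"
    by (intro exI[of _ "(c, d)"]) simp
  from someI_ex[OF this] show "tile i (fst (up i a b)) (snd (up i a b))" "fst (up i a b) \<le> a" "b \<le> snd (up i a b)"
    unfolding up_def by (auto simp: case_prod_unfold)
qed

definition nodes :: "nat set" where
  "nodes = insert 0 (enc ` T)"

text \<open>The germ index doubles as the code of a finite sequence. A tile for \<open>k # s\<close>
  is hung below the tile for \<open>s\<close> containing it only if \<open>P (k # s)\<close> meets
  it, and below the root \<open>0\<close> otherwise. Infinite branches therefore follow lengthening
  codes whose sets keep meeting the tiles.\<close>

definition parent :: "nat \<Rightarrow> nat" where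
  "parent n = (if n = 0 then 0 else case dec n of (j, a, b) \<Rightarrow>
     (case list_decode j of [] \<Rightarrow> 0
      | k # s \<Rightarrow> if P (k # s) \<inter> {a..b} \<noteq> {} then enc (list_encode s, up (list_encode s) a b) else 0))"

definition left :: "nat \<Rightarrow> real" where
  "left n = (if n = 0 then 0 else fst (snd (dec n)))"

definition right :: "nat \<Rightarrow> real" where
  "right n = (if n = 0 then 1 else snd (snd (dec n)))"

lemma enc_nz [simp]: "enc x \<noteq> 0" by (simp add: enc_def)

lemma left_enc [simp]: "x \<in> T \<Longrightarrow> left (enc x) = fst (snd x)" by (simp add: left_def)
lemma right_enc [simp]: "x \<in> T \<Longrightarrow> right (enc x) = snd (snd x)" by (simp add: right_def)

lemma in_T_iff [simp]: "(j, a, b) \<in> T \<longleftrightarrow> tile j a b" by (simp add: T_def)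

lemma list_encode_less: "list_encode s < list_encode (k # s)"
  using le_prod_encode_2[of "list_encode s" k] by simp

lemma parent_cases:
  assumes t: "tile j a b"
  obtains "parent (enc (j, a, b)) = 0"
  | k s c d where "j = list_encode (k # s)" "P (k # s) \<inter> {a..b} \<noteq> {}"
    "parent (enc (j, a, b)) = enc (list_encode s, c, d)" "tile (list_encode s) c d" "c \<le> a" "b \<le> d"
    "enc (list_encode s, c, d) < enc (j, a, b)"
proof (cases "parent (enc (j, a, b)) = 0")
  case False
  then obtain k s where ks: "list_decode j = k # s" "P (k # s) \<inter> {a..b} \<noteq> {}"
    "parent (enc (j, a, b)) = enc (list_encode s, up (list_encode s) a b)"
    using t by (auto simp: parent_def split: list.splits if_splits)
  have j: "j = list_encode (k # s)" using ks(1) by (metis list_decode_inverse)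
  obtain c d where cd: "up (list_encode s) a b = (c, d)" by fastforce
  have "list_encode s < j" unfolding j by (rule list_encode_less)
  then have u: "tile (list_encode s) c d" "c \<le> a" "b \<le> d"
    using up[OF t, of "list_encode s"] cd by auto
  have "before (list_encode s, c, d) (j, a, b)"
    using u \<open>list_encode s < j\<close> by (auto simp: before_def)
  then have "enc (list_encode s, c, d) < enc (j, a, b)" using u t by (intro enc_less) auto
  then show ?thesis using that(2)[OF j ks(2)] ks(3) u cd by simp
qed (use that in blast)

lemma nodes_cases:
  assumes "n \<in> nodes" "n \<noteq> 0"
  obtains j a b where "tile j a b" "n = enc (j, a, b)"
  using assms by (auto simp: nodes_def T_def)

sublocale tree: interval_tree nodes parent left right
proof
  show "0 \<in> nodes" by (simp add: nodes_def)
  show "parent n < n \<and> parent n \<in> nodes" if n: "n \<in> nodes" "n \<noteq> 0" for n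
  proof -
    obtain j a b where t: "tile j a b" "n = enc (j, a, b)" using nodes_cases[OF n] .
    show ?thesis
      by (rule parent_cases[OF t(1)]) (use t in \<open>auto simp: nodes_def enc_def\<close>)
  qed
  show "left n < right n" if n: "n \<in> nodes" for n
  proof (cases "n = 0")
    case False
    obtain j a b where t: "tile j a b" "n = enc (j, a, b)" using nodes_cases[OF n False] .
    then show ?thesis using tile_basic(2) by simp
  qed (simp add: left_def right_def)
  show "left (parent n) \<le> left n \<and> right n \<le> right (parent n)" if n: "n \<in> nodes" "n \<noteq> 0" for n
  proof -
    obtain j a b where t: "tile j a b" "n = enc (j, a, b)" using nodes_cases[OF n] .
    show ?thesis
    proof (rule parent_cases[OF t(1)])
      assume "parent (enc (j, a, b)) = 0"
      then show ?thesis using t tile_basic[OF t(1)] by (simp add: left_def[of 0] right_def[of 0])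
    next
      fix k s c d assume *: "parent (enc (j, a, b)) = enc (list_encode s, c, d)" "tile (list_encode s) c d" "c \<le> a" "b \<le> d"
      then show ?thesis using t by simp
    qed
  qed
  show "finite {n \<in> nodes. e \<le> right n - left n}" if e: "e > 0" for e
  proof -
    have "{n \<in> nodes. e \<le> right n - left n} \<subseteq> insert 0 (enc ` {(j, a, b). tile j a b \<and> e \<le> b - a})"
      by (auto simp: nodes_def T_def)
    then show ?thesis using finite_long_tiles[OF e] finite_subset by blast
  qed
qed

section \<open>Germ counts and fibre sizes\<close>

lemma over_eq: "tree.over y = enc ` {(j, a, b). tile j a b \<and> a \<le> y \<and> y \<le> b}"
  unfolding tree.over_def by (auto simp: nodes_def T_def image_iff)

text \<open>\<open>S\<close> selects the tiles reaching the point on a fixed side. Two of them with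
  the same index overlap and hence coincide, so counting tiles amounts to counting germs.\<close>

lemma tile_bij:
  assumes S: "\<And>a b c d. S a b \<Longrightarrow> S c d \<Longrightarrow> a < d" and g: "\<And>j. g j \<longleftrightarrow> (\<exists>a b. tile j a b \<and> S a b)"
  shows "bij_betw fst {(j, a, b). tile j a b \<and> S a b} {j. g j}"
proof (rule bij_betw_imageI)
  show "inj_on fst {(j, a, b). tile j a b \<and> S a b}"
    by (rule inj_onI) (auto, (use tile_unique S in blast)+)
  show "fst ` {(j, a, b). tile j a b \<and> S a b} = {j. g j}"
    unfolding g by force
qed

lemma rg_iff: "rg j y \<longleftrightarrow> (\<exists>a b. tile j a b \<and> a \<le> y \<and> y < b)"
  using tile_right tile_rg by metis

lemma lg_iff: "lg j y \<longleftrightarrow> (\<exists>a b. tile j a b \<and> a < y \<and> y \<le> b)"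
  using tile_left tile_lg by metis

lemma rtile_card: "bij_betw fst {(j, a, b). tile j a b \<and> a \<le> y \<and> y < b} {j. rg j y}"
  by (rule tile_bij[of "\<lambda>a b. a \<le> y \<and> y < b", OF _ rg_iff]) auto

lemma ltile_card: "bij_betw fst {(j, a, b). tile j a b \<and> a < y \<and> y \<le> b} {j. lg j y}"
  by (rule tile_bij[of "\<lambda>a b. a < y \<and> y \<le> b", OF _ lg_iff]) auto

lemma tiles_at_Un:
  "{(j, a, b). tile j a b \<and> a \<le> y \<and> y \<le> b} =
    {(j, a, b). tile j a b \<and> a \<le> y \<and> y < b} \<union> {(j, a, b). tile j a b \<and> a < y \<and> y \<le> b}"
  using tile_basic(2) by fastforce

lemma finite_over_iff: "finite (tree.over y) \<longleftrightarrow> finite {j. rg j y} \<and> finite {j. lg j y}"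
proof -
  have "{(j, a, b). tile j a b \<and> a \<le> y \<and> y \<le> b} \<subseteq> T" by auto
  then have "finite (tree.over y) \<longleftrightarrow> finite {(j, a, b). tile j a b \<and> a \<le> y \<and> y \<le> b}"
    unfolding over_eq by (intro finite_image_iff inj_on_subset[OF inj_enc])
  also have "\<dots> \<longleftrightarrow> finite {j. rg j y} \<and> finite {j. lg j y}"
    unfolding tiles_at_Un finite_Un using bij_betw_finite[OF rtile_card] bij_betw_finite[OF ltile_card] by blast
  finally show ?thesis .
qed

lemma over_sum:
  assumes "finite {j. rg j y}" "finite {j. lg j y}"
  shows "(\<Sum>n\<in>tree.over y. (if left n \<le> y \<and> y < right n then 1 else 0) + (if left n < y \<and> y \<le> right n then 1 else 0)) =
    card {j. rg j y} + card {j. lg j y}"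
proof -
  let ?O = "{(j, a, b). tile j a b \<and> a \<le> y \<and> y \<le> b}"
  have OT: "?O \<subseteq> T" by auto
  have fin: "finite ?O"
    unfolding tiles_at_Un finite_Un using bij_betw_finite[OF rtile_card] bij_betw_finite[OF ltile_card] assms by blast
  have "(\<Sum>n\<in>tree.over y. (if left n \<le> y \<and> y < right n then 1 else 0) + (if left n < y \<and> y \<le> right n then 1 else 0)) =
    (\<Sum>x\<in>?O. (if left (enc x) \<le> y \<and> y < right (enc x) then 1 else 0) + (if left (enc x) < y \<and> y \<le> right (enc x) then 1 else (0::nat)))"
    unfolding over_eq by (subst sum.reindex[OF inj_on_subset[OF inj_enc OT]]) simp
  also have "\<dots> = (\<Sum>x\<in>?O. (if fst (snd x) \<le> y \<and> y < snd (snd x) then 1 else 0) + (if fst (snd x) < y \<and> y \<le> snd (snd x) then 1 else 0))"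
    by (intro sum.cong refl) auto
  \<comment> \<open>A tile with \<open>y\<close> in its interior enters both sets, one with
    \<open>y\<close> as an end point only one of them; this matches its contribution to the
    fibre.\<close>
  also have "\<dots> = card {x \<in> ?O. fst (snd x) \<le> y \<and> y < snd (snd x)} + card {x \<in> ?O. fst (snd x) < y \<and> y \<le> snd (snd x)}"
    using fin by (simp add: sum.distrib sum.If_cases Int_def)
  also have "{x \<in> ?O. fst (snd x) \<le> y \<and> y < snd (snd x)} = {(j, a, b). tile j a b \<and> a \<le> y \<and> y < b}" by auto
  also have "{x \<in> ?O. fst (snd x) < y \<and> y \<le> snd (snd x)} = {(j, a, b). tile j a b \<and> a < y \<and> y \<le> b}" by auto
  finally show ?thesis using bij_betw_same_card[OF rtile_card] bij_betw_same_card[OF ltile_card] by simp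
qed

text \<open>The indices along a branch decode to a chain of codes, the sets of the scheme meet the
  corresponding tiles, and the tiles shrink to \<open>y\<close>; the limit axiom applies.\<close>

lemma branch_in_A:
  assumes c: "tree.branch c" and y: "\<And>k. left (c k) \<le> y \<and> y \<le> right (c k)"
  shows "y \<in> A"
proof -
  have "\<exists>j a b. tile j a b \<and> c (Suc k) = enc (j, a, b)" for k
  proof -
    have "c (Suc k) \<in> nodes" "c (Suc k) \<noteq> 0"
      using c unfolding tree.branch_def tree.kids_def by blast+
    then show ?thesis using nodes_cases by metis
  qed
  then obtain J L H where z: "\<And>k. tile (J k) (L k) (H k)" "\<And>k. c (Suc k) = enc (J k, L k, H k)" by metis
  have step: "\<exists>\<kappa> s. list_decode (J (Suc k)) = \<kappa> # s \<and> P (\<kappa> # s) \<inter> {L (Suc k)..H (Suc k)} \<noteq> {} \<and> s = list_decode (J k)" for k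
  proof -
    have par: "parent (enc (J (Suc k), L (Suc k), H (Suc k))) = enc (J k, L k, H k)"
      using c z(2) unfolding tree.branch_def tree.kids_def by (metis (mono_tags, lifting) mem_Collect_eq)
    show ?thesis
    proof (rule parent_cases[OF z(1)[of "Suc k"]])
      assume "parent (enc (J (Suc k), L (Suc k), H (Suc k))) = 0"
      then show ?thesis using par by simp
    next
      fix \<kappa> s a b
      assume *: "J (Suc k) = list_encode (\<kappa> # s)" "P (\<kappa> # s) \<inter> {L (Suc k)..H (Suc k)} \<noteq> {}"
        "parent (enc (J (Suc k), L (Suc k), H (Suc k))) = enc (list_encode s, a, b)" "tile (list_encode s) a b"
      then have "(list_encode s, a, b) = (J k, L k, H k)"
        using par inj_enc z(1)[of k] by (intro inj_onD[OF inj_enc]) auto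
      then have "s = list_decode (J k)" by (metis Pair_inject list_encode_inverse)
      moreover have "list_decode (J (Suc k)) = \<kappa> # s" unfolding *(1) by (rule list_encode_inverse)
      ultimately show ?thesis using *(2) by blast
    qed
  qed
  show ?thesis
  \<comment> \<open>The shift by one skips the tile hung directly below the root, for which the
    intersection test need not have succeeded.\<close>
  proof (rule P_limit[of "\<lambda>i. list_decode (J (Suc i))" "\<lambda>i. L (Suc i)" "\<lambda>i. H (Suc i)"])
    show "\<exists>k. list_decode (J (Suc (Suc i))) = k # list_decode (J (Suc i))" for i
      using step[of "Suc i"] by blast
    show "P (list_decode (J (Suc i))) \<inter> {L (Suc i)..H (Suc i)} \<noteq> {}" for i
      using step[of i] by metis
    show "L (Suc i) \<le> y \<and> y \<le> H (Suc i)" for i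
      using y[of "Suc (Suc i)"] z[of "Suc i"] by simp
    fix e :: real assume "e > 0"
    then obtain m where m: "\<And>k. m \<le> k \<Longrightarrow> k \<in> nodes \<Longrightarrow> right k - left k < e"
      using tree.eventually_short by metis
    have "H (Suc i) - L (Suc i) < e" if "i \<ge> m" for i
      using m[of "c (Suc (Suc i))"] tree.branch_N[OF c, of "Suc (Suc i)"] that z[of "Suc i"] by simp
    then show "\<exists>n. \<forall>i\<ge>n. H (Suc i) - L (Suc i) < e" by blast
  qed
qed

text \<open>Two tiles of the same index may meet at \<open>y\<close> as a common end point. Fixing
  one side on which infinitely many, hence all, indices are present singles out one tile per index,
  and whatever tile of index \<open>i\<close> contains a chosen tile must be the chosen one.\<close>

lemma side_tiles:
  assumes "infinite {j. rg j y} \<or> infinite {j. lg j y}"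
  obtains R where "\<And>j. tile j (fst (R j)) (snd (R j))" "\<And>j. fst (R j) \<le> y \<and> y \<le> snd (R j)"
    "\<And>i j a b. tile i a b \<Longrightarrow> a \<le> fst (R j) \<Longrightarrow> snd (R j) \<le> b \<Longrightarrow> (a, b) = R i"
proof -
  have all: "Q j" if "infinite {j. Q j}" "\<And>i j. i \<le> j \<Longrightarrow> Q j \<Longrightarrow> Q i" for Q :: "nat \<Rightarrow> bool" and j
    using that by (metis finite_nat_set_iff_bounded_le mem_Collect_eq nat_le_linear)
  show ?thesis
  proof (cases "infinite {j. rg j y}")
    case True
    then have "\<exists>z. tile j (fst z) (snd z) \<and> fst z \<le> y \<and> y < snd z" for j
      using tile_right[of j y] all[of "\<lambda>j. rg j y" j] rg_antimono by (metis fst_conv snd_conv)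
    then obtain R where R: "\<And>j. tile j (fst (R j)) (snd (R j)) \<and> fst (R j) \<le> y \<and> y < snd (R j)" by metis
    show ?thesis
    proof (rule that[of R])
      fix i j a b assume "tile i a b" "a \<le> fst (R j)" "snd (R j) \<le> b"
      then show "(a, b) = R i"
        using tile_unique[of i a b "fst (R i)" "snd (R i)"] R[of i] R[of j] by (cases "R i") auto
    qed (use R in \<open>auto simp: less_imp_le\<close>)
  next
    case False
    then have "infinite {j. lg j y}" using assms by blast
    then have "\<exists>z. tile j (fst z) (snd z) \<and> fst z < y \<and> y \<le> snd z" for j
      using tile_left[of j y] all[of "\<lambda>j. lg j y" j] lg_antimono by (metis fst_conv snd_conv)
    then obtain R where R: "\<And>j. tile j (fst (R j)) (snd (R j)) \<and> fst (R j) < y \<and> y \<le> snd (R j)" by metis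
    show ?thesis
    proof (rule that[of R])
      fix i j a b assume "tile i a b" "a \<le> fst (R j)" "snd (R j) \<le> b"
      then show "(a, b) = R i"
        using tile_unique[of i a b "fst (R i)" "snd (R i)"] R[of i] R[of j] by (cases "R i") auto
    qed (use R in \<open>auto simp: less_imp_le\<close>)
  qed
qed

text \<open>The prefixes of a code of \<open>y\<close> index the chosen tiles at \<open>y\<close>.
  Each contains \<open>y\<close>, a point of the corresponding set of the scheme, so the
  intersection test succeeds, and consistency of the chosen tiles identifies the parent. The indices
  recover all prefixes, hence the code.\<close>

lemma branches_of_codes:
  assumes y: "y \<in> {0..1}" and inf: "infinite {j. rg j y} \<or> infinite {j. lg j y}"
  shows "{\<sigma>. \<forall>n. y \<in> P (prefix_code \<sigma> n)} \<lesssim> {c. tree.branch c \<and> (\<forall>k. left (c k) \<le> y \<and> y \<le> right (c k))}"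
proof -
  obtain R where R: "\<And>j. tile j (fst (R j)) (snd (R j))" "\<And>j. fst (R j) \<le> y \<and> y \<le> snd (R j)"
    "\<And>i j a b. tile i a b \<Longrightarrow> a \<le> fst (R j) \<Longrightarrow> snd (R j) \<le> b \<Longrightarrow> (a, b) = R i"
    using side_tiles[OF inf] by metis
  have RT: "(j, R j) \<in> T" for j using R(1)[of j] by (simp add: T_def case_prod_unfold)
  define J where "J \<sigma> n = list_encode (prefix_code \<sigma> n)" for \<sigma> n
  define c where "c \<sigma> k = (case k of 0 \<Rightarrow> 0 | Suc n \<Rightarrow> enc (J \<sigma> n, R (J \<sigma> n)))" for \<sigma> k
  have c_simps: "c \<sigma> 0 = 0" "c \<sigma> (Suc n) = enc (J \<sigma> n, R (J \<sigma> n))" for \<sigma> n by (simp_all add: c_def)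
  have in_nodes: "c \<sigma> (Suc n) \<in> nodes" for \<sigma> n using RT by (auto simp: nodes_def c_simps)
  have br: "tree.branch (c \<sigma>)" if \<sigma>: "\<forall>n. y \<in> P (prefix_code \<sigma> n)" for \<sigma>
    unfolding tree.branch_def
  proof (intro conjI allI)
    show "c \<sigma> 0 = 0" by (simp add: c_simps)
    fix k
    have "parent (c \<sigma> (Suc k)) = c \<sigma> k"
    proof (cases k)
      case 0
      have "J \<sigma> 0 = 0" by (simp add: J_def prefix_code_simps)
      then have "dec (c \<sigma> (Suc 0)) = (0, R 0)" using RT[of 0] by (simp add: c_simps)
      moreover obtain a b where "R 0 = (a, b)" by fastforce
      ultimately have "parent (c \<sigma> (Suc 0)) = 0" by (simp add: parent_def)
      then show ?thesis using 0 by (simp add: c_simps)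
    next
      case (Suc n)
      obtain a b where ab: "R (J \<sigma> (Suc n)) = (a, b)" by fastforce
      have ld: "list_decode (J \<sigma> (Suc n)) = \<sigma> n # prefix_code \<sigma> n"
        unfolding J_def prefix_code_simps(2) by (rule list_encode_inverse)
      have "y \<in> P (prefix_code \<sigma> (Suc n))" using \<sigma> by blast
      then have "P (\<sigma> n # prefix_code \<sigma> n) \<inter> {a..b} \<noteq> {}"
        using R(2)[of "J \<sigma> (Suc n)"] ab by (auto simp: prefix_code_simps)
      moreover have "dec (c \<sigma> (Suc (Suc n))) = (J \<sigma> (Suc n), a, b)"
        using RT[of "J \<sigma> (Suc n)"] by (simp add: c_simps ab)
      moreover have "c \<sigma> (Suc (Suc n)) \<noteq> 0" by (simp add: c_simps)
      ultimately have "parent (c \<sigma> (Suc (Suc n))) = enc (J \<sigma> n, up (J \<sigma> n) a b)"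
        by (simp add: parent_def J_def prefix_code_simps del: list_encode.simps)
      moreover have "up (J \<sigma> n) a b = R (J \<sigma> n)"
      proof -
        have le: "J \<sigma> n \<le> J \<sigma> (Suc n)"
          unfolding J_def prefix_code_simps(2) by (rule less_imp_le[OF list_encode_less])
        have "tile (J \<sigma> (Suc n)) a b" using R(1)[of "J \<sigma> (Suc n)"] ab by simp
        note u = up[OF this le]
        show ?thesis
          using R(3)[OF u(1), of "J \<sigma> (Suc n)"] u(2,3) ab by simp
      qed
      ultimately show ?thesis using Suc by (simp add: c_simps)
    qed
    then show "c \<sigma> (Suc k) \<in> tree.kids (c \<sigma> k)"
      using in_nodes[of \<sigma> k] enc_nz[of "(J \<sigma> k, R (J \<sigma> k))"] unfolding tree.kids_def c_simps by blast
  qed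
  have thr: "left (c \<sigma> k) \<le> y \<and> y \<le> right (c \<sigma> k)" for \<sigma> k
    using y RT R(2) by (cases k) (auto simp: c_simps left_def[of 0] right_def[of 0])
  have "inj c"
  proof (rule injI)
    fix \<sigma> \<tau> assume eq: "c \<sigma> = c \<tau>"
    have "prefix_code \<sigma> n = prefix_code \<tau> n" for n
    proof -
      have "enc (J \<sigma> n, R (J \<sigma> n)) = enc (J \<tau> n, R (J \<tau> n))"
        using fun_cong[OF eq, of "Suc n"] by (simp only: c_simps)
      then have "J \<sigma> n = J \<tau> n" using inj_onD[OF inj_enc _ RT RT] by blast
      then show ?thesis unfolding J_def by (metis list_encode_inverse)
    qed
    then show "\<sigma> = \<tau>" using prefix_code_eq by blast
  qed
  then show ?thesis
    unfolding lepoll_def using br thr by (intro exI[of _ c] conjI) (auto intro: inj_on_subset)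
qed

theorem germ_function:
  obtains G :: "real \<Rightarrow> real" and x0 x1 :: real where
    "x0 < x1" "continuous_on {x0..x1} G" "G x0 = 0" "G x1 = 1" "G ` {x0..x1} \<subseteq> {0..1}"
    "\<And>y. y \<in> {0..1} \<Longrightarrow> finite {j. rg j y} \<Longrightarrow> finite {j. lg j y} \<Longrightarrow> finite {x \<in> {x0..x1}. G x = y} \<and>
      card {x \<in> {x0..x1}. G x = y} = 1 + card {j. rg j y} + card {j. lg j y}"
    "\<And>y. infinite {j. rg j y} \<or> infinite {j. lg j y} \<Longrightarrow> infinite {x \<in> {x0..x1}. G x = y}"
    "\<And>y. y \<in> {0..1} \<Longrightarrow> y \<notin> A \<Longrightarrow> countable {x \<in> {x0..x1}. G x = y}"
    "\<And>y. y \<in> {0..1} \<Longrightarrow> y \<in> A \<Longrightarrow> infinite {j. rg j y} \<or> infinite {j. lg j y} \<Longrightarrow>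
      (UNIV :: nat set set) \<lesssim> {x \<in> {x0..x1}. G x = y}"
proof (rule that[of "tree.a 0" "tree.b 0" tree.F])
  have lr: "left 0 = 0" "right 0 = 1" by (simp_all add: left_def right_def)
  show "tree.a 0 < tree.b 0" "tree.F (tree.a 0) = 0" "tree.F (tree.b 0) = 1"
    using tree.dom_bounds tree.F_ends lr by simp_all
  show "continuous_on {tree.a 0..tree.b 0} tree.F"
    by (rule continuous_on_subset[OF tree.continuous_on_F]) (use tree.dom_bounds in auto)
  show "tree.F ` {tree.a 0..tree.b 0} \<subseteq> {0..1}"
    using tree.F_in_J[OF tree.zero_in tree.inK_root] lr by auto
  note fib = tree.fib_def[symmetric]
  show "finite {x \<in> {tree.a 0..tree.b 0}. tree.F x = y} \<and>
      card {x \<in> {tree.a 0..tree.b 0}. tree.F x = y} = 1 + card {j. rg j y} + card {j. lg j y}"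
    if "y \<in> {0..1}" "finite {j. rg j y}" "finite {j. lg j y}" for y
    unfolding fib using tree.fib_finite[of y] that lr finite_over_iff over_sum[OF that(2,3)] by simp
  show "infinite {x \<in> {tree.a 0..tree.b 0}. tree.F x = y}" if "infinite {j. rg j y} \<or> infinite {j. lg j y}" for y
    unfolding fib using tree.fib_infinite finite_over_iff that by blast
  show "countable {x \<in> {tree.a 0..tree.b 0}. tree.F x = y}" if "y \<in> {0..1}" "y \<notin> A" for y
    unfolding fib
  proof (rule tree.fib_countable)
    show "left 0 \<le> y" "y \<le> right 0" using that lr by auto
    fix c assume "tree.branch c"
    then show "\<exists>k. \<not> (left (c k) \<le> y \<and> y \<le> right (c k))" using branch_in_A that(2) by blast
  qed
  show "(UNIV :: nat set set) \<lesssim> {x \<in> {tree.a 0..tree.b 0}. tree.F x = y}"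
    if "y \<in> {0..1}" "y \<in> A" "infinite {j. rg j y} \<or> infinite {j. lg j y}" for y
    unfolding fib
    by (rule lepoll_trans[OF P_codes[OF that(2)] lepoll_trans[OF branches_of_codes[OF that(1,3)] tree.fib_branches]])
qed

end


subsection \<open>Inserting intervals of constancy\<close>

lemma nat_sets_lepoll_interval:
  fixes a b :: real
  assumes "a < b"
  shows "(UNIV :: nat set set) \<lesssim> {a..b}"
proof -
  have "inj_on (aff 0 1 a b) {0..<1}"
    using aff_aff[of 0 1 a b] assms by (intro inj_on_inverseI[of _ "aff a b 0 1"]) auto
  moreover have "aff 0 1 a b ` {0..<1} \<subseteq> {a..b}"
    using aff_le_iff[OF _ assms, of 0 1 0] aff_le_iff[OF _ assms, of 0 1 _ 1] by (auto simp: aff_left aff_right)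
  ultimately have "{0..<1::real} \<lesssim> {a..b}" unfolding lepoll_def by blast
  then show ?thesis using nat_sets_lepoll_reals01 lepoll_trans by blast
qed

text \<open>One preimage of each value in \<open>C\<close> is blown up to an interval by composing
  with a monotone map. Every other point has a single preimage under that map, so fibres over values
  outside \<open>C\<close> keep their size.\<close>

lemma insert_flats:
  fixes G :: "real \<Rightarrow> real"
  assumes ab: "x0 < x1" and G: "continuous_on {x0..x1} G" "G x0 = 0" "G x1 = 1" "G ` {x0..x1} \<subseteq> {0..1}"
    and C: "countable C" "\<And>y. y \<in> C \<Longrightarrow> \<exists>x\<in>{x0..x1}. G x = y"
  obtains F :: "real \<Rightarrow> real" where "continuous_on {0..1} F" "F ` {0..1} \<subseteq> {0..1}" "F 0 = 0" "F 1 = 1"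
    "\<And>y. y \<notin> C \<Longrightarrow> {x \<in> {x0..x1}. G x = y} \<approx> {x \<in> {0..1}. F x = y}"
    "\<And>y. y \<in> C \<Longrightarrow> (UNIV :: nat set set) \<lesssim> {x \<in> {0..1}. F x = y}"
proof -
  obtain X where X: "\<And>y. y \<in> C \<Longrightarrow> X y \<in> {x0..x1} \<and> G (X y) = y" using C(2) by metis
  define R where "R = X ` C"
  have R: "countable R" using C by (simp add: R_def)
  define L where "L = flat_lo R x0"
  define U where "U = flat_hi R x1"
  have LU: "L < U"
    using flat_lo_le_hi[of R x0] flat_lo_le_hi[of R x1] flat_hi_less_lo[OF ab, of R] ab by (simp add: L_def U_def)
  define \<phi> where "\<phi> x = flat_map R (aff 0 1 L U x)" for x
  have lo_in: "L \<le> flat_lo R v" "flat_hi R v \<le> U" if "x0 \<le> v" "v \<le> x1" for v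
  proof -
    show "L \<le> flat_lo R v" unfolding L_def by (rule flat_lo_mono[OF that(1)])
    show "flat_hi R v \<le> U"
      using flat_hi_less_lo[of v x1 R] flat_lo_le_hi[of R x1] that unfolding U_def by (cases "v = x1") auto
  qed
  have \<phi>0: "\<phi> 0 = x0" and \<phi>1: "\<phi> 1 = x1"
    unfolding \<phi>_def flat_map_iff using flat_lo_le_hi by (auto simp: aff_left aff_right L_def U_def)
  have \<phi>_mono: "\<phi> x \<le> \<phi> y" if "x \<le> y" for x y
    unfolding \<phi>_def using aff_le_iff[of 0 1 L U x y] LU that by (intro flat_map_lipschitz(1)) auto
  have \<phi>_in: "\<phi> x \<in> {x0..x1}" if "x \<in> {0..1}" for x
    using \<phi>_mono[of 0 x] \<phi>_mono[of x 1] that \<phi>0 \<phi>1 by auto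
  have \<phi>_iff: "\<phi> x = v \<longleftrightarrow> aff L U 0 1 (flat_lo R v) \<le> x \<and> x \<le> aff L U 0 1 (flat_hi R v)" for x v
    unfolding \<phi>_def flat_map_iff
    using aff_le_iff[of L U 0 1 "flat_lo R v" "aff 0 1 L U x"] aff_le_iff[of L U 0 1 "aff 0 1 L U x" "flat_hi R v"]
      aff_aff[of 0 1 L U x] LU by simp
  have pre_in: "0 \<le> aff L U 0 1 (flat_lo R v)" "aff L U 0 1 (flat_hi R v) \<le> 1"
    "aff L U 0 1 (flat_lo R v) \<le> aff L U 0 1 (flat_hi R v)" if "x0 \<le> v" "v \<le> x1" for v
    using lo_in[OF that] aff_le_iff[of L U 0 1 L "flat_lo R v"] aff_le_iff[of L U 0 1 "flat_hi R v" U] LU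
      aff_le_iff[of L U 0 1 "flat_lo R v" "flat_hi R v"] flat_lo_le_hi[of R v]
    by (simp_all add: aff_left aff_right)
  define F where "F x = G (\<phi> x)" for x
  show ?thesis
  proof (rule that[of F])
    have "continuous_on {0..1} \<phi>"
      unfolding \<phi>_def by (rule continuous_on_compose2[OF continuous_on_flat_map[of UNIV] continuous_on_aff]) auto
    then show "continuous_on {0..1} F"
      unfolding F_def using \<phi>_in by (intro continuous_on_compose2[OF G(1)]) auto
    show "F ` {0..1} \<subseteq> {0..1}" unfolding F_def using \<phi>_in G(4) by blast
    show "F 0 = 0" "F 1 = 1" by (simp_all add: F_def \<phi>0 \<phi>1 G)
    show "{x \<in> {x0..x1}. G x = y} \<approx> {x \<in> {0..1}. F x = y}" if y: "y \<notin> C" for y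
    proof -
      \<comment> \<open>Over points outside \<open>R\<close> the flat interval is degenerate, and
        its left end inverts \<open>\<phi>\<close> there.\<close>
      let ?g = "\<lambda>v. aff L U 0 1 (flat_lo R v)"
      have \<phi>g: "\<phi> (?g v) = v" if "v \<in> {x0..x1}" for v
        unfolding \<phi>_iff using pre_in[of v] that by simp
      have g\<phi>: "?g (\<phi> x) = x" if x: "x \<in> {0..1}" "F x = y" for x
      proof -
        have "\<phi> x \<notin> R" using x y X unfolding R_def F_def by auto
        then have "flat_lo R (\<phi> x) = flat_hi R (\<phi> x)" by (rule flat_lo_eq_hi)
        then show ?thesis using \<phi>_iff[of x "\<phi> x"] by simp
      qed
      have "bij_betw ?g {x \<in> {x0..x1}. G x = y} {x \<in> {0..1}. F x = y}"
      proof (rule bij_betw_byWitness[of _ \<phi>])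
        show "\<forall>a\<in>{x \<in> {x0..x1}. G x = y}. \<phi> (?g a) = a" using \<phi>g by blast
        show "\<forall>a'\<in>{x \<in> {0..1}. F x = y}. ?g (\<phi> a') = a'" using g\<phi> by blast
        show "?g ` {x \<in> {x0..x1}. G x = y} \<subseteq> {x \<in> {0..1}. F x = y}"
        proof clarify
          fix v assume v: "v \<in> {x0..x1}"
          have "?g v \<in> {0..1}" using pre_in[of v] v by auto
          then show "?g v \<in> {0..1} \<and> F (?g v) = G v" unfolding F_def using \<phi>g[OF v] by simp
        qed
        show "\<phi> ` {x \<in> {0..1}. F x = y} \<subseteq> {x \<in> {x0..x1}. G x = y}"
          using \<phi>_in by (auto simp: F_def)
      qed
      then show ?thesis unfolding eqpoll_def by blast
    qed
    show "(UNIV :: nat set set) \<lesssim> {x \<in> {0..1}. F x = y}" if y: "y \<in> C" for y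
    proof -
      have v: "X y \<in> {x0..x1}" "G (X y) = y" "X y \<in> R" using X[OF y] y by (auto simp: R_def)
      let ?a = "aff L U 0 1 (flat_lo R (X y))" and ?b = "aff L U 0 1 (flat_hi R (X y))"
      have "?a < ?b" using aff_less_iff[of L U 0 1] LU flat_lo_less_hi[OF R v(3)] by simp
      then have "(UNIV :: nat set set) \<lesssim> {?a..?b}" by (rule nat_sets_lepoll_interval)
      moreover have "{?a..?b} \<subseteq> {x \<in> {0..1}. F x = y}"
      proof
        fix x assume x: "x \<in> {?a..?b}"
        then have "\<phi> x = X y" unfolding \<phi>_iff by simp
        moreover have "x \<in> {0..1}" using x pre_in(1,2)[of "X y"] v by auto
        ultimately show "x \<in> {x \<in> {0..1}. F x = y}" using v by (simp add: F_def)
      qed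
      ultimately show ?thesis using subset_imp_lepoll lepoll_trans by blast
    qed
  qed
qed

lemma has_card_Aleph0I:
  assumes "countable A" "infinite A"
  shows "has_card A Aleph0"
  using countableE_infinite[OF assms] by (auto simp: eqpoll_def)

lemma has_card_ContinuumI:
  fixes A :: "real set"
  assumes "(UNIV :: nat set set) \<lesssim> A"
  shows "has_card A Continuum"
proof -
  have "A \<lesssim> (UNIV :: real set)" by (rule subset_imp_lepoll) simp
  then have "A \<lesssim> (UNIV :: nat set set)"
    using nat_sets_eqpoll_reals eqpoll_sym lepoll_trans2 by blast
  then show ?thesis using assms by (simp add: lepoll_antisym)
qed

subsection \<open>Splitting a cardinal-valued function into germs\<close>

text \<open>At an end value all neighbours on the outer side have \<open>ext\<close> equal to
  \<open>Fin 1\<close>, so the quantifier over them disappears. The minima with \<open>1\<close>,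
  \<open>y\<close> or \<open>1 - y\<close> keep the inner neighbours within
  \<open>{0..1}\<close>.\<close>

lemma ext_iff:
  assumes "y \<in> {0..1}"
  shows "(\<exists>\<epsilon>>0. \<forall>y1 y2. y - \<epsilon> < y1 \<and> y1 < y \<and> y < y2 \<and> y2 < y + \<epsilon> \<longrightarrow> Q (ext f y1) (ext f y2)) \<longleftrightarrow>
    (if y = 0 then \<exists>\<epsilon>>0. \<forall>y2\<in>{0..1}. 0 < y2 \<and> y2 < \<epsilon> \<longrightarrow> Q (Fin 1) (f y2)
     else if y = 1 then \<exists>\<epsilon>>0. \<forall>y1\<in>{0..1}. 1 - \<epsilon> < y1 \<and> y1 < 1 \<longrightarrow> Q (f y1) (Fin 1)
     else \<exists>\<epsilon>>0. \<forall>y1\<in>{0..1}. \<forall>y2\<in>{0..1}. y - \<epsilon> < y1 \<and> y1 < y \<and> y < y2 \<and> y2 < y + \<epsilon> \<longrightarrow> Q (f y1) (f y2))"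
  (is "?L \<longleftrightarrow> ?R")
proof
  assume ?L
  then obtain \<epsilon> where e: "\<epsilon> > 0"
    "\<And>y1 y2. y - \<epsilon> < y1 \<Longrightarrow> y1 < y \<Longrightarrow> y < y2 \<Longrightarrow> y2 < y + \<epsilon> \<Longrightarrow> Q (ext f y1) (ext f y2)" by blast
  consider "y = 0" | "y = 1" | "0 < y" "y < 1" using assms by fastforce
  then show ?R
  proof cases
    case 1
    have "Q (Fin 1) (f y2)" if "y2 \<in> {0..1}" "0 < y2" "y2 < \<epsilon>" for y2
      using e(2)[of "- (\<epsilon> / 2)" y2] that e(1) 1 by (simp add: ext_def)
    then show ?thesis using 1 e(1) by auto
  next
    case 2
    have "Q (f y1) (Fin 1)" if "y1 \<in> {0..1}" "1 - \<epsilon> < y1" "y1 < 1" for y1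
      using e(2)[of y1 "1 + \<epsilon> / 2"] that e(1) 2 by (simp add: ext_def)
    then show ?thesis using 2 e(1) by auto
  next
    case 3
    have "Q (f y1) (f y2)" if "y1 \<in> {0..1}" "y2 \<in> {0..1}" "y - \<epsilon> < y1" "y1 < y" "y < y2" "y2 < y + \<epsilon>" for y1 y2
      using e(2)[of y1 y2] that by (simp add: ext_def)
    then show ?thesis using 3 e(1) by auto
  qed
next
  assume R: ?R
  consider "y = 0" | "y = 1" | "0 < y" "y < 1" using assms by fastforce
  then show ?L
  proof cases
    case 1
    then obtain \<epsilon> where e: "\<epsilon> > 0" "\<And>y2. y2 \<in> {0..1} \<Longrightarrow> 0 < y2 \<Longrightarrow> y2 < \<epsilon> \<Longrightarrow> Q (Fin 1) (f y2)"
      using R by auto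
    then show ?thesis using 1 by (intro exI[of _ "min \<epsilon> 1"]) (auto simp: ext_def)
  next
    case 2
    then obtain \<epsilon> where e: "\<epsilon> > 0" "\<And>y1. y1 \<in> {0..1} \<Longrightarrow> 1 - \<epsilon> < y1 \<Longrightarrow> y1 < 1 \<Longrightarrow> Q (f y1) (Fin 1)"
      using R by auto
    then show ?thesis using 2 by (intro exI[of _ "min \<epsilon> 1"]) (auto simp: ext_def)
  next
    case 3
    then obtain \<epsilon> where e: "\<epsilon> > 0"
      "\<And>y1 y2. y1 \<in> {0..1} \<Longrightarrow> y2 \<in> {0..1} \<Longrightarrow> y - \<epsilon> < y1 \<Longrightarrow> y1 < y \<Longrightarrow> y < y2 \<Longrightarrow> y2 < y + \<epsilon> \<Longrightarrow> Q (f y1) (f y2)"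
      using R by auto
    then show ?thesis using 3 by (intro exI[of _ "min \<epsilon> (min y (1 - y))"]) (auto simp: ext_def)
  qed
qed

text \<open>Availability of the right germ of index \<open>j\<close>: the neighbours on the right
  can afford the base point together with a right and a left germ for each index up to
  \<open>j\<close>.\<close>

definition right_ge :: "(real \<Rightarrow> cardval) \<Rightarrow> nat \<Rightarrow> real \<Rightarrow> bool" where
  "right_ge f j y \<longleftrightarrow> (\<exists>e>0. \<forall>t. y < t \<and> t < y + e \<longrightarrow> Fin (2 * j + 3) \<le> ext f t)"

definition left_ge :: "(real \<Rightarrow> cardval) \<Rightarrow> nat \<Rightarrow> real \<Rightarrow> bool" where
  "left_ge f j y \<longleftrightarrow> (\<exists>e>0. \<forall>t. y - e < t \<and> t < y \<longrightarrow> Fin (2 * j + 3) \<le> ext f t)"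

lemma Fin_le_trans: "m \<le> n \<Longrightarrow> Fin n \<le> a \<Longrightarrow> Fin m \<le> a"
  by (rule order_trans[of _ "Fin n"]) (simp_all add: Fin_le_iff)

lemma right_ge_antimono: "i \<le> j \<Longrightarrow> right_ge f j y \<Longrightarrow> right_ge f i y"
  unfolding right_ge_def using Fin_le_trans[of "2 * i + 3" "2 * j + 3"] by fastforce

lemma left_ge_antimono: "i \<le> j \<Longrightarrow> left_ge f j y \<Longrightarrow> left_ge f i y"
  unfolding left_ge_def using Fin_le_trans[of "2 * i + 3" "2 * j + 3"] by fastforce

lemma not_ge_witness:
  assumes "\<not> right_ge f u y" "\<not> left_ge f v y" "\<epsilon> > 0"
  obtains y1 y2 m n where "y - \<epsilon> < y1" "y1 < y" "y < y2" "y2 < y + \<epsilon>"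
    "ext f y1 = Fin m" "m \<le> 2 * v + 2" "ext f y2 = Fin n" "n \<le> 2 * u + 2"
proof -
  have small: "\<exists>m. a = Fin m \<and> m \<le> 2 * j + 2" if "\<not> Fin (2 * j + 3) \<le> a" for a j
    using that by (cases a) (auto simp: Fin_le_iff Fin_le_infinite)
  obtain y2 where "y < y2" "y2 < y + \<epsilon>" "\<not> Fin (2 * u + 3) \<le> ext f y2"
    using assms unfolding right_ge_def by blast
  moreover obtain y1 where "y - \<epsilon> < y1" "y1 < y" "\<not> Fin (2 * v + 3) \<le> ext f y1"
    using assms unfolding left_ge_def by blast
  ultimately show ?thesis using small that by metis
qed

text \<open>Distributes the \<open>k - 1\<close> excess points of a finite fibre over the two sides as evenly as the
  available germs permit.\<close>

lemma split_count:
  fixes B A :: "nat \<Rightarrow> bool"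
  assumes B: "\<And>i j. i \<le> j \<Longrightarrow> B j \<Longrightarrow> B i" and A: "\<And>i j. i \<le> j \<Longrightarrow> A j \<Longrightarrow> A i"
    and k: "k \<ge> 1" and enough: "\<And>u v. \<not> B u \<Longrightarrow> \<not> A v \<Longrightarrow> k \<le> u + v + 1"
  obtains \<rho> \<tau> where "\<rho> + \<tau> + 1 = k" "\<And>j. j < \<rho> \<Longrightarrow> B j" "\<And>j. j < \<tau> \<Longrightarrow> A j"
    "\<And>j. B j \<Longrightarrow> A j \<Longrightarrow> 2 * j + 3 \<le> k \<Longrightarrow> j < \<rho> \<and> j < \<tau>"
proof -
  \<comment> \<open>Below the bound \<open>k\<close>, availability is an initial segment; truncation
    covers the case where all indices are available.\<close>
  have init: "\<exists>n\<le>k. (\<forall>j. j < n \<longleftrightarrow> j < k \<and> Q j)" if Q: "\<And>i j. i \<le> j \<Longrightarrow> Q j \<Longrightarrow> Q i" for Q :: "nat \<Rightarrow> bool"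
  proof (cases "\<exists>j<k. \<not> Q j")
    case True
    define n where "n = (LEAST j. \<not> Q j)"
    have n: "\<not> Q n" "\<And>j. j < n \<Longrightarrow> Q j" "n < k"
      unfolding n_def using True LeastI_ex[of "\<lambda>j. \<not> Q j"] not_less_Least[of _ "\<lambda>j. \<not> Q j"]
      by (blast, blast, meson Least_le le_less_trans)
    have "j < n \<longleftrightarrow> j < k \<and> Q j" for j
      using n Q[of n j] by (cases "j < n") auto
    then show ?thesis using n(3) by (intro exI[of _ n]) auto
  qed auto
  obtain b where b: "b \<le> k" "\<And>j. j < b \<longleftrightarrow> j < k \<and> B j" using init[of B] B by blast
  obtain a where a: "a \<le> k" "\<And>j. j < a \<longleftrightarrow> j < k \<and> A j" using init[of A] A by blast
  have ab: "k \<le> a + b + 1"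
  proof (cases "a = k \<or> b = k")
    case False
    then have "\<not> B b" "\<not> A a" using a b by (metis le_neq_implies_less less_irrefl)+
    then show ?thesis using enough[of b a] by simp
  qed auto
  define c where "c = (k - 1) div 2"
  \<comment> \<open>Half of the surplus is aimed at the side of \<open>A\<close>, limited by its
    supply \<open>a\<close>; the second argument of \<open>max\<close> takes over what
    \<open>B\<close> cannot supply.\<close>
  define \<tau> where "\<tau> = max (min a c) (k - 1 - b)"
  define \<rho> where "\<rho> = k - 1 - \<tau>"
  have \<tau>: "\<tau> \<le> a" "\<tau> \<le> k - 1" and \<rho>: "\<rho> \<le> b"
    unfolding \<rho>_def \<tau>_def c_def using ab by auto
  show ?thesis
  proof (rule that[of \<rho> \<tau>])
    show "\<rho> + \<tau> + 1 = k" using \<tau> k unfolding \<rho>_def by simp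
    show "B j" if "j < \<rho>" for j using that \<rho> b(2)[of j] by simp
    show "A j" if "j < \<tau>" for j using that \<tau> a(2)[of j] by simp
    fix j assume j: "B j" "A j" "2 * j + 3 \<le> k"
    then have "j < a" "j < b" using a(2)[of j] b(2)[of j] by auto
    moreover have "j < c" using j(3) unfolding c_def by linarith
    moreover have "2 * c \<le> k - 1" unfolding c_def by simp
    ultimately show "j < \<rho> \<and> j < \<tau>" using j(3) unfolding \<rho>_def \<tau>_def by (auto simp: max_def min_def)
  qed
qed

theorem level_function_exists:
  fixes f :: "real \<Rightarrow> cardval"
  assumes f: "f ` {0..1} \<subseteq> {Fin n |n. n \<ge> 1} \<union> {Aleph0, Continuum}"
    and fin: "\<And>y k. y \<in> {0..1} \<Longrightarrow> f y = Fin k \<Longrightarrow> \<exists>\<epsilon>>0. \<forall>y1 y2. y - \<epsilon> < y1 \<and> y1 < y \<and> y < y2 \<and> y2 < y + \<epsilon> \<longrightarrow>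
      Fin (2 * k) \<le> ext f y1 + ext f y2 \<and> (ext f y1 + ext f y2 = Fin (2 * k) \<longrightarrow> odd_card (ext f y1) \<or> odd_card (ext f y2))"
    and C: "countable C" "C \<subseteq> {y \<in> {0..1}. f y = Continuum}"
    and inf: "\<And>y n. y \<in> {0..1} - C \<Longrightarrow> f y \<in> {Aleph0, Continuum} \<Longrightarrow>
      \<exists>\<epsilon>>0. \<forall>y1 y2. y - \<epsilon> < y1 \<and> y1 < y \<and> y < y2 \<and> y2 < y + \<epsilon> \<longrightarrow> Fin n \<le> ext f y1 + ext f y2"
    and analytic: "analytic_set {y \<in> {0..1}. f y = Continuum}"
  shows "\<exists>F :: real \<Rightarrow> real. continuous_on {0..1} F \<and> F ` {0..1} \<subseteq> {0..1} \<and> F 0 = 0 \<and> F 1 = 1 \<and>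
    (\<forall>y\<in>{0..1}. has_card {x \<in> {0..1}. F x = y} (f y))"
proof -
  define A where "A = {y \<in> {0..1}. f y = Continuum}"
  obtain P where P: "souslin_scheme A P"
    using analytic_scheme[OF analytic[folded A_def]] by blast
  interpret souslin_scheme A P by (rule P)
  \<comment> \<open>The witnesses satisfy \<open>m + n \<le> 2 * u + 2 * v + 4\<close>. A violation
    would force equality with \<open>2 * k\<close> and both \<open>m\<close> and \<open>n\<close>
    even, contrary to the parity clause.\<close>
  have enough: "k \<le> u + v + 1" if k: "ext f y = Fin k" and uv: "\<not> right_ge f u y" "\<not> left_ge f v y" for y k u v
  proof (cases "y \<in> {0..1}")
    case False
    then show ?thesis using k by (auto simp: ext_def)
  next
    case True
    then have "f y = Fin k" using k by (simp add: ext_def)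
    then obtain \<epsilon> where e: "\<epsilon> > 0" "\<And>y1 y2. y - \<epsilon> < y1 \<Longrightarrow> y1 < y \<Longrightarrow> y < y2 \<Longrightarrow> y2 < y + \<epsilon> \<Longrightarrow>
      Fin (2 * k) \<le> ext f y1 + ext f y2 \<and> (ext f y1 + ext f y2 = Fin (2 * k) \<longrightarrow> odd_card (ext f y1) \<or> odd_card (ext f y2))"
      using fin[OF True] by blast
    obtain y1 y2 m n where w: "y - \<epsilon> < y1" "y1 < y" "y < y2" "y2 < y + \<epsilon>"
      "ext f y1 = Fin m" "m \<le> 2 * v + 2" "ext f y2 = Fin n" "n \<le> 2 * u + 2"
      by (rule not_ge_witness[OF uv e(1)])
    have le: "2 * k \<le> m + n" and odd: "m + n = 2 * k \<Longrightarrow> odd m \<or> odd n"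
      using e(2)[OF w(1-4)] w(5,7) by (auto simp: Fin_le_iff odd_card_def)
    show ?thesis
    proof (rule ccontr)
      assume "\<not> k \<le> u + v + 1"
      then have "m = 2 * v + 2" "n = 2 * u + 2" "m + n = 2 * k" using le w(6,8) by linarith+
      then show False using odd by simp
    qed
  qed
  have ext_pos: "k \<ge> 1" if "ext f y = Fin k" for y k
  proof (cases "y \<in> {0..1}")
    case True
    then have "Fin k \<in> {Fin n |n. n \<ge> 1} \<union> {Aleph0, Continuum}"
      using that f by (force simp: ext_def)
    then show ?thesis by auto
  qed (use that in \<open>auto simp: ext_def split: if_splits\<close>)
  \<comment> \<open>At a finite value the germs must be rationed, at an infinite one all available
    germs are taken. The fifth clause forbids rationing an index that is available on both sides and
    affordable at \<open>y\<close>; it is what makes the germs of neighbouring values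
    persist.\<close>
  define S where "S y r l \<longleftrightarrow> (\<forall>i j. i \<le> j \<longrightarrow> r j \<longrightarrow> r i) \<and> (\<forall>i j. i \<le> j \<longrightarrow> l j \<longrightarrow> l i) \<and>
      (\<forall>j. r j \<longrightarrow> right_ge f j y) \<and> (\<forall>j. l j \<longrightarrow> left_ge f j y) \<and>
      (\<forall>j. right_ge f j y \<longrightarrow> left_ge f j y \<longrightarrow> Fin (2 * j + 3) \<le> ext f y \<longrightarrow> r j \<and> l j) \<and>
      (case ext f y of Fin k \<Rightarrow> finite {j. r j} \<and> finite {j. l j} \<and> 1 + card {j. r j} + card {j. l j} = k
        | _ \<Rightarrow> (\<forall>j. r j = right_ge f j y) \<and> (\<forall>j. l j = left_ge f j y))"
    for y r l
  have "\<exists>r l. S y r l" for y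
  proof (cases "\<exists>k. ext f y = Fin k")
    case True
    then obtain k where k: "ext f y = Fin k" by blast
    have "\<exists>\<rho> \<tau>. \<rho> + \<tau> + 1 = k \<and> (\<forall>j<\<rho>. right_ge f j y) \<and> (\<forall>j<\<tau>. left_ge f j y) \<and>
      (\<forall>j. right_ge f j y \<longrightarrow> left_ge f j y \<longrightarrow> 2 * j + 3 \<le> k \<longrightarrow> j < \<rho> \<and> j < \<tau>)"
    proof (rule split_count[of "\<lambda>j. right_ge f j y" "\<lambda>j. left_ge f j y" k])
      show "right_ge f i y" if "i \<le> j" "right_ge f j y" for i j by (rule right_ge_antimono[OF that])
      show "left_ge f i y" if "i \<le> j" "left_ge f j y" for i j by (rule left_ge_antimono[OF that])
      show "k \<ge> 1" by (rule ext_pos[OF k])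
      show "k \<le> u + v + 1" if "\<not> right_ge f u y" "\<not> left_ge f v y" for u v by (rule enough[OF k that])
    qed blast
    then obtain \<rho> \<tau> where rl: "\<rho> + \<tau> + 1 = k" "\<forall>j<\<rho>. right_ge f j y" "\<forall>j<\<tau>. left_ge f j y"
      "\<forall>j. right_ge f j y \<longrightarrow> left_ge f j y \<longrightarrow> 2 * j + 3 \<le> k \<longrightarrow> j < \<rho> \<and> j < \<tau>"
      by blast
    show ?thesis
      unfolding S_def
    proof (rule exI[of _ "\<lambda>j. j < \<rho>"], rule exI[of _ "\<lambda>j. j < \<tau>"], intro conjI)
      show "\<forall>j. right_ge f j y \<longrightarrow> left_ge f j y \<longrightarrow> Fin (2 * j + 3) \<le> ext f y \<longrightarrow> j < \<rho> \<and> j < \<tau>"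
        using rl(4) unfolding k Fin_le_iff by blast
      show "case ext f y of Fin k \<Rightarrow> finite {j. j < \<rho>} \<and> finite {j. j < \<tau>} \<and>
          1 + card {j. j < \<rho>} + card {j. j < \<tau>} = k
        | _ \<Rightarrow> (\<forall>j. (j < \<rho>) = right_ge f j y) \<and> (\<forall>j. (j < \<tau>) = left_ge f j y)"
        using rl(1) by (simp add: k)
    qed (use rl(2,3) in auto)
  next
    case False
    show ?thesis
      unfolding S_def
    proof (rule exI[of _ "\<lambda>j. right_ge f j y"], rule exI[of _ "\<lambda>j. left_ge f j y"], intro conjI)
      show "\<forall>i j. i \<le> j \<longrightarrow> right_ge f j y \<longrightarrow> right_ge f i y" using right_ge_antimono by blast
      show "\<forall>i j. i \<le> j \<longrightarrow> left_ge f j y \<longrightarrow> left_ge f i y" using left_ge_antimono by blast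
      show "case ext f y of Fin k \<Rightarrow> finite {j. right_ge f j y} \<and> finite {j. left_ge f j y} \<and>
          1 + card {j. right_ge f j y} + card {j. left_ge f j y} = k
        | _ \<Rightarrow> (\<forall>j. right_ge f j y = right_ge f j y) \<and> (\<forall>j. left_ge f j y = left_ge f j y)"
        using False by (cases "ext f y") auto
    qed auto
  qed
  then obtain r l where S: "\<And>y. S y (r y) (l y)" by metis
  note S = S[unfolded S_def]
  have rl: "i \<le> j \<Longrightarrow> r y j \<Longrightarrow> r y i" "i \<le> j \<Longrightarrow> l y j \<Longrightarrow> l y i"
    "r y j \<Longrightarrow> right_ge f j y" "l y j \<Longrightarrow> left_ge f j y"
    "right_ge f j y \<Longrightarrow> left_ge f j y \<Longrightarrow> Fin (2 * j + 3) \<le> ext f y \<Longrightarrow> r y j \<and> l y j"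
    "case ext f y of Fin k \<Rightarrow> finite {j. r y j} \<and> finite {j. l y j} \<and> 1 + card {j. r y j} + card {j. l y j} = k
        | _ \<Rightarrow> (\<forall>j. r y j = right_ge f j y) \<and> (\<forall>j. l y j = left_ge f j y)" for y i j
    using S[of y] by blast+
  \<comment> \<open>Inside an open interval of sufficiently large values, index \<open>j\<close> is
    available on both sides of every point and affordable there, so the choice retains it.\<close>
  have both: "r t j \<and> l t j" if "\<And>t. a < t \<Longrightarrow> t < b \<Longrightarrow> Fin (2 * j + 3) \<le> ext f t" "a < t" "t < b" for a b t j
  proof (rule rl(5))
    show "Fin (2 * j + 3) \<le> ext f t" using that by blast
    show "right_ge f j t" unfolding right_ge_def using that by (intro exI[of _ "b - t"]) auto
    show "left_ge f j t" unfolding left_ge_def using that by (intro exI[of _ "t - a"]) auto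
  qed
  interpret coded_germs "\<lambda>j y. r y j" "\<lambda>j y. l y j" A P
  proof
    fix j y
    show "r y (Suc j) \<Longrightarrow> r y j" "l y (Suc j) \<Longrightarrow> l y j" using rl(1,2)[of j "Suc j" y] by simp_all
    show "\<exists>e>0. \<forall>t. y < t \<and> t < y + e \<longrightarrow> r t j \<and> l t j" if rj: "r y j"
    proof -
      obtain e where "e > 0" "\<And>t. y < t \<Longrightarrow> t < y + e \<Longrightarrow> Fin (2 * j + 3) \<le> ext f t"
        using rl(3)[OF rj] unfolding right_ge_def by blast
      then show ?thesis using both[of y "y + e" j] by blast
    qed
    show "\<exists>e>0. \<forall>t. y - e < t \<and> t < y \<longrightarrow> r t j \<and> l t j" if lj: "l y j"
    proof -
      obtain e where "e > 0" "\<And>t. y - e < t \<Longrightarrow> t < y \<Longrightarrow> Fin (2 * j + 3) \<le> ext f t"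
        using rl(4)[OF lj] unfolding left_ge_def by blast
      then show ?thesis using both[of "y - e" y j] by blast
    qed
    show "0 \<le> y \<and> y < 1" if rj: "r y j"
    proof (rule ccontr)
      assume *: "\<not> (0 \<le> y \<and> y < 1)"
      obtain e where e: "e > 0" "\<And>t. y < t \<Longrightarrow> t < y + e \<Longrightarrow> Fin (2 * j + 3) \<le> ext f t"
        using rl(3)[OF rj] unfolding right_ge_def by blast
      \<comment> \<open>A neighbour outside \<open>{0..1}\<close>, where the value \<open>1\<close>
        is below every threshold \<open>2 * j + 3\<close>.\<close>
      define t where "t = (if y < 0 then y + min e (- y) / 2 else y + e / 2)"
      have "y < t" "t < y + e" "t \<notin> {0..1}" using e(1) * by (auto simp: t_def min_def field_simps)
      then show False using e(2)[of t] by (auto simp: ext_def Fin_le_iff split: if_splits)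
    qed
    show "0 < y \<and> y \<le> 1" if lj: "l y j"
    proof (rule ccontr)
      assume *: "\<not> (0 < y \<and> y \<le> 1)"
      obtain e where e: "e > 0" "\<And>t. y - e < t \<Longrightarrow> t < y \<Longrightarrow> Fin (2 * j + 3) \<le> ext f t"
        using rl(4)[OF lj] unfolding left_ge_def by blast
      define t where "t = (if y > 1 then y - min e (y - 1) / 2 else y - e / 2)"
      have "y - e < t" "t < y" "t \<notin> {0..1}" using e(1) * by (auto simp: t_def min_def field_simps)
      then show False using e(2)[of t] by (auto simp: ext_def Fin_le_iff split: if_splits)
    qed
  qed
  obtain G :: "real \<Rightarrow> real" and x0 x1 where G:
    "x0 < x1" "continuous_on {x0..x1} G" "G x0 = 0" "G x1 = 1" "G ` {x0..x1} \<subseteq> {0..1}"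
    "\<And>y. y \<in> {0..1} \<Longrightarrow> finite {j. r y j} \<Longrightarrow> finite {j. l y j} \<Longrightarrow> finite {x \<in> {x0..x1}. G x = y} \<and>
      card {x \<in> {x0..x1}. G x = y} = 1 + card {j. r y j} + card {j. l y j}"
    "\<And>y. infinite {j. r y j} \<or> infinite {j. l y j} \<Longrightarrow> infinite {x \<in> {x0..x1}. G x = y}"
    "\<And>y. y \<in> {0..1} \<Longrightarrow> y \<notin> A \<Longrightarrow> countable {x \<in> {x0..x1}. G x = y}"
    "\<And>y. y \<in> {0..1} \<Longrightarrow> y \<in> A \<Longrightarrow> infinite {j. r y j} \<or> infinite {j. l y j} \<Longrightarrow>
      (UNIV :: nat set set) \<lesssim> {x \<in> {x0..x1}. G x = y}"
    by (rule germ_function) blast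
  \<comment> \<open>Intervals of constancy go only to those values with
    \<open>f y = Continuum\<close> where the germs run out; an exceptional value with infinitely
    many germs gets its continuum from the branches.\<close>
  define C' where "C' = {y \<in> A. finite {j. r y j} \<and> finite {j. l y j}}"
  have inf_germs: "infinite {j. r y j} \<or> infinite {j. l y j}"
    if y: "y \<in> {0..1} - C" "f y \<in> {Aleph0, Continuum}" for y
  proof (rule ccontr)
    assume "\<not> (infinite {j. r y j} \<or> infinite {j. l y j})"
    then obtain u v where uv: "\<not> r y u" "\<not> l y v"
      by (metis (mono_tags) ex_new_if_finite infinite_UNIV_nat mem_Collect_eq)
    moreover have "(\<forall>j. r y j = right_ge f j y) \<and> (\<forall>j. l y j = left_ge f j y)"
      using rl(6)[of y] y by (auto simp: ext_def)
    ultimately have ge: "\<not> right_ge f u y" "\<not> left_ge f v y" by auto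
    \<comment> \<open>Failure of the indices \<open>u\<close> and \<open>v\<close> allows at most
      \<open>(2 * u + 2) + (2 * v + 2)\<close> preimages in total; the requested number is one
      more.\<close>
    obtain \<epsilon> where e: "\<epsilon> > 0" "\<And>y1 y2. y - \<epsilon> < y1 \<Longrightarrow> y1 < y \<Longrightarrow> y < y2 \<Longrightarrow> y2 < y + \<epsilon> \<Longrightarrow>
      Fin (2 * u + 2 * v + 5) \<le> ext f y1 + ext f y2"
      using inf[OF y, of "2 * u + 2 * v + 5"] by blast
    obtain y1 y2 m n where w: "y - \<epsilon> < y1" "y1 < y" "y < y2" "y2 < y + \<epsilon>"
      "ext f y1 = Fin m" "m \<le> 2 * v + 2" "ext f y2 = Fin n" "n \<le> 2 * u + 2"
      by (rule not_ge_witness[OF ge e(1)])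
    then show False using e(2)[OF w(1-4)] by (simp add: Fin_le_iff)
  qed
  have "C' \<subseteq> C" using inf_germs by (auto simp: C'_def A_def)
  then have cC: "countable C'" using C(1) countable_subset by blast
  have exC: "\<exists>x\<in>{x0..x1}. G x = y" if "y \<in> C'" for y
  proof -
    have "card {x \<in> {x0..x1}. G x = y} \<noteq> 0" using G(6)[of y] that by (simp add: C'_def A_def)
    then have "{x \<in> {x0..x1}. G x = y} \<noteq> {}" by (metis card.empty)
    then show ?thesis by blast
  qed
  obtain F :: "real \<Rightarrow> real" where F: "continuous_on {0..1} F" "F ` {0..1} \<subseteq> {0..1}" "F 0 = 0" "F 1 = 1"
    "\<And>y. y \<notin> C' \<Longrightarrow> {x \<in> {x0..x1}. G x = y} \<approx> {x \<in> {0..1}. F x = y}"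
    "\<And>y. y \<in> C' \<Longrightarrow> (UNIV :: nat set set) \<lesssim> {x \<in> {0..1}. F x = y}"
    by (rule insert_flats[OF G(1-5) cC exC]) blast+
  have "has_card {x \<in> {0..1}. F x = y} (f y)" if y: "y \<in> {0..1}" for y
  proof (cases "y \<in> C'")
    case True
    then have "f y = Continuum" by (simp add: C'_def A_def)
    then show ?thesis using has_card_ContinuumI[OF F(6)[OF True]] by simp
  next
    case False
    have "has_card {x \<in> {x0..x1}. G x = y} (f y)"
    proof (cases "f y")
      case (Fin k)
      then have "finite {j. r y j}" "finite {j. l y j}" "1 + card {j. r y j} + card {j. l y j} = k"
        using rl(6)[of y] y by (auto simp: ext_def)
      then show ?thesis using G(6)[OF y] Fin by simp
    next
      case Aleph0
      then have "y \<notin> C" "y \<notin> A" using C by (auto simp: A_def)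
      then have "infinite {x \<in> {x0..x1}. G x = y}" "countable {x \<in> {x0..x1}. G x = y}"
        using G(7) inf_germs[of y] G(8)[OF y] y Aleph0 by auto
      then show ?thesis using has_card_Aleph0I Aleph0 by metis
    next
      case Continuum
      then have "y \<in> A" using y by (simp add: A_def)
      then have "infinite {j. r y j} \<or> infinite {j. l y j}" using False by (auto simp: C'_def)
      then show ?thesis using has_card_ContinuumI[OF G(9)[OF y \<open>y \<in> A\<close>]] Continuum by metis
    qed
    then show ?thesis using has_card_eqpoll[OF F(5)[OF False]] by blast
  qed
  then have "\<forall>y\<in>{0..1}. has_card {x \<in> {0..1}. F x = y} (f y)" by blast
  then show ?thesis
    by (intro exI[of _ F] conjI F(1-4))
qed

section \<open>The conditions at the end values as two-sided conditions\<close>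

lemma finite_condition_iff:
  "((\<forall>y\<in>{0<..<1}. \<forall>k. f y = Fin k \<longrightarrow>
         (\<exists>\<epsilon>>0. \<forall>y1\<in>{0..1}. \<forall>y2\<in>{0..1}. y - \<epsilon> < y1 \<and> y1 < y \<and> y < y2 \<and> y2 < y + \<epsilon> \<longrightarrow>
            f y1 + f y2 \<ge> Fin (2 * k) \<and>
            (f y1 + f y2 = Fin (2 * k) \<longrightarrow> odd_card (f y1) \<or> odd_card (f y2)))) \<and>
      (\<forall>k. f 0 = Fin k \<longrightarrow>
         (\<exists>\<epsilon>>0. \<forall>y2\<in>{0..1}. 0 < y2 \<and> y2 < \<epsilon> \<longrightarrow> Fin 1 + f y2 \<ge> Fin (2 * k))) \<and>
      (\<forall>k. f 1 = Fin k \<longrightarrow>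
         (\<exists>\<epsilon>>0. \<forall>y1\<in>{0..1}. 1 - \<epsilon> < y1 \<and> y1 < 1 \<longrightarrow> f y1 + Fin 1 \<ge> Fin (2 * k)))) \<longleftrightarrow>
   (\<forall>y\<in>{0..1::real}. \<forall>k. f y = Fin k \<longrightarrow>
     (\<exists>\<epsilon>>0. \<forall>y1 y2. y - \<epsilon> < y1 \<and> y1 < y \<and> y < y2 \<and> y2 < y + \<epsilon> \<longrightarrow>
        Fin (2 * k) \<le> ext f y1 + ext f y2 \<and>
        (ext f y1 + ext f y2 = Fin (2 * k) \<longrightarrow> odd_card (ext f y1) \<or> odd_card (ext f y2))))"
    (is "?L1 \<and> ?L2 \<and> ?L3 \<longleftrightarrow> (\<forall>y\<in>{0..1}. \<forall>k. f y = Fin k \<longrightarrow> ?E y k)")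
proof -
  \<comment> \<open>The outer neighbour of an end value counts \<open>1\<close>, an odd number, so
    the equality clause holds there automatically and is absent from the one-sided
    conditions.\<close>
  have odd1: "odd_card (Fin 1)" by (simp add: odd_card_def)
  let ?Q = "\<lambda>k a b. Fin (2 * k) \<le> a + b \<and> (a + b = Fin (2 * k) \<longrightarrow> odd_card a \<or> odd_card b)"
  have split: "{0..1::real} = insert 0 (insert 1 {0<..<1})" by auto
  have ball: "(\<forall>y\<in>{0..1::real}. R y) \<longleftrightarrow> (\<forall>y\<in>{0<..<1}. R y) \<and> R 0 \<and> R 1" for R
    unfolding split by blast
  have 0: "?E 0 k \<longleftrightarrow> (\<exists>\<epsilon>>0. \<forall>y2\<in>{0..1}. 0 < y2 \<and> y2 < \<epsilon> \<longrightarrow> Fin (2 * k) \<le> Fin 1 + f y2)" for k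
    using ext_iff[of 0 "?Q k" f] odd1 by simp
  have 1: "?E 1 k \<longleftrightarrow> (\<exists>\<epsilon>>0. \<forall>y1\<in>{0..1}. 1 - \<epsilon> < y1 \<and> y1 < 1 \<longrightarrow> Fin (2 * k) \<le> f y1 + Fin 1)" for k
    using ext_iff[of 1 "?Q k" f] odd1 by simp
  have 2: "?E y k \<longleftrightarrow> (\<exists>\<epsilon>>0. \<forall>y1\<in>{0..1}. \<forall>y2\<in>{0..1}. y - \<epsilon> < y1 \<and> y1 < y \<and> y < y2 \<and> y2 < y + \<epsilon> \<longrightarrow>
      ?Q k (f y1) (f y2))" if "y \<in> {0<..<1}" for y k
    using ext_iff[of y "?Q k" f] that by simp
  have L1: "?L1 \<longleftrightarrow> (\<forall>y\<in>{0<..<1}. \<forall>k. f y = Fin k \<longrightarrow> ?E y k)"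
    by (intro ball_cong refl all_cong1 imp_cong 2[symmetric])
  have L2: "?L2 \<longleftrightarrow> (\<forall>k. f 0 = Fin k \<longrightarrow> ?E 0 k)"
    by (intro all_cong1 imp_cong refl 0[symmetric])
  have L3: "?L3 \<longleftrightarrow> (\<forall>k. f 1 = Fin k \<longrightarrow> ?E 1 k)"
    by (intro all_cong1 imp_cong refl 1[symmetric])
  show ?thesis
    unfolding L1 L2 L3 by (rule ball[where R = "\<lambda>y. \<forall>k. f y = Fin k \<longrightarrow> ?E y k", symmetric])
qed

lemma infinite_condition_iff:
  assumes y: "y \<in> {0..1::real} - C"
  shows "(\<exists>\<epsilon>>0.
            (y \<in> {0<..<1} \<longrightarrow>
               (\<forall>y1\<in>{0..1}. \<forall>y2\<in>{0..1}. y - \<epsilon> < y1 \<and> y1 < y \<and> y < y2 \<and> y2 < y + \<epsilon> \<longrightarrow>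
                  f y1 + f y2 \<ge> Fin n)) \<and>
            (y = 0 \<longrightarrow> (\<forall>y2\<in>{0..1}. 0 < y2 \<and> y2 < \<epsilon> \<longrightarrow> Fin 1 + f y2 \<ge> Fin n)) \<and>
            (y = 1 \<longrightarrow> (\<forall>y1\<in>{0..1}. 1 - \<epsilon> < y1 \<and> y1 < 1 \<longrightarrow> f y1 + Fin 1 \<ge> Fin n))) \<longleftrightarrow>
    (\<exists>\<epsilon>>0. \<forall>y1 y2. y - \<epsilon> < y1 \<and> y1 < y \<and> y < y2 \<and> y2 < y + \<epsilon> \<longrightarrow> Fin n \<le> ext f y1 + ext f y2)"
proof -
  have "y = 0 \<or> y = 1 \<or> y \<in> {0<..<1} \<and> y \<noteq> 0 \<and> y \<noteq> 1" using y by auto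
  moreover have "y \<in> {0..1}" using y by blast
  ultimately show ?thesis
    unfolding ext_iff[OF \<open>y \<in> {0..1}\<close>, of "\<lambda>a b. Fin n \<le> a + b" f] by (elim disjE) simp_all
qed

theorem theorem1:
  fixes f :: "real \<Rightarrow> cardval"
  assumes "f ` {0..1} \<subseteq> {Fin n |n. n \<ge> 1} \<union> {Aleph0, Continuum}"
  shows
    "(\<exists>F :: real \<Rightarrow> real. continuous_on {0..1} F \<and> F ` {0..1} \<subseteq> {0..1} \<and> F 0 = 0 \<and> F 1 = 1 \<and>
        (\<forall>y\<in>{0..1}. has_card {x \<in> {0..1}. F x = y} (f y)))
     \<longleftrightarrow>
     ((\<forall>y\<in>{0<..<1}. \<forall>k. f y = Fin k \<longrightarrow>
         (\<exists>\<epsilon>>0. \<forall>y1\<in>{0..1}. \<forall>y2\<in>{0..1}. y - \<epsilon> < y1 \<and> y1 < y \<and> y < y2 \<and> y2 < y + \<epsilon> \<longrightarrow>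
            f y1 + f y2 \<ge> Fin (2 * k) \<and>
            (f y1 + f y2 = Fin (2 * k) \<longrightarrow> odd_card (f y1) \<or> odd_card (f y2)))) \<and>
      (\<forall>k. f 0 = Fin k \<longrightarrow>
         (\<exists>\<epsilon>>0. \<forall>y2\<in>{0..1}. 0 < y2 \<and> y2 < \<epsilon> \<longrightarrow> Fin 1 + f y2 \<ge> Fin (2 * k))) \<and>
      (\<forall>k. f 1 = Fin k \<longrightarrow>
         (\<exists>\<epsilon>>0. \<forall>y1\<in>{0..1}. 1 - \<epsilon> < y1 \<and> y1 < 1 \<longrightarrow> f y1 + Fin 1 \<ge> Fin (2 * k))))
     \<and>
     (\<exists>C. countable C \<and> C \<subseteq> {y \<in> {0..1}. f y = Continuum} \<and>
        (\<forall>y\<in>{0..1} - C. f y \<in> {Aleph0, Continuum} \<longrightarrow>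
          (\<forall>n. \<exists>\<epsilon>>0.
            (y \<in> {0<..<1} \<longrightarrow>
               (\<forall>y1\<in>{0..1}. \<forall>y2\<in>{0..1}. y - \<epsilon> < y1 \<and> y1 < y \<and> y < y2 \<and> y2 < y + \<epsilon> \<longrightarrow>
                  f y1 + f y2 \<ge> Fin n)) \<and>
            (y = 0 \<longrightarrow> (\<forall>y2\<in>{0..1}. 0 < y2 \<and> y2 < \<epsilon> \<longrightarrow> Fin 1 + f y2 \<ge> Fin n)) \<and>
            (y = 1 \<longrightarrow> (\<forall>y1\<in>{0..1}. 1 - \<epsilon> < y1 \<and> y1 < 1 \<longrightarrow> f y1 + Fin 1 \<ge> Fin n)))))
     \<and>
     analytic_set {y \<in> {0..1}. f y = Continuum}"
proof -
  let ?ext = "\<lambda>Q y. \<exists>\<epsilon>>0. \<forall>y1 y2. y - \<epsilon> < y1 \<and> y1 < y \<and> y < y2 \<and> y2 < y + \<epsilon> \<longrightarrow> Q (ext f y1) (ext f y2)"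
  let ?fin = "\<forall>y\<in>{0..1}. \<forall>k. f y = Fin k \<longrightarrow>
    ?ext (\<lambda>a b. Fin (2 * k) \<le> a + b \<and> (a + b = Fin (2 * k) \<longrightarrow> odd_card a \<or> odd_card b)) y"
  let ?inf = "\<exists>C. countable C \<and> C \<subseteq> {y \<in> {0..1}. f y = Continuum} \<and>
    (\<forall>y\<in>{0..1} - C. f y \<in> {Aleph0, Continuum} \<longrightarrow> (\<forall>n. ?ext (\<lambda>a b. Fin n \<le> a + b) y))"
  let ?fun = "\<exists>F :: real \<Rightarrow> real. continuous_on {0..1} F \<and> F ` {0..1} \<subseteq> {0..1} \<and> F 0 = 0 \<and> F 1 = 1 \<and>
        (\<forall>y\<in>{0..1}. has_card {x \<in> {0..1}. F x = y} (f y))"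
  have "?fun \<longleftrightarrow> ?fin \<and> ?inf \<and> analytic_set {y \<in> {0..1}. f y = Continuum}"
  proof
    assume ?fun
    then obtain F :: "real \<Rightarrow> real" where F: "continuous_on {0..1} F" "F ` {0..1} \<subseteq> {0..1}" "F 0 = 0" "F 1 = 1"
      "\<And>y. y \<in> {0..1} \<Longrightarrow> has_card {x \<in> {0..1}. F x = y} (f y)"
      by blast
    interpret level_cards F f
      by unfold_locales (use F in auto)
    show "?fin \<and> ?inf \<and> analytic_set {y \<in> {0..1}. f y = Continuum}"
    proof (intro conjI)
      show ?fin using finite_level by blast
      show ?inf
        by (intro exI[of _ flat_values] conjI countable_flat_values flat_values_continuum)
          (use infinite_level in blast)
    qed (rule analytic_continuum)
  next
    assume R: "?fin \<and> ?inf \<and> analytic_set {y \<in> {0..1}. f y = Continuum}"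
    then obtain C where C: "countable C" "C \<subseteq> {y \<in> {0..1}. f y = Continuum}"
      "\<forall>y\<in>{0..1} - C. f y \<in> {Aleph0, Continuum} \<longrightarrow> (\<forall>n. ?ext (\<lambda>a b. Fin n \<le> a + b) y)"
      by (elim conjE exE)
    show ?fun
    proof (rule level_function_exists[OF assms _ C(1,2)])
      show "?ext (\<lambda>a b. Fin (2 * k) \<le> a + b \<and> (a + b = Fin (2 * k) \<longrightarrow> odd_card a \<or> odd_card b)) y"
        if "y \<in> {0..1}" "f y = Fin k" for y k
        using R that by blast
      show "?ext (\<lambda>a b. Fin n \<le> a + b) y" if "y \<in> {0..1} - C" "f y \<in> {Aleph0, Continuum}" for y n
        using C(3) that by blast
    qed (use R in blast)
  qed
  then show ?thesis
    by (simp only: finite_condition_iff infinite_condition_iff cong: ball_cong)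
qed

end
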